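(* Let $(M,g)$ be a smooth Riemannian surface and let $p_0\in M$ be a point with $dK\ne0$ at $p_0$. Then $\dim\mathcal J_2=4$ (the geodesic flow has locally exactly 4 linearly independent quadratic integrals, the Hamiltonian included) if and only if the three differential conditions $$I_{4b}=0,\qquad J_5=0,\qquad J_4=0$$ hold identically in a neighbourhood of $p_0$, where $$J_5=5I_3(I_{5a}-I_{5c})+(I_{4a}-I_{4c})(I_{4c}-6I_{4a})-25I_2I_3^3,$$ $$J_4=3(I_{4a}-I_{4c})(I_{4a}+4I_{4c})I_{4c}-15I_2I_3^3(I_{4a}+4I_{4c})+25I_3^5.$$
   Context: Let $H=\sum g^{ij}p_ip_j$ be the Hamiltonian of the geodesic flow of $g$ on $T^*M$. Everything is local: $\mathcal J_n=\mathcal J_n(g)$ denotes the real vector space of germs at $p_0$ of integrals homogeneous of degree $n$ in momenta, i.e. of functions $F=\sum_{i+j=n}u_{ij}(x,y)p_x^ip_y^j$ defined on $T^*U$ for some neighbourhood $U$ of $p_0$, with smooth $u_{ij}$, such that $\{H,F\}=0$ (canonical Poisson bracket). Differential invariants: $K$ is the Gaussian curvature, $\nabla$ the Levi-Civita connection, $\operatorname{grad}K$ the $g$-gradient of $K$, and $\operatorname{sgrad}K$ its rotation by $\pi/2$ (a local orientation is fixed). Put $d_\nabla^{\otimes1}K=dK$ and $(d_\nabla^{\otimes l}K)(\xi_1,\dots,\xi_l)=(\nabla_{\xi_1}d_\nabla^{\otimes(l-1)}K)(\xi_2,\dots,\xi_l)$. Set $I_2=K$, $I_3=|\operatorname{grad}K|^2$,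 and for $i=l+2\ge4$, $0\le j\le l$, $$I_{ij}=d_\nabla^{\otimes l}K(\underbrace{\operatorname{grad}K,\dots,\operatorname{grad}K}_{l-j},\underbrace{\operatorname{sgrad}K,\dots,\operatorname{sgrad}K}_{j}),$$ with the index $j=0,1,2,3,\dots$ written as a letter $a,b,c,d,\dots$ (e.g. $I_{4a}=I_{40}$, $I_{4b}=I_{41}$, $I_{5c}=I_{52}$). *)

theory Defs
  imports "HOL-Analysis.Analysis"
begin

section \<open>Smooth functions on open subsets of the plane\<close>

definition pd :: "2 \<Rightarrow> (real^2 \<Rightarrow> real) \<Rightarrow> real^2 \<Rightarrow> real" where
  "pd i f x = frechet_derivative f (at x) (axis i 1)"

text \<open>On an open set, differentiability of all iterated partial derivatives amounts to
  being of class C-infinity (differentiability implies continuity).\<close>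

definition smooth_on :: "(real^2) set \<Rightarrow> (real^2 \<Rightarrow> real) \<Rightarrow> bool" where
  "smooth_on S f \<longleftrightarrow> (\<forall>is :: 2 list. (foldr pd is f) differentiable_on S)"


section \<open>Smooth Riemannian surfaces\<close>

type_synonym 'a chart = "'a set \<times> ('a \<Rightarrow> real^2)"

definition transition :: "'a chart \<Rightarrow> 'a chart \<Rightarrow> real^2 \<Rightarrow> real^2" where
  "transition c d = snd d \<circ> inv_into (fst c) (snd c)"

definition overlap :: "'a chart \<Rightarrow> 'a chart \<Rightarrow> (real^2) set" where
  "overlap c d = snd c ` (fst c \<inter> fst d)"

definition smooth_surface :: "'a topology \<Rightarrow> 'a chart set \<Rightarrow> bool" where
  "smooth_surface M A \<longleftrightarrow>
     Hausdorff_space M \<and> second_countable M \<and>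
     (\<Union>c\<in>A. fst c) = topspace M \<and>
     (\<forall>(U, \<phi>)\<in>A. openin M U \<and> open (\<phi> ` U) \<and>
        homeomorphic_map (subtopology M U) (top_of_set (\<phi> ` U)) \<phi>) \<and>
     (\<forall>c\<in>A. \<forall>d\<in>A. \<forall>i. smooth_on (overlap c d) (\<lambda>x. transition c d x $ i))"

text \<open>A metric is given by its Gram matrix in each chart, as a function of the coordinates
  of that chart.\<close>

type_synonym metric = "real^2 \<Rightarrow> real^2^2"

definition riemannian_metric :: "'a chart set \<Rightarrow> ('a chart \<Rightarrow> metric) \<Rightarrow> bool" where
  "riemannian_metric A g \<longleftrightarrow>
     (\<forall>c\<in>A. (\<forall>i j. smooth_on (snd c ` fst c) (\<lambda>x. g c x $ i $ j)) \<and>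
        (\<forall>x\<in>snd c ` fst c. transpose (g c x) = g c x \<and>
           (\<forall>v. v \<noteq> 0 \<longrightarrow> v \<bullet> (g c x *v v) > 0))) \<and>
     (\<forall>c\<in>A. \<forall>d\<in>A. \<forall>x\<in>overlap c d.
        (let D = matrix (frechet_derivative (transition c d) (at x))
         in g c x = transpose D ** g d (transition c d x) ** D))"


section \<open>Levi-Civita connection and Gaussian curvature in a chart\<close>

definition christoffel :: "metric \<Rightarrow> real^2 \<Rightarrow> 2 \<Rightarrow> 2 \<Rightarrow> 2 \<Rightarrow> real" where
  "christoffel g x k i j = (1/2) * (\<Sum>l\<in>UNIV. matrix_inv (g x) $ k $ l *
     (pd i (\<lambda>y. g y $ j $ l) x + pd j (\<lambda>y. g y $ i $ l) x - pd l (\<lambda>y. g y $ i $ j) x))"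

text \<open>The component \<open>l\<close> of \<open>R(\<partial>\<^sub>i, \<partial>\<^sub>j) \<partial>\<^sub>k\<close>, for
  \<open>R(X, Y) = \<nabla>\<^sub>X \<nabla>\<^sub>Y - \<nabla>\<^sub>Y \<nabla>\<^sub>X - \<nabla>\<^bsub>[X, Y]\<^esub>\<close>.\<close>

definition riemann :: "metric \<Rightarrow> real^2 \<Rightarrow> 2 \<Rightarrow> 2 \<Rightarrow> 2 \<Rightarrow> 2 \<Rightarrow> real" where
  "riemann g x l k i j =
     pd i (\<lambda>y. christoffel g y l j k) x - pd j (\<lambda>y. christoffel g y l i k) x +
     (\<Sum>m\<in>UNIV. christoffel g x l i m * christoffel g x m j k
              - christoffel g x l j m * christoffel g x m i k)"

definition gauss_curvature :: "metric \<Rightarrow> real^2 \<Rightarrow> real" where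
  "gauss_curvature g x = (\<Sum>l\<in>UNIV. riemann g x l 2 1 2 * g x $ l $ 1) / det (g x)"

text \<open>\<open>\<nabla>\<^sub>v w\<close> at \<open>x\<close> for the vector fields with constant components \<open>v\<close>, \<open>w\<close>.\<close>

definition nabla_const :: "metric \<Rightarrow> real^2 \<Rightarrow> real^2 \<Rightarrow> real^2 \<Rightarrow> real^2" where
  "nabla_const g x v w = (\<chi> k. \<Sum>i\<in>UNIV. \<Sum>j\<in>UNIV. christoffel g x k i j * v $ i * w $ j)"

text \<open>A covariant tensor field of degree \<open>l\<close> takes a point and a list of \<open>l\<close> tangent vectors.
  The Leibniz rule is applied to extensions of the arguments with constant components; the
  direction of differentiation becomes the first argument.\<close>

fun cov_diff :: "metric \<Rightarrow> (real^2 \<Rightarrow> (real^2) list \<Rightarrow> real) \<Rightarrow> real^2 \<Rightarrow> (real^2) list \<Rightarrow> real" where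
  "cov_diff g T x [] = 0"
| "cov_diff g T x (v # vs) = frechet_derivative (\<lambda>y. T y vs) (at x) v
     - (\<Sum>m<length vs. T x (vs[m := nabla_const g x v (vs ! m)]))"

definition d_nabla :: "metric \<Rightarrow> nat \<Rightarrow> (real^2 \<Rightarrow> real) \<Rightarrow> real^2 \<Rightarrow> (real^2) list \<Rightarrow> real" where
  "d_nabla g l f = (cov_diff g ^^ l) (\<lambda>x _. f x)"


section \<open>Differential invariants\<close>

definition gradient :: "metric \<Rightarrow> (real^2 \<Rightarrow> real) \<Rightarrow> real^2 \<Rightarrow> real^2" where
  "gradient g f x = matrix_inv (g x) *v (\<chi> i. pd i f x)"

text \<open>The real number \<open>\<epsilon>\<close> is \<open>1\<close> if the coordinates are positively oriented and \<open>-1\<close> otherwise.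
  The rotation of \<open>v\<close> by \<open>\<pi>/2\<close> is the vector \<open>w\<close> with \<open>g(w, \<cdot>) = \<epsilon> sqrt(det g) det(v, \<cdot>)\<close>, the
  right-hand side being the area form applied to \<open>v\<close>.\<close>

definition rotate_right_angle :: "metric \<Rightarrow> real \<Rightarrow> real^2 \<Rightarrow> real^2 \<Rightarrow> real^2" where
  "rotate_right_angle g \<epsilon> x v =
     (\<epsilon> / sqrt (det (g x))) *\<^sub>R vector [- ((g x *v v) $ 2), (g x *v v) $ 1]"

definition gradK :: "metric \<Rightarrow> real^2 \<Rightarrow> real^2" where
  "gradK g x = gradient g (gauss_curvature g) x"

definition sgradK :: "metric \<Rightarrow> real \<Rightarrow> real^2 \<Rightarrow> real^2" where
  "sgradK g \<epsilon> x = rotate_right_angle g \<epsilon> x (gradK g x)"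

definition I2 :: "metric \<Rightarrow> real^2 \<Rightarrow> real" where
  "I2 g x = gauss_curvature g x"

definition I3 :: "metric \<Rightarrow> real^2 \<Rightarrow> real" where
  "I3 g x = gradK g x \<bullet> (g x *v gradK g x)"

definition Inv :: "metric \<Rightarrow> real \<Rightarrow> nat \<Rightarrow> nat \<Rightarrow> real^2 \<Rightarrow> real" where
  "Inv g \<epsilon> i j x = (let l = i - 2 in
     d_nabla g l (gauss_curvature g) x
       (replicate (l - j) (gradK g x) @ replicate j (sgradK g \<epsilon> x)))"

abbreviation "I4a g \<epsilon> \<equiv> Inv g \<epsilon> 4 0"
abbreviation "I4b g \<epsilon> \<equiv> Inv g \<epsilon> 4 1"
abbreviation "I4c g \<epsilon> \<equiv> Inv g \<epsilon> 4 2"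
abbreviation "I5a g \<epsilon> \<equiv> Inv g \<epsilon> 5 0"
abbreviation "I5c g \<epsilon> \<equiv> Inv g \<epsilon> 5 2"

definition J5 :: "metric \<Rightarrow> real \<Rightarrow> real^2 \<Rightarrow> real" where
  "J5 g \<epsilon> x = 5 * I3 g x * (I5a g \<epsilon> x - I5c g \<epsilon> x)
     + (I4a g \<epsilon> x - I4c g \<epsilon> x) * (I4c g \<epsilon> x - 6 * I4a g \<epsilon> x)
     - 25 * I2 g x * I3 g x ^ 3"

definition J4 :: "metric \<Rightarrow> real \<Rightarrow> real^2 \<Rightarrow> real" where
  "J4 g \<epsilon> x = 3 * (I4a g \<epsilon> x - I4c g \<epsilon> x) * (I4a g \<epsilon> x + 4 * I4c g \<epsilon> x) * I4c g \<epsilon> x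
     - 15 * I2 g x * I3 g x ^ 3 * (I4a g \<epsilon> x + 4 * I4c g \<epsilon> x)
     + 25 * I3 g x ^ 5"


section \<open>Germs of functions on the cotangent bundle\<close>

text \<open>A function on the cotangent bundle of a coordinate domain is written \<open>F x p\<close>, with position
  \<open>x\<close> and momentum \<open>p\<close>. Germs are local in the position only: two functions agree if they agree
  on all fibres over some neighbourhood. The type consists of germs at the origin; germs at other
  points are obtained by translation.\<close>

quotient_type fibre_germ = "real^2 \<Rightarrow> real^2 \<Rightarrow> real" /
    "\<lambda>F G. \<forall>\<^sub>F x in nhds 0. F x = G x"
  by (rule equivpI; auto simp: reflp_def symp_def transp_def elim: eventually_elim2 eventually_mono)

instantiation fibre_germ :: real_vector
begin

lift_definition zero_fibre_germ :: fibre_germ is "\<lambda>_ _. 0" .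

lift_definition plus_fibre_germ :: "fibre_germ \<Rightarrow> fibre_germ \<Rightarrow> fibre_germ"
  is "\<lambda>F G x p. F x p + G x p"
  by (auto elim: eventually_elim2)

lift_definition minus_fibre_germ :: "fibre_germ \<Rightarrow> fibre_germ \<Rightarrow> fibre_germ"
  is "\<lambda>F G x p. F x p - G x p"
  by (auto elim: eventually_elim2)

lift_definition uminus_fibre_germ :: "fibre_germ \<Rightarrow> fibre_germ" is "\<lambda>F x p. - F x p"
  by (auto elim: eventually_mono)

lift_definition scaleR_fibre_germ :: "real \<Rightarrow> fibre_germ \<Rightarrow> fibre_germ" is "\<lambda>r F x p. r * F x p"
  by (auto elim: eventually_mono)

instance
  by standard (transfer; simp add: algebra_simps)+

end

definition germ_at :: "real^2 \<Rightarrow> (real^2 \<Rightarrow> real^2 \<Rightarrow> real) \<Rightarrow> fibre_germ" where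
  "germ_at a F = abs_fibre_germ (\<lambda>h. F (a + h))"


section \<open>Integrals of the geodesic flow\<close>

definition poisson ::
  "(real^2 \<Rightarrow> real^2 \<Rightarrow> real) \<Rightarrow> (real^2 \<Rightarrow> real^2 \<Rightarrow> real) \<Rightarrow> real^2 \<Rightarrow> real^2 \<Rightarrow> real" where
  "poisson H F x p = (\<Sum>i\<in>UNIV. pd i (\<lambda>y. H y p) x * pd i (F x) p
                             - pd i (H x) p * pd i (\<lambda>y. F y p) x)"

definition hamiltonian :: "metric \<Rightarrow> real^2 \<Rightarrow> real^2 \<Rightarrow> real" where
  "hamiltonian g x p = (\<Sum>i\<in>UNIV. \<Sum>j\<in>UNIV. matrix_inv (g x) $ i $ j * p $ i * p $ j)"

text \<open>The germs at \<open>a\<close> of the integrals homogeneous of degree \<open>n\<close> in momenta, where the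
  metric is defined on the open set \<open>V\<close>. The function \<open>u i\<close> is the coefficient of
  \<open>p\<^sub>x\<^sup>i p\<^sub>y\<^sup>n\<^sup>-\<^sup>i\<close>.\<close>

definition integral_germs :: "nat \<Rightarrow> (real^2) set \<Rightarrow> metric \<Rightarrow> real^2 \<Rightarrow> fibre_germ set" where
  "integral_germs n V g a = {germ_at a F | F.
     \<exists>W u. open W \<and> a \<in> W \<and> W \<subseteq> V \<and> (\<forall>i\<le>n. smooth_on W (u i)) \<and>
       (\<forall>x\<in>W. \<forall>p. F x p = (\<Sum>i\<le>n. u i x * p $ 1 ^ i * p $ 2 ^ (n - i))) \<and>
       (\<forall>x\<in>W. \<forall>p. poisson (hamiltonian g) F x p = 0)}"

end

theory Submission
  imports Defs
begin

text \<open>Let \<open>e\<^sub>1\<close> and \<open>e\<^sub>2\<close> be the unit vectors along \<open>grad K\<close> and \<open>sgrad K\<close>, \<open>k = |grad K|\<close>, and let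
  \<open>a\<close>, \<open>b\<close> be the connection coefficients, \<open>\<nabla>\<^bsub>e\<^sub>1\<^esub>e\<^sub>1 = a e\<^sub>2\<close>, \<open>\<nabla>\<^bsub>e\<^sub>2\<^esub>e\<^sub>1 = b e\<^sub>2\<close>. Write a quadratic integral as
  \<open>A p\<^sub>1\<^sup>2 + 2 B p\<^sub>1 p\<^sub>2 + C p\<^sub>2\<^sup>2\<close> and put \<open>T = A - C\<close>, \<open>X = e\<^sub>1 B\<close>, \<open>Y = e\<^sub>2 B\<close>, \<open>S = e\<^sub>1 Y\<close>.
  Prolongation closes up the equation \<open>{H, F} = 0\<close> to a linear system for \<open>(T, B, X, Y, S, C)\<close>, whose
  compatibility condition \<open>5 k X + 4 a k T + (e\<^sub>1 k - b k) B = 0\<close> and its \<open>e\<^sub>2\<close>-derivative express \<open>X\<close> and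
  \<open>S\<close> through \<open>T, B, Y\<close>. Hence an integral is determined by the values of \<open>(T, B, Y, C)\<close> at one
  point, and the dimension is 4 iff these values can be prescribed arbitrarily at every point near \<open>p\<^sub>0\<close>.
  In that case the \<open>e\<^sub>1\<close>-derivative of the compatibility condition gives \<open>a = 0\<close> (this is \<open>I\<^sub>4\<^sub>b = 0\<close>) and
  \<open>J\<^sub>5 = 0\<close>, and its second \<open>e\<^sub>2\<close>-derivative gives \<open>J\<^sub>4 = 0\<close>.

  Conversely, \<open>J\<^sub>4 = 0\<close> is a cubic equation for \<open>b\<close> whose coefficients are constant along \<open>e\<^sub>2\<close>, so
  \<open>e\<^sub>2 b = 0\<close>; the metric then has a Killing field \<open>f e\<^sub>2\<close>, and separation of variables
  \<open>B = m c(\<theta>)\<close> with \<open>e\<^sub>2 \<theta> = 1/f\<close> reduces everything to \<open>c'' = - \<nu> c\<close>, where \<open>\<nu>\<close> is constant by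
  \<open>J\<^sub>4 = J\<^sub>5 = 0\<close>, and to integrating closed 1-forms.\<close>

section \<open>Calculus of smooth functions on open subsets of the plane\<close>

lemma pd_eqI: "(f has_derivative f') (at x) \<Longrightarrow> pd i f x = f' (axis i 1)"
  unfolding pd_def by (metis frechet_derivative_at)

lemma smooth_on_differentiable: "smooth_on S f \<Longrightarrow> f differentiable_on S"
  unfolding smooth_on_def by (metis foldr.simps(1) id_apply)

lemma smooth_on_differentiable_at:
  "smooth_on S f \<Longrightarrow> open S \<Longrightarrow> x \<in> S \<Longrightarrow> f differentiable (at x)"
  using smooth_on_differentiable differentiable_on_eq_differentiable_at by blast

lemma smooth_on_pd: "smooth_on S f \<Longrightarrow> smooth_on S (pd i f)"
  unfolding smooth_on_def
proof (intro allI)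
  fix "is" :: "2 list"
  assume "\<forall>is. foldr pd is f differentiable_on S"
  then have "foldr pd (is @ [i]) f differentiable_on S" by blast
  then show "foldr pd is (pd i f) differentiable_on S" by simp
qed

lemma smooth_on_subset: "smooth_on S f \<Longrightarrow> T \<subseteq> S \<Longrightarrow> smooth_on T f"
  unfolding smooth_on_def using differentiable_on_subset by blast

lemma smooth_on_continuous: "smooth_on S f \<Longrightarrow> continuous_on S f"
  by (simp add: differentiable_imp_continuous_on smooth_on_differentiable)

text \<open>\<open>frechet_derivative\<close> chooses some derivative. Both functions have exactly
  the same derivatives at \<open>x\<close>, so the two choices coincide, even at points where there
  is nothing to choose from.\<close>

lemma frechet_derivative_cong_open:
  assumes "open S" "x \<in> S" "\<And>y. y \<in> S \<Longrightarrow> f y = g y"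
  shows "frechet_derivative f (at x) = frechet_derivative g (at x)"
proof -
  have "(f has_derivative f') (at x) \<longleftrightarrow> (g has_derivative f') (at x)" for f'
    using has_derivative_transform_within_open[of f f' x UNIV S g]
      has_derivative_transform_within_open[of g f' x UNIV S f] assms by auto
  then show ?thesis by (simp add: frechet_derivative_def)
qed

lemma pd_cong_open:
  assumes "open S" "x \<in> S" "\<And>y. y \<in> S \<Longrightarrow> f y = g y"
  shows "pd i f x = pd i g x"
  unfolding pd_def using frechet_derivative_cong_open[OF assms] by simp

lemma differentiable_on_cong_open:
  assumes "open S" "\<And>y. y \<in> S \<Longrightarrow> f y = g y" "g differentiable_on S"
  shows "f differentiable_on S"
  unfolding differentiable_on_eq_differentiable_at[OF assms(1)] differentiable_def
  using assms has_derivative_transform_within_open[of g _ _ UNIV S f]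
  by (metis differentiable_on_eq_differentiable_at differentiable_def)

text \<open>By induction on the list of directions, every iterated partial derivative agrees on
  \<open>S\<close> with some member of \<open>P\<close>. Agreement on the open set \<open>S\<close>
  is enough to pass to the next partial derivative.\<close>

lemma smooth_on_coinduct:
  assumes S: "open S" and "P f"
    and diff: "\<And>f. P f \<Longrightarrow> f differentiable_on S"
    and pd: "\<And>f i. P f \<Longrightarrow> \<exists>g. P g \<and> (\<forall>x\<in>S. pd i f x = g x)"
  shows "smooth_on S f"
proof -
  have "\<exists>h. P h \<and> (\<forall>x\<in>S. foldr pd is f x = h x)" for "is"
  proof (induction "is")
    case Nil
    then show ?case using \<open>P f\<close> by auto
  next
    case (Cons i "is")
    then obtain h where h: "P h" "\<forall>x\<in>S. foldr pd is f x = h x" by auto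
    obtain g where "P g" "\<forall>x\<in>S. pd i h x = g x" using pd[OF h(1)] by blast
    then show ?case using h pd_cong_open[OF S, of _ "foldr pd is f" h i] by fastforce
  qed
  then show ?thesis
    unfolding smooth_on_def using diff differentiable_on_cong_open[OF S] by meson
qed

section \<open>Differentiation rules and closure properties of smoothness\<close>

lemma frechet_derivative_add_at:
  fixes f g :: "real^2 \<Rightarrow> real"
  assumes "f differentiable (at x)" "g differentiable (at x)"
  shows "frechet_derivative (\<lambda>x. f x + g x) (at x) v =
    frechet_derivative f (at x) v + frechet_derivative g (at x) v"
proof -
  have "((\<lambda>x. f x + g x) has_derivative (\<lambda>v. frechet_derivative f (at x) v +
      frechet_derivative g (at x) v)) (at x)"
    using assms by (intro has_derivative_add) (simp_all flip: frechet_derivative_works)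
  then show ?thesis by (simp flip: frechet_derivative_at)
qed

lemma frechet_derivative_mult_at:
  fixes f g :: "real^2 \<Rightarrow> real"
  assumes "f differentiable (at x)" "g differentiable (at x)"
  shows "frechet_derivative (\<lambda>x. f x * g x) (at x) v =
    frechet_derivative f (at x) v * g x + f x * frechet_derivative g (at x) v"
proof -
  have "((\<lambda>x. f x * g x) has_derivative (\<lambda>v. f x * frechet_derivative g (at x) v +
      frechet_derivative f (at x) v * g x)) (at x)"
    using assms by (intro has_derivative_mult) (simp_all flip: frechet_derivative_works)
  then show ?thesis by (simp flip: frechet_derivative_at)
qed

lemma frechet_derivative_comp_real_at:
  fixes f :: "real^2 \<Rightarrow> real"
  assumes "f differentiable (at x)" "(h has_real_derivative h') (at (f x))"
  shows "frechet_derivative (\<lambda>x. h (f x)) (at x) v = frechet_derivative f (at x) v * h'"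
proof -
  have "((\<lambda>x. h (f x)) has_derivative (\<lambda>v. h' * frechet_derivative f (at x) v)) (at x)"
    using has_derivative_compose[of f "frechet_derivative f (at x)" x UNIV h "(*) h'"] assms
    by (simp add: has_field_derivative_def frechet_derivative_works)
  then show ?thesis by (simp flip: frechet_derivative_at)
qed

lemma frechet_derivative_inverse_at:
  fixes f :: "real^2 \<Rightarrow> real"
  assumes "f differentiable (at x)" "f x \<noteq> 0"
  shows "frechet_derivative (\<lambda>x. inverse (f x)) (at x) v =
    - (frechet_derivative f (at x) v * (inverse (f x) * inverse (f x)))"
  using frechet_derivative_comp_real_at[OF assms(1) DERIV_inverse[OF assms(2)]]
  by (simp add: power2_eq_square)

lemma frechet_derivative_ln_at:
  fixes f :: "real^2 \<Rightarrow> real"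
  assumes "f differentiable (at x)" "f x > 0"
  shows "frechet_derivative (\<lambda>x. ln (f x)) (at x) v = frechet_derivative f (at x) v / f x"
  using frechet_derivative_comp_real_at[OF assms(1) DERIV_ln[OF assms(2)]]
  by (simp add: divide_inverse)

text \<open>The invariant for the coinduction above: a class of expressions stable under partial
  derivatives. In \<open>comp\<close> a smooth function of one variable is encoded as a sequence
  \<open>c\<close> of successive derivatives, so that differentiating \<open>c n\<close> stays in
  the class. \<open>ln\<close> and \<open>inverse\<close> have rules of their own because they are
  differentiable on part of the line only.\<close>

inductive smooth_closure :: "(real^2) set \<Rightarrow> (real^2 \<Rightarrow> real) \<Rightarrow> bool" for S where
  base: "smooth_on S f \<Longrightarrow> smooth_closure S f"
| const: "smooth_closure S (\<lambda>x. c)"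
| add: "smooth_closure S f \<Longrightarrow> smooth_closure S g \<Longrightarrow> smooth_closure S (\<lambda>x. f x + g x)"
| mult: "smooth_closure S f \<Longrightarrow> smooth_closure S g \<Longrightarrow> smooth_closure S (\<lambda>x. f x * g x)"
| inverse: "smooth_closure S f \<Longrightarrow> (\<And>x. x \<in> S \<Longrightarrow> f x \<noteq> 0) \<Longrightarrow> smooth_closure S (\<lambda>x. inverse (f x))"
| ln: "smooth_closure S f \<Longrightarrow> (\<And>x. x \<in> S \<Longrightarrow> f x > 0) \<Longrightarrow> smooth_closure S (\<lambda>x. ln (f x))"
| comp: "smooth_closure S f \<Longrightarrow> (\<And>n t. (c n has_real_derivative c (Suc n) t) (at t)) \<Longrightarrow>
    smooth_closure S (\<lambda>x. c (n::nat) (f x))"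

lemma smooth_closure_differentiable:
  assumes "open S" "x \<in> S"
  shows "smooth_closure S f \<Longrightarrow> f differentiable (at x)"
proof (induction rule: smooth_closure.induct)
  case (base f)
  then show ?case using assms smooth_on_differentiable_at by blast
next
  case (inverse f)
  then show ?case using assms by (simp add: differentiable_inverse)
next
  case (ln f)
  then obtain f' where "(f has_derivative f') (at x)" by (auto simp: differentiable_def)
  then have "((\<lambda>x. ln (f x)) has_derivative (\<lambda>h. f' h * inverse (f x))) (at x)"
    using ln(2) assms by (auto intro!: derivative_eq_intros simp: field_simps)
  then show ?case by (auto simp: differentiable_def)
next
  case (comp f c n)
  then obtain f' where "(f has_derivative f') (at x)" by (auto simp: differentiable_def)
  then have "((\<lambda>x. c n (f x)) has_derivative (\<lambda>h. f' h * c (Suc n) (f x))) (at x)"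
    using has_derivative_compose[of f f' x UNIV "c n" "(*) (c (Suc n) (f x))"] comp(2)[of n "f x"]
    by (simp add: has_field_derivative_def mult.commute)
  then show ?case by (auto simp: differentiable_def)
qed auto

lemma smooth_closure_pd:
  assumes "open S"
  shows "smooth_closure S f \<Longrightarrow> \<exists>g. smooth_closure S g \<and> (\<forall>x\<in>S. pd i f x = g x)"
proof (induction rule: smooth_closure.induct)
  case (base f)
  then show ?case using smooth_closure.base smooth_on_pd by blast
next
  case (const c)
  have "pd i (\<lambda>x. c) x = 0" for x by (simp add: pd_def)
  then show ?case using smooth_closure.const by blast
next
  case (add f g)
  then obtain f' g' where *: "smooth_closure S f'" "\<forall>x\<in>S. pd i f x = f' x"
    "smooth_closure S g'" "\<forall>x\<in>S. pd i g x = g' x" by blast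
  show ?case
  proof (intro exI conjI ballI)
    show "smooth_closure S (\<lambda>x. f' x + g' x)" using * smooth_closure.add by blast
    show "pd i (\<lambda>x. f x + g x) x = f' x + g' x" if "x \<in> S" for x
      using smooth_closure_differentiable[OF assms that] add * that
      by (simp add: pd_def frechet_derivative_add_at)
  qed
next
  case (mult f g)
  then obtain f' g' where *: "smooth_closure S f'" "\<forall>x\<in>S. pd i f x = f' x"
    "smooth_closure S g'" "\<forall>x\<in>S. pd i g x = g' x" by blast
  show ?case
  proof (intro exI conjI ballI)
    show "smooth_closure S (\<lambda>x. f' x * g x + f x * g' x)"
      using * mult.hyps by (intro smooth_closure.add smooth_closure.mult)
    show "pd i (\<lambda>x. f x * g x) x = f' x * g x + f x * g' x" if "x \<in> S" for x
      using smooth_closure_differentiable[OF assms that] mult * that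
      by (simp add: pd_def frechet_derivative_mult_at)
  qed
next
  case (inverse f)
  then obtain f' where *: "smooth_closure S f'" "\<forall>x\<in>S. pd i f x = f' x" by blast
  show ?case
  proof (intro exI conjI ballI)
    show "smooth_closure S (\<lambda>x. (-1) * (f' x * (inverse (f x) * inverse (f x))))"
      using * inverse.hyps by (intro smooth_closure.const smooth_closure.mult smooth_closure.inverse)
    show "pd i (\<lambda>x. inverse (f x)) x = (-1) * (f' x * (inverse (f x) * inverse (f x)))"
      if "x \<in> S" for x
      using smooth_closure_differentiable[OF assms that] inverse * that
      by (simp add: pd_def frechet_derivative_inverse_at)
  qed
next
  case (ln f)
  then obtain f' where *: "smooth_closure S f'" "\<forall>x\<in>S. pd i f x = f' x" by blast
  show ?case
  proof (intro exI conjI ballI)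
    show "smooth_closure S (\<lambda>x. f' x * inverse (f x))"
      using * ln.hyps
      by (intro smooth_closure.mult smooth_closure.inverse) (auto simp: less_le)
    show "pd i (\<lambda>x. ln (f x)) x = f' x * inverse (f x)" if "x \<in> S" for x
      using smooth_closure_differentiable[OF assms that] ln * that
      by (simp add: pd_def frechet_derivative_ln_at divide_inverse)
  qed
next
  case (comp f c n)
  then obtain f' where *: "smooth_closure S f'" "\<forall>x\<in>S. pd i f x = f' x" by blast
  show ?case
  proof (intro exI conjI ballI)
    show "smooth_closure S (\<lambda>x. f' x * c (Suc n) (f x))"
      using * comp.hyps by (intro smooth_closure.mult[OF _ smooth_closure.comp[of S f c "Suc n"]])
    show "pd i (\<lambda>x. c n (f x)) x = f' x * c (Suc n) (f x)" if "x \<in> S" for x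
      using frechet_derivative_comp_real_at[OF smooth_closure_differentiable[OF assms that comp(1)] comp(2)]
        * that
      by (simp add: pd_def)
  qed
qed

lemma smooth_closure_iff_smooth_on:
  assumes "open S"
  shows "smooth_closure S f \<longleftrightarrow> smooth_on S f"
proof
  assume "smooth_closure S f"
  then show "smooth_on S f"
  proof (rule smooth_on_coinduct[where P = "smooth_closure S", OF assms])
    show "f differentiable_on S" if "smooth_closure S f" for f
      using smooth_closure_differentiable[OF assms _ that]
      by (simp add: differentiable_on_eq_differentiable_at assms)
    show "\<exists>g. smooth_closure S g \<and> (\<forall>x\<in>S. pd i f x = g x)" if "smooth_closure S f" for f i
      using smooth_closure_pd[OF assms that] .
  qed
qed (rule smooth_closure.base)

lemma smooth_on_const [simp]: "open S \<Longrightarrow> smooth_on S (\<lambda>x. c)"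
  using smooth_closure.const[of S c] by (simp add: smooth_closure_iff_smooth_on)

lemma smooth_on_add [simp]:
  "open S \<Longrightarrow> smooth_on S f \<Longrightarrow> smooth_on S g \<Longrightarrow> smooth_on S (\<lambda>x. f x + g x)"
  using smooth_closure.add[of S f g] by (simp add: smooth_closure_iff_smooth_on)

lemma smooth_on_mult [simp]:
  "open S \<Longrightarrow> smooth_on S f \<Longrightarrow> smooth_on S g \<Longrightarrow> smooth_on S (\<lambda>x. f x * g x)"
  using smooth_closure.mult[of S f g] by (simp add: smooth_closure_iff_smooth_on)

lemma smooth_on_minus [simp]: "open S \<Longrightarrow> smooth_on S f \<Longrightarrow> smooth_on S (\<lambda>x. - f x)"
  using smooth_on_mult[of S "\<lambda>x. -1" f] by simp

lemma smooth_on_diff [simp]: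
  "open S \<Longrightarrow> smooth_on S f \<Longrightarrow> smooth_on S g \<Longrightarrow> smooth_on S (\<lambda>x. f x - g x)"
  using smooth_on_add[of S f "\<lambda>x. - g x"] by simp

lemma smooth_on_sum [simp]:
  "open S \<Longrightarrow> (\<And>i. i \<in> I \<Longrightarrow> smooth_on S (f i)) \<Longrightarrow> smooth_on S (\<lambda>x. \<Sum>i\<in>I. f i x)"
  by (induction I rule: infinite_finite_induct) auto

lemma smooth_on_power [simp]: "open S \<Longrightarrow> smooth_on S f \<Longrightarrow> smooth_on S (\<lambda>x. f x ^ n)"
  by (induction n) auto

lemma smooth_on_inverse [simp]:
  "open S \<Longrightarrow> smooth_on S f \<Longrightarrow> \<forall>x\<in>S. f x \<noteq> 0 \<Longrightarrow> smooth_on S (\<lambda>x. inverse (f x))"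
  using smooth_closure.inverse[of S f] by (simp add: smooth_closure_iff_smooth_on)

lemma smooth_on_divide [simp]:
  "open S \<Longrightarrow> smooth_on S f \<Longrightarrow> smooth_on S g \<Longrightarrow> \<forall>x\<in>S. g x \<noteq> 0 \<Longrightarrow>
    smooth_on S (\<lambda>x. f x / g x)"
  by (simp add: divide_inverse)

lemma smooth_on_ln [simp]:
  "open S \<Longrightarrow> smooth_on S f \<Longrightarrow> \<forall>x\<in>S. f x > 0 \<Longrightarrow> smooth_on S (\<lambda>x. ln (f x))"
  using smooth_closure.ln[of S f] by (simp add: smooth_closure_iff_smooth_on)

lemma smooth_on_comp:
  "open S \<Longrightarrow> smooth_on S f \<Longrightarrow> (\<And>n t. (c n has_real_derivative c (Suc n) t) (at t)) \<Longrightarrow>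
    smooth_on S (\<lambda>x. c (n::nat) (f x))"
  using smooth_closure.comp[of S f c n] by (simp add: smooth_closure_iff_smooth_on)

lemma smooth_on_exp [simp]: "open S \<Longrightarrow> smooth_on S f \<Longrightarrow> smooth_on S (\<lambda>x. exp (f x))"
  by (rule smooth_on_comp[where c = "\<lambda>_. exp"]) (simp_all add: DERIV_exp)

lemma foldr_pd_cong_open:
  assumes "open S" "\<And>x. x \<in> S \<Longrightarrow> f x = g x"
  shows "x \<in> S \<Longrightarrow> foldr pd is f x = foldr pd is g x"
proof (induction "is" arbitrary: x)
  case (Cons i "is")
  show ?case
    using pd_cong_open[OF assms(1) Cons(2) Cons(1)] by simp
qed (simp add: assms)

lemma smooth_on_cong:
  assumes "open S" "smooth_on S f" "\<And>x. x \<in> S \<Longrightarrow> f x = g x"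
  shows "smooth_on S g"
  unfolding smooth_on_def
proof
  fix "is" :: "2 list"
  show "foldr pd is g differentiable_on S"
  proof (rule differentiable_on_cong_open[OF assms(1)])
    show "foldr pd is f differentiable_on S" using assms(2) by (simp add: smooth_on_def)
    show "foldr pd is g y = foldr pd is f y" if "y \<in> S" for y
      using foldr_pd_cong_open[OF assms(1,3) that] by simp
  qed
qed

lemma smooth_on_sqrt [simp]:
  assumes "open S" "smooth_on S f" "\<forall>x\<in>S. f x > 0"
  shows "smooth_on S (\<lambda>x. sqrt (f x))"
proof (rule smooth_on_cong[OF assms(1)])
  have "smooth_on S (\<lambda>x. inverse 2 * ln (f x))" using assms by simp
  then show "smooth_on S (\<lambda>x. exp (inverse 2 * ln (f x)))" using assms(1) by simp
  show "exp (inverse 2 * ln (f x)) = sqrt (f x)" if "x \<in> S" for x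
    using assms(3) that powr_half_sqrt[of "f x"] by (auto simp: powr_def)
qed

text \<open>\<open>foldr pd\<close> applies the last direction of the list first, so splitting the
  list at its end peels off exactly the derivative described by \<open>f'\<close>.\<close>

lemma smooth_on_of_pd:
  assumes "open S" "\<And>x. x \<in> S \<Longrightarrow> f differentiable (at x)"
    and "\<And>i. smooth_on S (f' i)" "\<And>x i. x \<in> S \<Longrightarrow> pd i f x = f' i x"
  shows "smooth_on S f"
  unfolding smooth_on_def
proof
  fix "is" :: "2 list"
  show "foldr pd is f differentiable_on S"
  proof (cases "is" rule: rev_exhaust)
    case Nil
    then show ?thesis using assms(1,2) by (simp add: differentiable_on_eq_differentiable_at)
  next
    case (snoc js i)
    have "smooth_on S (pd i f)" by (rule smooth_on_cong[OF assms(1) assms(3)[of i]]) (simp add: assms(4))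
    then show ?thesis using snoc by (simp add: smooth_on_def)
  qed
qed

section \<open>Differentials, mixed partial derivatives and potentials\<close>

lemma has_derivative_pd:
  assumes "f differentiable (at x)"
  shows "(f has_derivative (\<lambda>v. v \<bullet> (\<chi> i. pd i f x))) (at x)"
proof -
  have lin: "linear (frechet_derivative f (at x))"
    using assms frechet_derivative_works has_derivative_linear by blast
  have "frechet_derivative f (at x) v = v \<bullet> (\<chi> i. pd i f x)" for v
  proof -
    have "frechet_derivative f (at x) v = frechet_derivative f (at x) (\<Sum>i\<in>UNIV. v $ i *\<^sub>R axis i 1)"
      using basis_expansion[of v] by (simp add: scalar_mult_eq_scaleR)
    also have "\<dots> = (\<Sum>i\<in>UNIV. v $ i * pd i f x)"
      by (simp add: linear_sum[OF lin] linear_scale[OF lin] pd_def)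
    finally show ?thesis by (simp add: inner_vec_def)
  qed
  then have "frechet_derivative f (at x) = (\<lambda>v. v \<bullet> (\<chi> i. pd i f x))" by blast
  then show ?thesis using assms frechet_derivative_works[of f "at x"] by metis
qed

lemma frechet_derivative_eq_pd:
  assumes "f differentiable (at x)"
  shows "frechet_derivative f (at x) v = v $ 1 * pd 1 f x + v $ 2 * pd 2 f x"
  using fun_cong[OF frechet_derivative_at[OF has_derivative_pd[OF assms]], of v]
  by (simp add: inner_vec_def sum_2)

lemma DERIV_along_line:
  assumes "f differentiable (at (y + t *\<^sub>R v))"
  shows "((\<lambda>t. f (y + t *\<^sub>R v)) has_real_derivative frechet_derivative f (at (y + t *\<^sub>R v)) v) (at t)"
proof -
  have "((\<lambda>t. y + t *\<^sub>R v) has_derivative (\<lambda>h. h *\<^sub>R v)) (at t)"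
    by (auto intro!: derivative_eq_intros)
  from has_derivative_compose[OF this] assms
  have "((\<lambda>t. f (y + t *\<^sub>R v)) has_derivative (\<lambda>h. frechet_derivative f (at (y + t *\<^sub>R v)) (h *\<^sub>R v))) (at t)"
    by (simp add: frechet_derivative_works)
  moreover have "linear (frechet_derivative f (at (y + t *\<^sub>R v)))"
    using assms frechet_derivative_works has_derivative_linear by blast
  then have "(\<lambda>h. frechet_derivative f (at (y + t *\<^sub>R v)) (h *\<^sub>R v)) =
      (*) (frechet_derivative f (at (y + t *\<^sub>R v)) v)"
    by (simp add: fun_eq_iff linear_scale)
  ultimately show ?thesis by (simp add: has_field_derivative_def)
qed

text \<open>Two uses of the mean value theorem: in direction \<open>i\<close> for the difference of
  \<open>f\<close> between two opposite sides of the square, then in direction \<open>j\<close> for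
  \<open>pd i f\<close>.\<close>

lemma second_difference_pd:
  assumes S: "open S" "smooth_on S f" and h: "0 < h"
    and sub: "\<And>s t. 0 \<le> s \<Longrightarrow> s \<le> h \<Longrightarrow> 0 \<le> t \<Longrightarrow> t \<le> h \<Longrightarrow>
      x + s *\<^sub>R axis i 1 + t *\<^sub>R axis j 1 \<in> S"
  shows "\<exists>s t. 0 < s \<and> s < h \<and> 0 < t \<and> t < h \<and>
    f (x + h *\<^sub>R axis i 1 + h *\<^sub>R axis j 1) - f (x + h *\<^sub>R axis i 1) -
      f (x + h *\<^sub>R axis j 1) + f x =
    h * h * pd j (pd i f) (x + s *\<^sub>R axis i 1 + t *\<^sub>R axis j 1)"
proof -
  define u :: "real^2" where "u = axis i 1"
  define v :: "real^2" where "v = axis j 1"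
  note sub = sub[folded u_def v_def]
  have dif: "f differentiable (at (x + s *\<^sub>R u + t *\<^sub>R v))"
    "pd i f differentiable (at (x + s *\<^sub>R u + t *\<^sub>R v))"
    if "0 \<le> s" "s \<le> h" "0 \<le> t" "t \<le> h" for s t
    using smooth_on_differentiable_at[OF S(2,1) sub[OF that]]
      smooth_on_differentiable_at[OF smooth_on_pd[OF S(2)] S(1) sub[OF that]] by auto
  have 1: "((\<lambda>s. f (x + t *\<^sub>R v + s *\<^sub>R u)) has_real_derivative pd i f (x + t *\<^sub>R v + s *\<^sub>R u)) (at s)"
    if "0 \<le> s" "s \<le> h" "0 \<le> t" "t \<le> h" for s t
    using DERIV_along_line[of f "x + t *\<^sub>R v" s u] dif(1)[OF that]
    by (simp add: pd_def u_def ac_simps)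
  have 2: "((\<lambda>s. f (x + h *\<^sub>R v + s *\<^sub>R u) - f (x + 0 *\<^sub>R v + s *\<^sub>R u)) has_real_derivative
      pd i f (x + h *\<^sub>R v + s *\<^sub>R u) - pd i f (x + 0 *\<^sub>R v + s *\<^sub>R u)) (at s)"
    if "0 \<le> s" "s \<le> h" for s
    using that h by (intro derivative_intros 1) auto
  from MVT2[OF h 2] obtain s where s: "0 < s" "s < h"
    "(f (x + h *\<^sub>R v + h *\<^sub>R u) - f (x + h *\<^sub>R u)) - (f (x + h *\<^sub>R v) - f x) =
      h * (pd i f (x + h *\<^sub>R v + s *\<^sub>R u) - pd i f (x + s *\<^sub>R u))"
    by auto
  have 3: "((\<lambda>t. pd i f (x + s *\<^sub>R u + t *\<^sub>R v)) has_real_derivative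
      pd j (pd i f) (x + s *\<^sub>R u + t *\<^sub>R v)) (at t)" if "0 \<le> t" "t \<le> h" for t
    using DERIV_along_line[of "pd i f" "x + s *\<^sub>R u" t v] dif(2)[of s t] that s
    by (simp add: pd_def v_def)
  from MVT2[OF h 3] obtain t where "0 < t" "t < h"
    "pd i f (x + s *\<^sub>R u + h *\<^sub>R v) - pd i f (x + s *\<^sub>R u) = h * pd j (pd i f) (x + s *\<^sub>R u + t *\<^sub>R v)"
    by auto
  then show ?thesis
    using s unfolding u_def[symmetric] v_def[symmetric]
    by (intro exI[of _ s] exI[of _ t]) (simp add: algebra_simps)
qed

text \<open>The second difference is symmetric in \<open>i\<close> and \<open>j\<close>, so the two
  mixed derivatives take a common value at points arbitrarily close to \<open>x\<close>; continuity
  does the rest.\<close>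

lemma pd_commute:
  assumes S: "open S" "smooth_on S f" "x \<in> S"
  shows "pd i (pd j f) x = pd j (pd i f) x"
proof (rule ccontr)
  \<comment> \<open>Half the supposed gap: two values within \<open>e\<close> of the two mixed
    derivatives at \<open>x\<close> cannot coincide.\<close>
  define e where "e = \<bar>pd i (pd j f) x - pd j (pd i f) x\<bar> / 2"
  assume "\<not> ?thesis"
  then have e: "e > 0" by (simp add: e_def)
  have cont: "isCont (pd i (pd j f)) x" "isCont (pd j (pd i f)) x"
    using smooth_on_continuous[OF smooth_on_pd[OF smooth_on_pd[OF S(2)]]] S(1,3)
    by (simp_all add: continuous_on_eq_continuous_at)
  obtain d1 where d1: "d1 > 0" "\<And>y. dist y x < d1 \<Longrightarrow> dist (pd i (pd j f) y) (pd i (pd j f) x) < e"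
    using cont(1) e unfolding continuous_at_eps_delta by blast
  obtain d2 where d2: "d2 > 0" "\<And>y. dist y x < d2 \<Longrightarrow> dist (pd j (pd i f) y) (pd j (pd i f) x) < e"
    using cont(2) e unfolding continuous_at_eps_delta by blast
  obtain d3 where d3: "d3 > 0" "ball x d3 \<subseteq> S"
    using S open_contains_ball by blast
  define h where "h = min d1 (min d2 d3) / 3"
  have h: "h > 0" "2 * h < d1" "2 * h < d2" "2 * h < d3"
    using d1 d2 d3 by (auto simp: h_def min_def)
  have near: "dist (x + s *\<^sub>R axis k 1 + t *\<^sub>R axis l 1) x \<le> 2 * h"
    if "0 \<le> s" "s \<le> h" "0 \<le> t" "t \<le> h" for s t and k l :: 2
  proof -
    have "dist (x + s *\<^sub>R axis k 1 + t *\<^sub>R axis l 1) x =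
        norm (s *\<^sub>R axis k 1 + t *\<^sub>R axis l (1::real) :: real^2)"
      by (simp add: dist_norm)
    also have "\<dots> \<le> s + t"
      using norm_triangle_ineq[of "s *\<^sub>R axis k (1::real) :: real^2" "t *\<^sub>R axis l 1"] that by simp
    finally show ?thesis using that by simp
  qed
  have sub: "x + s *\<^sub>R axis k 1 + t *\<^sub>R axis l 1 \<in> S"
    if "0 \<le> s" "s \<le> h" "0 \<le> t" "t \<le> h" for s t and k l :: 2
    using near[OF that, of k l] h d3 by (auto simp: dist_commute)
  obtain s t where st: "0 < s" "s < h" "0 < t" "t < h"
    "f (x + h *\<^sub>R axis i 1 + h *\<^sub>R axis j 1) - f (x + h *\<^sub>R axis i 1) -
      f (x + h *\<^sub>R axis j 1) + f x =
    h * h * pd j (pd i f) (x + s *\<^sub>R axis i 1 + t *\<^sub>R axis j 1)"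
    using second_difference_pd[OF S(1,2) h(1) sub] by blast
  obtain s' t' where st': "0 < s'" "s' < h" "0 < t'" "t' < h"
    "f (x + h *\<^sub>R axis j 1 + h *\<^sub>R axis i 1) - f (x + h *\<^sub>R axis j 1) -
      f (x + h *\<^sub>R axis i 1) + f x =
    h * h * pd i (pd j f) (x + s' *\<^sub>R axis j 1 + t' *\<^sub>R axis i 1)"
    using second_difference_pd[OF S(1,2) h(1) sub] by blast
  have "h * h * pd j (pd i f) (x + s *\<^sub>R axis i 1 + t *\<^sub>R axis j 1) =
      h * h * pd i (pd j f) (x + s' *\<^sub>R axis j 1 + t' *\<^sub>R axis i 1)"
    unfolding st(5)[symmetric] st'(5)[symmetric] by (simp add: ac_simps)
  then have "pd j (pd i f) (x + s *\<^sub>R axis i 1 + t *\<^sub>R axis j 1) =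
      pd i (pd j f) (x + s' *\<^sub>R axis j 1 + t' *\<^sub>R axis i 1)"
    using h by simp
  moreover have "dist (pd j (pd i f) (x + s *\<^sub>R axis i 1 + t *\<^sub>R axis j 1)) (pd j (pd i f) x) < e"
    using near[of s t i j] st h by (intro d2(2)) auto
  moreover have "dist (pd i (pd j f) (x + s' *\<^sub>R axis j 1 + t' *\<^sub>R axis i 1)) (pd i (pd j f) x) < e"
    using near[of s' t' j i] st' h by (intro d1(2)) auto
  ultimately show False by (auto simp: e_def dist_real_def abs_if split: if_splits)
qed

text \<open>The potential is the integral of the form along the segment from a base point; convexity
  keeps the segment inside \<open>S\<close>.\<close>

lemma poincare_lemma:
  fixes w :: "2 \<Rightarrow> real^2 \<Rightarrow> real"
  assumes S: "open S" "convex S" and w: "\<And>i. smooth_on S (w i)"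
    and closed: "\<And>x. x \<in> S \<Longrightarrow> pd 1 (w 2) x = pd 2 (w 1) x"
  obtains P where "smooth_on S P" "\<And>x i. x \<in> S \<Longrightarrow> pd i P x = w i x"
proof (cases "S = {}")
  case True
  then show ?thesis using that[of "\<lambda>_. 0"] S(1) by simp
next
  case False
  then obtain a where a: "a \<in> S" by blast
  \<comment> \<open>\<open>z x\<close> runs along the segment from \<open>a\<close> to
    \<open>x\<close>, \<open>g x\<close> is the form evaluated on its velocity, and
    \<open>V x t\<close> is the gradient of \<open>g\<close> in \<open>x\<close>, to be integrated
    over \<open>t\<close> by the Leibniz rule.\<close>
  define z where "z x t = a + t *\<^sub>R (x - a)" for x :: "real^2" and t :: real
  define V :: "real^2 \<Rightarrow> real \<Rightarrow> real^2" where
    "V x t = (\<Sum>i\<in>UNIV. (w i (z x t) + t * (\<Sum>j\<in>UNIV. pd i (w j) (z x t) * (x - a) $ j)) *\<^sub>R axis i 1)" for x t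
  define g where "g x t = (\<Sum>i\<in>UNIV. w i (z x t) * (x - a) $ i)" for x t
  define P where "P x = integral (cbox 0 1) (g x)" for x
  have cl: "pd i (w j) x = pd j (w i) x" if "x \<in> S" for i j x
    using closed[OF that] exhaust_2[of i] exhaust_2[of j] by auto
  have zS: "z x t \<in> S" if "x \<in> S" "t \<in> cbox 0 1" for x t
  proof -
    have "(1 - t) *\<^sub>R a + t *\<^sub>R x \<in> S" using that a S(2) by (auto intro: convexD_alt)
    then show ?thesis by (simp add: z_def algebra_simps)
  qed
  have zc: "continuous_on (S \<times> cbox 0 1) (\<lambda>q. z (fst q) (snd q))"
    unfolding z_def by (intro continuous_intros)
  have compc: "continuous_on (S \<times> cbox 0 1) (\<lambda>q. f (z (fst q) (snd q)))" if "smooth_on S f" for f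
    by (rule continuous_on_compose2[OF smooth_on_continuous[OF that] zc]) (use zS in auto)
  have Vc: "continuous_on (S \<times> cbox 0 1) (\<lambda>q. V (fst q) (snd q))"
    unfolding V_def by (intro continuous_intros compc w smooth_on_pd)
  have w': "(w i has_derivative (\<lambda>v. v \<bullet> (\<chi> j. pd j (w i) y))) (at y)" if "y \<in> S" for i y
    using smooth_on_differentiable_at[OF w S(1) that] by (rule has_derivative_pd)
  have dg: "((\<lambda>x. g x t) has_derivative blinfun_inner_left (V x t)) (at x within S)"
    if "x \<in> S" "t \<in> cbox 0 1" for x t
  proof -
    have dz: "((\<lambda>x. z x t) has_derivative (\<lambda>h. t *\<^sub>R h)) (at x)"
      unfolding z_def by (auto intro!: derivative_eq_intros)
    have dw: "((\<lambda>x. w i (z x t)) has_derivative (\<lambda>h. t *\<^sub>R h \<bullet> (\<chi> j. pd j (w i) (z x t)))) (at x)" for i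
      using has_derivative_compose[OF dz w'[OF zS[OF that]]] .
    have "((\<lambda>x. g x t) has_derivative (\<lambda>h. \<Sum>i\<in>UNIV. w i (z x t) * h $ i +
        (t *\<^sub>R h \<bullet> (\<chi> j. pd j (w i) (z x t))) * (x - a) $ i)) (at x)"
      unfolding g_def
      by (intro has_derivative_sum has_derivative_mult dw)
        (auto intro!: derivative_eq_intros bounded_linear.has_derivative[OF bounded_linear_vec_nth])
    moreover have "(\<Sum>i\<in>UNIV. w i (z x t) * h $ i +
        (t *\<^sub>R h \<bullet> (\<chi> j. pd j (w i) (z x t))) * (x - a) $ i) = h \<bullet> V x t" for h
      using cl[OF zS[OF that]]
      by (simp add: V_def inner_vec_def sum_2 axis_def algebra_simps)
    ultimately show ?thesis by (simp add: has_derivative_at_withinI)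
  qed
  have gc: "continuous_on (cbox 0 1) (g x)" if "x \<in> S" for x
  proof -
    have "continuous_on (cbox 0 1) (\<lambda>t. w i (z x t))" for i
      using continuous_on_compose2[OF compc[OF w[of i]], of "cbox 0 1" "\<lambda>t. (x, t)"] that
      by (simp add: image_subset_iff continuous_on_Pair)
    then show ?thesis unfolding g_def[abs_def] by (intro continuous_intros)
  qed
  have dP: "(P has_derivative (\<lambda>h. h \<bullet> (\<chi> i. w i x))) (at x)" if x: "x \<in> S" for x
  proof -
    have "(P has_derivative integral (cbox 0 1) (\<lambda>t. blinfun_inner_left (V x t))) (at x within S)"
      unfolding P_def[abs_def]
    proof (rule leibniz_rule[OF dg])
      show "continuous_on (S \<times> cbox 0 1) (\<lambda>(x, t). blinfun_inner_left (V x t))"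
        using bounded_linear.continuous_on[OF bounded_linear_blinfun_inner_left Vc]
        by (simp add: split_beta)
    qed (use gc S x in \<open>auto intro: integrable_continuous_real\<close>)
    \<comment> \<open>By closedness \<open>V x t\<close> is also the \<open>t\<close>-derivative of
      \<open>t\<close> times the vector of the \<open>w i\<close> at \<open>z x t\<close>. The
      fundamental theorem then leaves the value at \<open>t = 1\<close>, which is the form at
      \<open>x\<close>.\<close>
    moreover have "((\<lambda>t. blinfun_inner_left (V x t)) has_integral
        1 *\<^sub>R blinfun_inner_left (\<chi> i. w i (z x 1)) - 0 *\<^sub>R blinfun_inner_left (\<chi> i. w i (z x 0))) {0..1}"
    proof (rule fundamental_theorem_of_calculus)
      fix t :: real assume t: "t \<in> {0..1}"
      then have zt: "z x t \<in> S" using zS x by simp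
      have dz: "((\<lambda>t. z x t) has_derivative (\<lambda>h. h *\<^sub>R (x - a))) (at t)"
        unfolding z_def by (auto intro!: derivative_eq_intros)
      have dw: "((\<lambda>t. w i (z x t)) has_real_derivative (x - a) \<bullet> (\<chi> j. pd j (w i) (z x t))) (at t)" for i
        using has_derivative_compose[OF dz w'[OF zt, of i]]
        by (simp add: has_field_derivative_def mult_commute_abs)
      have "((\<lambda>t. t *\<^sub>R (\<Sum>i\<in>UNIV. w i (z x t) *\<^sub>R axis i (1::real))) has_vector_derivative
          t *\<^sub>R (\<Sum>i\<in>UNIV. w i (z x t) *\<^sub>R 0 +
            ((x - a) \<bullet> (\<chi> j. pd j (w i) (z x t))) *\<^sub>R axis i 1) +
          1 *\<^sub>R (\<Sum>i\<in>UNIV. w i (z x t) *\<^sub>R axis i 1)) (at t)"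
        by (intro has_vector_derivative_scaleR has_vector_derivative_sum has_vector_derivative_const
            DERIV_ident dw)
      then have "((\<lambda>t. t *\<^sub>R (\<Sum>i\<in>UNIV. w i (z x t) *\<^sub>R axis i (1::real))) has_vector_derivative V x t) (at t)"
        unfolding V_def by (simp add: inner_vec_def cl[OF zt] sum_2 algebra_simps)
      moreover have "(\<chi> i. w i (z x t)) = (\<Sum>i\<in>UNIV. w i (z x t) *\<^sub>R axis i (1::real))" for t
        by (simp add: vec_eq_iff axis_def if_distrib[of "\<lambda>c. _ * c"] cong: if_cong)
      ultimately have "((\<lambda>t. t *\<^sub>R (\<chi> i. w i (z x t))) has_vector_derivative V x t) (at t)"
        by simp
      from bounded_linear.has_vector_derivative[OF bounded_linear_blinfun_inner_left this]
      have "((\<lambda>t. t *\<^sub>R blinfun_inner_left (\<chi> i. w i (z x t))) has_vector_derivative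
          blinfun_inner_left (V x t)) (at t)"
        by (simp add: linear_scale bounded_linear.linear bounded_linear_blinfun_inner_left)
      then show "((\<lambda>t. t *\<^sub>R blinfun_inner_left (\<chi> i. w i (z x t))) has_vector_derivative
          blinfun_inner_left (V x t)) (at t within {0..1})"
        by (rule has_vector_derivative_at_within)
    qed simp
    ultimately have "(P has_derivative blinfun_inner_left (\<chi> i. w i x)) (at x within S)"
      by (simp add: integral_unique z_def)
    then show ?thesis
      unfolding at_within_open[OF x S(1)] blinfun_inner_left.rep_eq .
  qed
  have pdP: "pd i P x = w i x" if "x \<in> S" for x i
    using pd_eqI[OF dP[OF that], of i] by (simp add: inner_axis')
  moreover have "smooth_on S P"
    using dP pdP w by (intro smooth_on_of_pd[OF S(1), of P w]) (auto simp: differentiable_def)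
  ultimately show ?thesis using that by blast
qed

section \<open>Moving frames\<close>

definition along :: "(real^2 \<Rightarrow> real^2) \<Rightarrow> (real^2 \<Rightarrow> real) \<Rightarrow> real^2 \<Rightarrow> real" where
  "along E f x = frechet_derivative f (at x) (E x)"

lemma along_cong:
  "open W \<Longrightarrow> (\<And>y. y \<in> W \<Longrightarrow> f y = g y) \<Longrightarrow> x \<in> W \<Longrightarrow> along E f x = along E g x"
  unfolding along_def using frechet_derivative_cong_open by metis

lemma along_eq_pd:
  "smooth_on W f \<Longrightarrow> open W \<Longrightarrow> x \<in> W \<Longrightarrow>
    along E f x = E x $ 1 * pd 1 f x + E x $ 2 * pd 2 f x"
  unfolding along_def by (intro frechet_derivative_eq_pd smooth_on_differentiable_at)

lemma smooth_on_along:
  assumes "open W" "smooth_on W f" "\<And>i. smooth_on W (\<lambda>x. E x $ i)"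
  shows "smooth_on W (along E f)"
  by (rule smooth_on_cong[where f = "\<lambda>x. E x $ 1 * pd 1 f x + E x $ 2 * pd 2 f x"])
    (use assms in \<open>simp_all add: along_eq_pd smooth_on_pd\<close>)

lemma along_const: "along E (\<lambda>x. c) x = 0"
  by (simp add: along_def)

lemma along_add:
  "smooth_on W f \<Longrightarrow> smooth_on W g \<Longrightarrow> open W \<Longrightarrow> x \<in> W \<Longrightarrow>
    along E (\<lambda>x. f x + g x) x = along E f x + along E g x"
  unfolding along_def by (intro frechet_derivative_add_at smooth_on_differentiable_at)

lemma along_mult:
  "smooth_on W f \<Longrightarrow> smooth_on W g \<Longrightarrow> open W \<Longrightarrow> x \<in> W \<Longrightarrow>
    along E (\<lambda>x. f x * g x) x = along E f x * g x + f x * along E g x"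
  unfolding along_def by (intro frechet_derivative_mult_at smooth_on_differentiable_at)

lemma along_minus:
  "smooth_on W f \<Longrightarrow> open W \<Longrightarrow> x \<in> W \<Longrightarrow> along E (\<lambda>x. - f x) x = - along E f x"
  using along_mult[of W "\<lambda>x. -1" f x E] by (simp add: along_const)

lemma along_diff:
  "smooth_on W f \<Longrightarrow> smooth_on W g \<Longrightarrow> open W \<Longrightarrow> x \<in> W \<Longrightarrow>
    along E (\<lambda>x. f x - g x) x = along E f x - along E g x"
  using along_add[of W f "\<lambda>x. - g x" x E] along_minus[of W g x E] by simp

lemma along_power:
  assumes "smooth_on W f" "open W" "x \<in> W"
  shows "along E (\<lambda>x. f x ^ n) x = of_nat n * f x ^ (n - 1) * along E f x"
proof (induction n)
  case (Suc n)
  then show ?case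
    using along_mult[of W f "\<lambda>x. f x ^ n" x E] assms
    by (cases n) (simp_all add: algebra_simps)
qed (simp add: along_const)

lemma along_sum:
  assumes "\<And>i. i \<in> I \<Longrightarrow> smooth_on W (f i)" "open W" "x \<in> W"
  shows "along E (\<lambda>x. \<Sum>i\<in>I. f i x) x = (\<Sum>i\<in>I. along E (f i) x)"
  using assms(1)
proof (induction I rule: infinite_finite_induct)
  case (insert i I)
  then show ?case
    using along_add[of W "f i" "\<lambda>x. \<Sum>i\<in>I. f i x" x E] assms(2,3) by simp
qed (simp_all add: along_const)

lemma along_comp:
  "smooth_on W f \<Longrightarrow> open W \<Longrightarrow> x \<in> W \<Longrightarrow> (h has_real_derivative h') (at (f x)) \<Longrightarrow>
    along E (\<lambda>x. h (f x)) x = along E f x * h'"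
  unfolding along_def by (intro frechet_derivative_comp_real_at smooth_on_differentiable_at)

lemma along_inverse:
  assumes "smooth_on W f" "open W" "x \<in> W" "f x \<noteq> 0"
  shows "along E (\<lambda>x. inverse (f x)) x = - (along E f x / f x ^ 2)"
  unfolding along_def using smooth_on_differentiable_at[OF assms(1-3)] assms(4)
  by (simp add: frechet_derivative_inverse_at power2_eq_square divide_inverse)

lemma along_divide:
  assumes "smooth_on W f" "smooth_on W g" "open W" "x \<in> W" "\<forall>x\<in>W. g x \<noteq> 0"
  shows "along E (\<lambda>x. f x / g x) x = (along E f x * g x - f x * along E g x) / g x ^ 2"
  using along_mult[of W f "\<lambda>x. inverse (g x)" x E] along_inverse[of W g x E] assms
  by (simp add: divide_inverse[symmetric]) (simp add: field_simps power2_eq_square)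

locale moving_frame =
  fixes W :: "(real^2) set" and E1 E2 :: "real^2 \<Rightarrow> real^2" and a b :: "real^2 \<Rightarrow> real"
  assumes W_open [simp]: "open W" and W_convex: "convex W"
    and smooth_frame [simp]: "smooth_on W (\<lambda>x. E1 x $ i)" "smooth_on W (\<lambda>x. E2 x $ i)"
    and smooth_connection [simp]: "smooth_on W a" "smooth_on W b"
    and independent: "x \<in> W \<Longrightarrow> E1 x $ 1 * E2 x $ 2 - E1 x $ 2 * E2 x $ 1 \<noteq> 0"
    and bracket: "x \<in> W \<Longrightarrow>
      along E1 (\<lambda>x. E2 x $ i) x - along E2 (\<lambda>x. E1 x $ i) x = - a x * E1 x $ i - b x * E2 x $ i"
begin

abbreviation "D1 \<equiv> along E1"
abbreviation "D2 \<equiv> along E2"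

lemma smooth_D [simp]: "smooth_on W f \<Longrightarrow> smooth_on W (D1 f)" "smooth_on W f \<Longrightarrow> smooth_on W (D2 f)"
  by (simp_all add: smooth_on_along)

lemmas D_simps [simp] =
  along_const along_add[where W = W] along_mult[where W = W] along_minus[where W = W]
  along_diff[where W = W] along_divide[where W = W]

lemma D_power [simp]:
  "smooth_on W f \<Longrightarrow> x \<in> W \<Longrightarrow> along E (\<lambda>x. f x ^ n) x = of_nat n * f x ^ (n - 1) * along E f x"
  by (simp add: along_power[where W = W])

lemma D_cong:
  "(\<And>y. y \<in> W \<Longrightarrow> f y = g y) \<Longrightarrow> x \<in> W \<Longrightarrow> along E f x = along E g x"
  by (rule along_cong[OF W_open])

text \<open>In coordinates the second partial derivatives cancel by symmetry, and
  \<open>bracket\<close> evaluates the remaining first-order terms.\<close>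

lemma commutator:
  assumes f: "smooth_on W f" and x: "x \<in> W"
  shows "D1 (D2 f) x - D2 (D1 f) x = - a x * D1 f x - b x * D2 f x"
proof -
  have "D1 (D2 f) x = D1 (\<lambda>x. E2 x $ 1 * pd 1 f x + E2 x $ 2 * pd 2 f x) x"
    using f by (intro D_cong[OF _ x]) (simp add: along_eq_pd[where W = W])
  moreover have "D2 (D1 f) x = D2 (\<lambda>x. E1 x $ 1 * pd 1 f x + E1 x $ 2 * pd 2 f x) x"
    using f by (intro D_cong[OF _ x]) (simp add: along_eq_pd[where W = W])
  moreover have "pd 1 (pd 2 f) x = pd 2 (pd 1 f) x"
    by (rule pd_commute[OF W_open f x])
  moreover have "D1 (\<lambda>x. E2 x $ 1) x = D2 (\<lambda>x. E1 x $ 1) x + (- a x * E1 x $ 1 - b x * E2 x $ 1)"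
    "D1 (\<lambda>x. E2 x $ 2) x = D2 (\<lambda>x. E1 x $ 2) x + (- a x * E1 x $ 2 - b x * E2 x $ 2)"
    using bracket[OF x] by (metis add_diff_cancel_left' diff_add_cancel add.commute)+
  ultimately show ?thesis
    using f x smooth_on_pd[OF f] by (simp add: along_eq_pd[where W = W] algebra_simps)
qed

text \<open>The Poincare lemma for the 1-form with values \<open>s1\<close>, \<open>s2\<close> on
  the frame: \<open>closed\<close> says that its exterior derivative vanishes on
  \<open>(E1, E2)\<close>, with the bracket term expanded.\<close>

lemma frame_potential:
  assumes s: "smooth_on W s1" "smooth_on W s2"
    and closed: "\<And>x. x \<in> W \<Longrightarrow> D1 s2 x - D2 s1 x + a x * s1 x + b x * s2 x = 0"
  obtains P where "smooth_on W P" "\<And>x. x \<in> W \<Longrightarrow> D1 P x = s1 x" "\<And>x. x \<in> W \<Longrightarrow> D2 P x = s2 x"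
proof -
  define \<delta> where "\<delta> x = E1 x $ 1 * E2 x $ 2 - E1 x $ 2 * E2 x $ 1" for x
  have \<delta>: "\<forall>x\<in>W. \<delta> x \<noteq> 0" using independent by (simp add: \<delta>_def)
  have \<delta>_smooth: "smooth_on W \<delta>" by (simp add: \<delta>_def[abs_def])
  \<comment> \<open>Cramer's rule gives the coordinate components of the form from its values on the
    frame.\<close>
  define w1 where "w1 x = (s1 x * E2 x $ 2 - s2 x * E1 x $ 2) / \<delta> x" for x
  define w2 where "w2 x = (s2 x * E1 x $ 1 - s1 x * E2 x $ 1) / \<delta> x" for x
  have w: "smooth_on W w1" "smooth_on W w2"
    using s \<delta> \<delta>_smooth by (simp_all add: w1_def[abs_def] w2_def[abs_def])
  have s1: "s1 x = w1 x * E1 x $ 1 + w2 x * E1 x $ 2" if "x \<in> W" for x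
    using \<delta> that by (simp add: w1_def w2_def divide_simps) (simp add: \<delta>_def algebra_simps)
  have s2: "s2 x = w1 x * E2 x $ 1 + w2 x * E2 x $ 2" if "x \<in> W" for x
    using \<delta> that by (simp add: w1_def w2_def divide_simps) (simp add: \<delta>_def algebra_simps)
  have curl: "pd 1 w2 x = pd 2 w1 x" if x: "x \<in> W" for x
  proof -
    have 1: "D1 s2 x = D1 (\<lambda>x. w1 x * E2 x $ 1 + w2 x * E2 x $ 2) x"
      by (rule D_cong[OF s2 x])
    have 2: "D2 s1 x = D2 (\<lambda>x. w1 x * E1 x $ 1 + w2 x * E1 x $ 2) x"
      by (rule D_cong[OF s1 x])
    have 3: "D1 (\<lambda>x. E2 x $ 1) x = D2 (\<lambda>x. E1 x $ 1) x + (- a x * E1 x $ 1 - b x * E2 x $ 1)"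
      "D1 (\<lambda>x. E2 x $ 2) x = D2 (\<lambda>x. E1 x $ 2) x + (- a x * E1 x $ 2 - b x * E2 x $ 2)"
      using bracket[OF x] by (metis add_diff_cancel_left' diff_add_cancel add.commute)+
    have "\<delta> x * pd 1 w2 x = \<delta> x * pd 2 w1 x"
      using closed[OF x] w x
      by (simp add: 1 2 3 s1[OF x] s2[OF x] along_eq_pd[where W = W and f = w1]
          along_eq_pd[where W = W and f = w2] \<delta>_def algebra_simps)
    then show ?thesis using \<delta> x by simp
  qed
  define w :: "2 \<Rightarrow> real^2 \<Rightarrow> real" where "w i = (if i = 1 then w1 else w2)" for i
  have "smooth_on W (w i)" for i using w by (simp add: w_def)
  moreover have "pd 1 (w 2) x = pd 2 (w 1) x" if "x \<in> W" for x
    using curl[OF that] by (simp add: w_def)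
  ultimately obtain P where P: "smooth_on W P" "\<And>x i. x \<in> W \<Longrightarrow> pd i P x = w i x"
    using poincare_lemma[OF W_open W_convex, of w] by blast
  show ?thesis
  proof
    show "smooth_on W P" by fact
    show "D1 P x = s1 x" if "x \<in> W" for x
      using P that by (simp add: along_eq_pd[where W = W] s1 w_def)
    show "D2 P x = s2 x" if "x \<in> W" for x
      using P that by (simp add: along_eq_pd[where W = W] s2 w_def)
  qed
qed

section \<open>Uniqueness for linear first-order systems along the frame\<close>

lemma frechet_derivative_frame:
  assumes "f differentiable (at x)" "x \<in> W"
  shows "frechet_derivative f (at x) v =
    ((v $ 1 * E2 x $ 2 - v $ 2 * E2 x $ 1) * D1 f x + (v $ 2 * E1 x $ 1 - v $ 1 * E1 x $ 2) * D2 f x) /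
      (E1 x $ 1 * E2 x $ 2 - E1 x $ 2 * E2 x $ 1)"
  using independent[OF assms(2)]
  by (simp add: along_def frechet_derivative_eq_pd[OF assms(1)] divide_simps) (simp add: algebra_simps)

text \<open>Along the segment from \<open>q\<close> to \<open>x\<close> the derivative of
  \<open>f\<close> is at most a constant \<open>L\<close> times \<open>f\<close>, so
  \<open>exp (- L t)\<close> times \<open>f\<close> cannot grow from its initial value 0.\<close>

lemma gronwall_frame:
  assumes f: "smooth_on W f" and nonneg: "\<And>x. x \<in> W \<Longrightarrow> f x \<ge> 0"
    and m: "continuous_on W m"
    and bound: "\<And>x. x \<in> W \<Longrightarrow> \<bar>D1 f x\<bar> \<le> m x * f x" "\<And>x. x \<in> W \<Longrightarrow> \<bar>D2 f x\<bar> \<le> m x * f x"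
    and q: "q \<in> W" "f q = 0" and x: "x \<in> W"
  shows "f x = 0"
proof -
  define z where "z t = q + t *\<^sub>R (x - q)" for t :: real
  define v where "v = x - q"
  have zW: "z t \<in> W" if "t \<in> {0..1}" for t
  proof -
    have "(1 - t) *\<^sub>R q + t *\<^sub>R x \<in> W" using that q x W_convex by (auto intro: convexD_alt)
    then show ?thesis by (simp add: z_def algebra_simps)
  qed
  \<comment> \<open>The frame components of the direction \<open>v\<close> of the segment.\<close>
  define \<alpha> where "\<alpha> y = (v $ 1 * E2 y $ 2 - v $ 2 * E2 y $ 1) / (E1 y $ 1 * E2 y $ 2 - E1 y $ 2 * E2 y $ 1)" for y
  define \<beta> where "\<beta> y = (v $ 2 * E1 y $ 1 - v $ 1 * E1 y $ 2) / (E1 y $ 1 * E2 y $ 2 - E1 y $ 2 * E2 y $ 1)" for y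
  define c where "c y = (\<bar>\<alpha> y\<bar> + \<bar>\<beta> y\<bar>) * m y" for y
  have "smooth_on W \<alpha>" "smooth_on W \<beta>"
    unfolding \<alpha>_def[abs_def] \<beta>_def[abs_def] using independent by simp_all
  then have "continuous_on W c"
    unfolding c_def[abs_def] by (intro continuous_intros smooth_on_continuous m)
  then have "continuous_on {0..1} (\<lambda>t. c (z t))"
    by (rule continuous_on_compose2) (use zW in \<open>auto simp: z_def intro!: continuous_intros\<close>)
  then have "bounded ((\<lambda>t. c (z t)) ` {0..1})"
    using compact_continuous_image compact_imp_bounded by blast
  then obtain L where "\<And>t. t \<in> {0..1} \<Longrightarrow> \<bar>c (z t)\<bar> \<le> L"
    unfolding bounded_iff real_norm_def by blast
  then have L: "c (z t) \<le> L" if "t \<in> {0..1}" for t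
    using that abs_le_D1 by blast
  define h where "h t = exp (- L * t) * f (z t)" for t
  have "h 1 \<le> h 0"
  proof (rule DERIV_nonpos_imp_nonincreasing[of 0 1])
    fix t :: real assume t: "0 \<le> t" "t \<le> 1"
    then have zt: "z t \<in> W" using zW by simp
    have fd: "f differentiable (at (z t))" using smooth_on_differentiable_at[OF f W_open zt] .
    have d: "((\<lambda>t. f (z t)) has_real_derivative frechet_derivative f (at (z t)) v) (at t)"
      using DERIV_along_line[of f q t v] fd by (simp add: z_def v_def)
    have "frechet_derivative f (at (z t)) v = \<alpha> (z t) * D1 f (z t) + \<beta> (z t) * D2 f (z t)"
      by (simp add: frechet_derivative_frame[OF fd zt] \<alpha>_def \<beta>_def add_divide_distrib)
    also have "\<dots> \<le> \<bar>\<alpha> (z t)\<bar> * \<bar>D1 f (z t)\<bar> + \<bar>\<beta> (z t)\<bar> * \<bar>D2 f (z t)\<bar>"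
      by (intro add_mono) (metis abs_ge_self abs_mult)+
    also have "\<dots> \<le> \<bar>\<alpha> (z t)\<bar> * (m (z t) * f (z t)) + \<bar>\<beta> (z t)\<bar> * (m (z t) * f (z t))"
      using bound zt by (intro add_mono mult_left_mono) auto
    also have "\<dots> = c (z t) * f (z t)" by (simp add: c_def algebra_simps)
    also have "\<dots> \<le> L * f (z t)" using L t nonneg zt by (intro mult_right_mono) auto
    finally have "frechet_derivative f (at (z t)) v - L * f (z t) \<le> 0" by simp
    then have "exp (- L * t) * (frechet_derivative f (at (z t)) v - L * f (z t)) \<le> 0"
      by (simp add: mult_nonneg_nonpos)
    moreover have "(h has_real_derivative
        exp (- L * t) * (frechet_derivative f (at (z t)) v - L * f (z t))) (at t)"
      unfolding h_def[abs_def] by (auto intro!: derivative_eq_intros d simp: algebra_simps)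
    ultimately show "\<exists>y. (h has_real_derivative y) (at t) \<and> y \<le> 0" by blast
  qed simp
  then have "exp (- L) * f x \<le> 0" using q by (simp add: h_def z_def)
  then have "f x \<le> 0" by (simp add: mult_le_0_iff)
  then show ?thesis using nonneg[OF x] by simp
qed

text \<open>Gronwall for the sum of squares \<open>f\<close> of the unknowns: each product of two
  unknowns is bounded by \<open>f\<close>, and the single function \<open>m\<close> dominates the
  coefficients of both frame directions.\<close>

lemma linear_system_unique:
  fixes u :: "'n \<Rightarrow> real^2 \<Rightarrow> real" and M N :: "'n \<Rightarrow> 'n \<Rightarrow> real^2 \<Rightarrow> real"
  assumes I: "finite I" and u: "\<And>p. p \<in> I \<Longrightarrow> smooth_on W (u p)"
    and M: "\<And>p r. p \<in> I \<Longrightarrow> r \<in> I \<Longrightarrow> continuous_on W (M p r)"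
      "\<And>p r. p \<in> I \<Longrightarrow> r \<in> I \<Longrightarrow> continuous_on W (N p r)"
    and D1u: "\<And>p x. p \<in> I \<Longrightarrow> x \<in> W \<Longrightarrow> D1 (u p) x = (\<Sum>r\<in>I. M p r x * u r x)"
    and D2u: "\<And>p x. p \<in> I \<Longrightarrow> x \<in> W \<Longrightarrow> D2 (u p) x = (\<Sum>r\<in>I. N p r x * u r x)"
    and q: "q \<in> W" "\<And>p. p \<in> I \<Longrightarrow> u p q = 0" and x: "x \<in> W" and p: "p \<in> I"
  shows "u p x = 0"
proof -
  define f where "f x = (\<Sum>p\<in>I. u p x * u p x)" for x
  define m where "m x = 2 * (\<Sum>p\<in>I. \<Sum>r\<in>I. \<bar>M p r x\<bar> + \<bar>N p r x\<bar>)" for x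
  have le: "\<bar>u p y * u r y\<bar> \<le> f y" if "p \<in> I" "r \<in> I" for p r y
  proof -
    have sq: "u p y * u p y \<le> f y" if "p \<in> I" for p
      unfolding f_def by (rule member_le_sum[OF that _ I]) simp
    have "2 * \<bar>u p y * u r y\<bar> \<le> u p y * u p y + u r y * u r y"
      using sum_squares_bound[of "\<bar>u p y\<bar>" "\<bar>u r y\<bar>"] by (simp add: abs_mult power2_eq_square)
    then show ?thesis using sq[OF that(1)] sq[OF that(2)] by simp
  qed
  have Df: "along E f y = 2 * (\<Sum>p\<in>I. u p y * along E (u p) y)" if "y \<in> W" for E y
    unfolding f_def[abs_def] using that u
    by (subst along_sum[where W = W]) (auto simp: sum_distrib_left algebra_simps intro!: sum.cong)
  have bound: "\<bar>along E f y\<bar> \<le> m y * f y"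
    if y: "y \<in> W" and D: "\<And>p. p \<in> I \<Longrightarrow> along E (u p) y = (\<Sum>r\<in>I. R p r y * u r y)"
      and R: "\<And>p r. \<bar>R p r y\<bar> \<le> \<bar>M p r y\<bar> + \<bar>N p r y\<bar>" for E y R
  proof -
    have "(\<Sum>p\<in>I. u p y * along E (u p) y) = (\<Sum>p\<in>I. \<Sum>r\<in>I. R p r y * (u p y * u r y))"
      by (intro sum.cong) (simp_all add: D sum_distrib_left algebra_simps)
    then have "\<bar>along E f y\<bar> = 2 * \<bar>\<Sum>p\<in>I. \<Sum>r\<in>I. R p r y * (u p y * u r y)\<bar>"
      by (simp add: Df[OF y] abs_mult)
    also have "\<dots> \<le> 2 * (\<Sum>p\<in>I. \<Sum>r\<in>I. \<bar>R p r y\<bar> * \<bar>u p y * u r y\<bar>)"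
      by (intro mult_left_mono order_trans[OF sum_abs] sum_mono) (auto simp: abs_mult)
    also have "\<dots> \<le> 2 * (\<Sum>p\<in>I. \<Sum>r\<in>I. (\<bar>M p r y\<bar> + \<bar>N p r y\<bar>) * f y)"
      by (intro mult_left_mono sum_mono mult_mono R le) auto
    also have "\<dots> = m y * f y" by (simp add: m_def sum_distrib_right)
    finally show ?thesis .
  qed
  have "f x = 0"
  proof (rule gronwall_frame[OF _ _ _ _ _ q(1) _ x, where m = m])
    show "smooth_on W f" unfolding f_def[abs_def] using u by simp
    show "f y \<ge> 0" for y by (simp add: f_def sum_nonneg)
    show "continuous_on W m" unfolding m_def[abs_def] by (intro continuous_intros M)
    show "\<bar>D1 f y\<bar> \<le> m y * f y" if "y \<in> W" for y
      by (rule bound[OF that, where R = M]) (use that D1u in auto)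
    show "\<bar>D2 f y\<bar> \<le> m y * f y" if "y \<in> W" for y
      by (rule bound[OF that, where R = N]) (use that D2u in auto)
    show "f q = 0" using q by (simp add: f_def)
  qed
  then show ?thesis using le[OF p p, of x] by (auto simp: mult_le_0_iff)
qed

text \<open>The case of the single unknown \<open>f x - f q\<close> with vanishing
  coefficients.\<close>

lemma constant_of_D_zero:
  assumes f: "smooth_on W f" and D: "\<And>x. x \<in> W \<Longrightarrow> D1 f x = 0" "\<And>x. x \<in> W \<Longrightarrow> D2 f x = 0"
    and q: "q \<in> W" and x: "x \<in> W"
  shows "f x = f q"
proof -
  have "f x - f q = 0"
    by (rule linear_system_unique[where I = "{()}" and u = "\<lambda>_ x. f x - f q" and
          M = "\<lambda>_ _ _. 0" and N = "\<lambda>_ _ _. 0", OF _ _ _ _ _ _ q _ x])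
      (use f D in simp_all)
  then show ?thesis by simp
qed

end

section \<open>Quadratic integrals in a frame adapted to the curvature\<close>

text \<open>Together with \<open>bracket\<close>, the Gauss equation and the two derivatives of
  \<open>K\<close> carry the geometry into the purely differential arguments that follow.\<close>

locale adapted_frame = moving_frame +
  fixes K k :: "real^2 \<Rightarrow> real"
  assumes smooth_curvature [simp]: "smooth_on W K" "smooth_on W k"
    and k_pos: "x \<in> W \<Longrightarrow> k x > 0"
    and DK: "x \<in> W \<Longrightarrow> D1 K x = k x" "x \<in> W \<Longrightarrow> D2 K x = 0"
    and gauss: "x \<in> W \<Longrightarrow> D1 b x = D2 a x - a x ^ 2 - b x ^ 2 - K x"
begin

text \<open>The commutator applied to \<open>K\<close>, whose derivative along \<open>E2\<close>
  vanishes.\<close>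

lemma D2_k: "x \<in> W \<Longrightarrow> D2 k x = a x * k x"
  using commutator[of K x] D_cong[of "D2 K" "\<lambda>_. 0" x E1] D_cong[of "D1 K" k x E2] DK
  by simp

end

text \<open>The function \<open>A p\<^sub>1\<^sup>2 + 2 B p\<^sub>1 p\<^sub>2 + C p\<^sub>2\<^sup>2\<close> of the frame momenta is an integral.\<close>

locale quadratic_integral = adapted_frame +
  fixes A B C :: "real^2 \<Rightarrow> real"
  assumes smooth_ABC [simp]: "smooth_on W A" "smooth_on W B" "smooth_on W C"
    and D1_A: "x \<in> W \<Longrightarrow> D1 A x = 2 * a x * B x"
    and D2_C: "x \<in> W \<Longrightarrow> D2 C x = - 2 * b x * B x"
    and D2_A: "x \<in> W \<Longrightarrow> D2 A x = - 2 * D1 B x - 2 * a x * (A x - C x) + 2 * b x * B x"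
    and D1_C: "x \<in> W \<Longrightarrow> D1 C x = - 2 * D2 B x - 2 * b x * (A x - C x) - 2 * a x * B x"
begin

definition "T x = A x - C x"
abbreviation "X \<equiv> D1 B"
abbreviation "Y \<equiv> D2 B"
abbreviation "S \<equiv> D1 (D2 B)"

lemma smooth_T [simp]: "smooth_on W T"
  by (simp add: T_def[abs_def])

lemma D1_T: "x \<in> W \<Longrightarrow> D1 T x = 2 * Y x + 4 * a x * B x + 2 * b x * T x"
  unfolding T_def[abs_def] by (simp add: D1_A D1_C algebra_simps)

lemma D2_T: "x \<in> W \<Longrightarrow> D2 T x = - 2 * X x - 2 * a x * T x + 4 * b x * B x"
  unfolding T_def[abs_def] by (simp add: D2_A D2_C algebra_simps)

lemma D2_X: "x \<in> W \<Longrightarrow> D2 X x = S x + a x * X x + b x * Y x"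
  using commutator[of B x] by simp

text \<open>Prolongation begins here. The commutator on \<open>C\<close> determines
  \<open>D2 Y\<close>; with it, the commutator on \<open>T\<close> determines
  \<open>D1 X\<close>.\<close>

lemma D1_X:
  assumes x: "x \<in> W"
  shows "D1 X x = - B x * K x - 4 * a x ^ 2 * B x - 3 * a x * b x * T x - D1 a x * T x - 3 * a x * Y x"
proof -
  have "D1 (D2 T) x = D1 (\<lambda>x. - 2 * X x - 2 * a x * T x + 4 * b x * B x) x"
    by (rule D_cong[OF D2_T x])
  moreover have "D2 (D1 T) x = D2 (\<lambda>x. 2 * Y x + 4 * a x * B x + 2 * b x * T x) x"
    by (rule D_cong[OF D1_T x])
  moreover have "D1 (D2 C) x = D1 (\<lambda>x. - 2 * b x * B x) x"
    by (rule D_cong[OF D2_C x])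
  moreover have "D2 (D1 C) x = D2 (\<lambda>x. - 2 * Y x - 2 * b x * T x - 2 * a x * B x) x"
    by (rule D_cong[OF _ x]) (simp add: D1_C T_def)
  ultimately show ?thesis
    using commutator[of T x] commutator[of C x] x
    by (simp add: D1_T D2_T D2_X D1_C D2_C gauss T_def[symmetric])
      (simp add: algebra_simps power2_eq_square)
qed

lemma D2_Y:
  assumes x: "x \<in> W"
  shows "D2 Y x = - B x * K x - 4 * b x ^ 2 * B x + 3 * a x * b x * T x - D2 b x * T x + 3 * b x * X x"
proof -
  have "D1 (D2 C) x = D1 (\<lambda>x. - 2 * b x * B x) x"
    by (rule D_cong[OF D2_C x])
  moreover have "D2 (D1 C) x = D2 (\<lambda>x. - 2 * Y x - 2 * b x * T x - 2 * a x * B x) x"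
    by (rule D_cong[OF _ x]) (simp add: D1_C T_def)
  ultimately show ?thesis
    using commutator[of C x] x
    by (simp add: D1_T D2_T D2_X D1_C D2_C gauss T_def[symmetric])
      (simp add: algebra_simps power2_eq_square)
qed

lemma D2_D1_a: "x \<in> W \<Longrightarrow> D2 (D1 a) x = D1 (D2 a) x + a x * D1 a x + b x * D2 a x"
  using commutator[of a x] by simp

text \<open>The commutator on \<open>X\<close>: its derivative along \<open>E2\<close> contains
  \<open>S\<close>, so the cross derivatives give \<open>D1 S\<close>.\<close>

lemma D1_S:
  assumes x: "x \<in> W"
  shows "D1 S x = 5 * B x * K x * a x - 8 * B x * a x * D2 a x + 8 * B x * a x ^ 3
    - 4 * B x * D1 a x * b x + 3 * T x * a x * D1 a x + 3 * T x * a x ^ 2 * b x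
    - 4 * T x * D2 a x * b x - T x * D1 (D2 a) x - 2 * S x * b x - 4 * X x * a x * b x
    + X x * D1 a x + 3 * Y x * a x ^ 2 - 4 * Y x * D2 a x"
proof -
  have "D1 (D2 X) x = D1 (\<lambda>x. S x + a x * X x + b x * Y x) x"
    by (rule D_cong[OF D2_X x])
  moreover have "D2 (D1 X) x = D2 (\<lambda>x. - B x * K x - 4 * a x ^ 2 * B x - 3 * a x * b x * T x
      - D1 a x * T x - 3 * a x * Y x) x"
    by (rule D_cong[OF D1_X x])
  ultimately show ?thesis
    using commutator[of X x] x
    by (simp add: D1_T D2_T D2_X D1_X D2_Y gauss DK D2_D1_a)
      (simp add: algebra_simps power2_eq_square power3_eq_cube)
qed

text \<open>Differentiating the Gauss equation along \<open>E2\<close> rewrites this mixed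
  derivative through derivatives of \<open>a\<close> and lower terms, so that the compatibility
  conditions come out in a normal form in which terms cancel.\<close>

lemma D1_D2_b:
  assumes x: "x \<in> W"
  shows "D1 (D2 b) x = D2 (D2 a) x - 2 * a x * D2 a x - 2 * b x * D2 b x - a x * D1 b x - b x * D2 b x"
proof -
  have "D2 (D1 b) x = D2 (\<lambda>x. D2 a x - a x ^ 2 - b x ^ 2 - K x) x"
    by (rule D_cong[OF gauss x])
  then show ?thesis using commutator[of b x] x by (simp add: DK)
qed

text \<open>Since \<open>S = D1 Y\<close>, this is the commutator on \<open>Y\<close>.\<close>

lemma D2_S:
  assumes x: "x \<in> W"
  shows "D2 S x = 4 * B x * K x * b x - 4 * B x * a x * D2 b x + 8 * B x * a x ^ 2 * b x
    - 8 * B x * D2 a x * b x + 4 * B x * b x ^ 3 - B x * k x - 4 * T x * K x * a x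
    + 6 * T x * a x * D2 a x - 4 * T x * a x * b x ^ 2 - 4 * T x * a x ^ 3 - T x * D2 (D2 a) x
    - 4 * K x * X x + S x * a x - 3 * X x * a x ^ 2 + 3 * X x * D2 a x - 4 * X x * b x ^ 2
    - 3 * Y x * a x * b x - 2 * Y x * D2 b x"
proof -
  have "D1 (D2 Y) x = D1 (\<lambda>x. - B x * K x - 4 * b x ^ 2 * B x + 3 * a x * b x * T x
      - D2 b x * T x + 3 * b x * X x) x"
    by (rule D_cong[OF D2_Y x])
  then show ?thesis
    using commutator[of Y x] x
    by (simp add: D1_T D2_T D2_X D1_X D2_Y gauss DK D2_D1_a D1_D2_b)
      (simp add: algebra_simps power2_eq_square power3_eq_cube)
qed

text \<open>The system for \<open>T, B, X, Y, S, C\<close> is now closed, and the commutators on all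
  unknowns but \<open>S\<close> have been spent. The one on \<open>S\<close> is therefore an
  algebraic condition; in it \<open>Y\<close>, \<open>S\<close> and all second derivatives of
  \<open>a\<close> cancel.\<close>

lemma first_constraint:
  assumes x: "x \<in> W"
  shows "5 * k x * X x + 4 * a x * k x * T x + (D1 k x - b x * k x) * B x = 0"
proof -
  have "D1 (D2 S) x = D1 (\<lambda>x. 4 * B x * K x * b x - 4 * B x * a x * D2 b x + 8 * B x * a x ^ 2 * b x
    - 8 * B x * D2 a x * b x + 4 * B x * b x ^ 3 - B x * k x - 4 * T x * K x * a x
    + 6 * T x * a x * D2 a x - 4 * T x * a x * b x ^ 2 - 4 * T x * a x ^ 3 - T x * D2 (D2 a) x
    - 4 * K x * X x + S x * a x - 3 * X x * a x ^ 2 + 3 * X x * D2 a x - 4 * X x * b x ^ 2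
    - 3 * Y x * a x * b x - 2 * Y x * D2 b x) x"
    by (rule D_cong[OF D2_S x])
  moreover have "D2 (D1 S) x = D2 (\<lambda>x. 5 * B x * K x * a x - 8 * B x * a x * D2 a x + 8 * B x * a x ^ 3
    - 4 * B x * D1 a x * b x + 3 * T x * a x * D1 a x + 3 * T x * a x ^ 2 * b x
    - 4 * T x * D2 a x * b x - T x * D1 (D2 a) x - 2 * S x * b x - 4 * X x * a x * b x
    + X x * D1 a x + 3 * Y x * a x ^ 2 - 4 * Y x * D2 a x) x"
    by (rule D_cong[OF D1_S x])
  moreover have "D2 (D1 (D2 a)) x = D1 (D2 (D2 a)) x + a x * D1 (D2 a) x + b x * D2 (D2 a) x"
    using commutator[of "D2 a" x] x by simp
  ultimately show ?thesis
    using commutator[of S x] x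
    by (simp add: D1_T D2_T D2_X D1_X D2_Y D1_S D2_S gauss DK D2_D1_a D1_D2_b)
      (simp add: algebra_simps power2_eq_square power3_eq_cube)
qed

text \<open>The first constraint differentiated along \<open>E1\<close>; \<open>D1_X\<close> keeps
  \<open>S\<close> out of the result.\<close>

lemma second_constraint:
  assumes x: "x \<in> W"
  shows "7 * a x * k x * Y x + (k x * b x - 6 * D1 k x) * X x
    + (7 * a x * b x * k x - 4 * a x * D1 k x + D1 a x * k x) * T x
    + (4 * K x * k x + 3 * a x ^ 2 * k x + D2 a x * k x + b x * D1 k x - b x ^ 2 * k x - D1 (D1 k) x) * B x = 0"
proof -
  have "D1 (\<lambda>x. 5 * k x * X x + 4 * a x * k x * T x + (D1 k x - b x * k x) * B x) x = D1 (\<lambda>x. 0) x"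
    by (rule D_cong[OF first_constraint x])
  then show ?thesis
    using x by (simp add: D1_T D1_X gauss) (simp add: algebra_simps power2_eq_square)
qed

text \<open>The first constraint differentiated along \<open>E2\<close>; here \<open>D2 X\<close>
  brings in \<open>S\<close>, which is thereby expressed through the other unknowns.\<close>

lemma third_constraint:
  assumes x: "x \<in> W"
  shows "5 * k x * S x = - 2 * a x * k x * X x - (4 * b x * k x + D1 k x) * Y x
    + (4 * a x ^ 2 * k x - 4 * D2 a x * k x) * T x
    + (D2 b x * k x - 16 * a x * b x * k x - 2 * a x * D1 k x - D1 a x * k x) * B x"
proof -
  have "D2 (\<lambda>x. 5 * k x * X x + 4 * a x * k x * T x + (D1 k x - b x * k x) * B x) x = D2 (\<lambda>x. 0) x"
    by (rule D_cong[OF first_constraint x])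
  moreover have "D2 (D1 k) x = D1 (D2 k) x + a x * D1 k x + b x * D2 k x"
    using commutator[of k x] x by simp
  moreover have "D1 (D2 k) x = D1 (\<lambda>x. a x * k x) x"
    by (rule D_cong[OF D2_k x])
  ultimately show ?thesis
    using x by (simp add: D2_T D2_X D2_k) (simp add: algebra_simps power2_eq_square)
qed

end

text \<open>The solution is delivered as a sequence of successive derivatives, the form in which
  \<open>smooth_on_comp\<close> accepts functions of one variable.\<close>

lemma harmonic_oscillator_exists:
  fixes \<mu> :: real
  obtains c :: "nat \<Rightarrow> real \<Rightarrow> real" where "\<And>n t. (c n has_real_derivative c (Suc n) t) (at t)"
    "\<And>n t. c (Suc (Suc n)) t = - \<mu> * c n t" "c 0 t0 = \<alpha>" "c 1 t0 = \<gamma>"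
proof -
  obtain c0 c1 where c: "\<And>t. (c0 has_real_derivative c1 t) (at t)"
    "\<And>t. (c1 has_real_derivative - \<mu> * c0 t) (at t)" "c0 t0 = \<alpha>" "c1 t0 = \<gamma>"
  proof (cases \<mu> "0::real" rule: linorder_cases)
    case less
    define w where "w = sqrt (- \<mu>)"
    have w: "w \<noteq> 0" "\<mu> = - (w * w)" using less by (auto simp: w_def)
    show ?thesis
      by (rule that[of "\<lambda>t. \<alpha> * cosh (w * (t - t0)) + \<gamma> / w * sinh (w * (t - t0))"
            "\<lambda>t. \<alpha> * w * sinh (w * (t - t0)) + \<gamma> * cosh (w * (t - t0))"])
        (use w in \<open>auto intro!: derivative_eq_intros simp: algebra_simps\<close>)
  next
    case equal
    show ?thesis
      by (rule that[of "\<lambda>t. \<alpha> + \<gamma> * (t - t0)" "\<lambda>t. \<gamma>"])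
        (use equal in \<open>auto intro!: derivative_eq_intros\<close>)
  next
    case greater
    define w where "w = sqrt \<mu>"
    have w: "w \<noteq> 0" "\<mu> = w * w" using greater by (auto simp: w_def)
    show ?thesis
      by (rule that[of "\<lambda>t. \<alpha> * cos (w * (t - t0)) + \<gamma> / w * sin (w * (t - t0))"
            "\<lambda>t. \<gamma> * cos (w * (t - t0)) - \<alpha> * w * sin (w * (t - t0))"])
        (use w in \<open>auto intro!: derivative_eq_intros simp: algebra_simps\<close>)
  qed
  \<comment> \<open>The derivatives alternate between \<open>c0\<close> and \<open>c1\<close> and
    gain a factor \<open>- \<mu>\<close> at every second step.\<close>
  define d where "d n t = (- \<mu>) ^ (n div 2) * (if even n then c0 t else c1 t)" for n :: nat and t
  show ?thesis
  proof (rule that[of d])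
    show "(d n has_real_derivative d (Suc n) t) (at t)" for n t
    proof (cases "even n")
      case True
      then show ?thesis
        using DERIV_cmult[OF c(1), of "(- \<mu>) ^ (n div 2)" t] by (simp add: d_def[abs_def])
    next
      case False
      then show ?thesis
        using DERIV_cmult[OF c(2), of "(- \<mu>) ^ (n div 2)" t]
        by (simp add: d_def[abs_def] odd_two_times_div_two_succ algebra_simps)
    qed
  qed (use c in \<open>auto simp: d_def\<close>)
qed

section \<open>Determination of an integral by four numbers\<close>

context quadratic_integral
begin

text \<open>Once the first and third constraints have eliminated \<open>X\<close> and
  \<open>S\<close>, the four functions \<open>T, B, Y, C\<close> satisfy a closed linear system, to
  which uniqueness applies.\<close>

lemma determined_by_values:
  assumes q: "q \<in> W" "A q = 0" "B q = 0" "C q = 0" "Y q = 0" and x: "x \<in> W"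
  shows "A x = 0 \<and> B x = 0 \<and> C x = 0"
proof -
  define \<kappa> where "\<kappa> x = D1 k x / k x" for x
  have k: "\<forall>x\<in>W. k x \<noteq> 0" using k_pos by fastforce
  have \<kappa>: "smooth_on W \<kappa>" using k by (simp add: \<kappa>_def[abs_def])
  \<comment> \<open>\<open>xT\<close> and \<open>xB\<close> are the coefficients of \<open>T\<close>
    and \<open>B\<close> in \<open>X\<close>; in the same way \<open>sT\<close>, \<open>sB\<close>,
    \<open>sY\<close> belong to \<open>S\<close>, and \<open>yT\<close>, \<open>yB\<close> to
    \<open>D2 Y\<close>.\<close>
  define xT where "xT x = - (4 / 5) * a x" for x
  define xB where "xB x = (b x - \<kappa> x) / 5" for x
  define sT where "sT x = (4 * a x ^ 2 - 4 * D2 a x - 2 * a x * xT x) / 5" for x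
  define sB where "sB x = (D2 b x - 16 * a x * b x - 2 * a x * \<kappa> x - D1 a x - 2 * a x * xB x) / 5" for x
  define sY where "sY x = - (4 * b x + \<kappa> x) / 5" for x
  define yT where "yT x = 3 * a x * b x - D2 b x + 3 * b x * xT x" for x
  define yB where "yB x = - K x - 4 * b x ^ 2 + 3 * b x * xB x" for x
  have sm: "smooth_on W xT" "smooth_on W xB" "smooth_on W sT" "smooth_on W sB" "smooth_on W sY"
    "smooth_on W yT" "smooth_on W yB"
    using \<kappa> unfolding xT_def[abs_def] xB_def[abs_def] sT_def[abs_def] sB_def[abs_def] sY_def[abs_def]
      yT_def[abs_def] yB_def[abs_def]
    by simp_all
  have X: "X x = xT x * T x + xB x * B x" if "x \<in> W" for x
    using first_constraint[OF that] k that
    by (simp add: xT_def xB_def \<kappa>_def field_simps)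
  have S: "S x = sT x * T x + sB x * B x + sY x * Y x" if "x \<in> W" for x
  proof -
    have "5 * k x * S x = 5 * k x * (sT x * T x + sB x * B x + sY x * Y x)"
      unfolding third_constraint[OF that] X[OF that] using k that
      by (simp add: sT_def sB_def sY_def \<kappa>_def field_simps)
    then show ?thesis using k that by simp
  qed
  \<comment> \<open>The unknowns in the order \<open>T, B, Y, C\<close>; row \<open>p\<close> of
    \<open>M\<close> and of \<open>N\<close> holds the coefficients of the derivative of
    \<open>u p\<close> along \<open>E1\<close> and \<open>E2\<close>.\<close>
  define u where "u p = [T, B, Y, C] ! p" for p :: nat
  define M where "M p r = [[\<lambda>x. 2 * b x, \<lambda>x. 4 * a x, \<lambda>x. 2, \<lambda>x. 0], [xT, xB, \<lambda>x. 0, \<lambda>x. 0],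
    [sT, sB, sY, \<lambda>x. 0], [\<lambda>x. - 2 * b x, \<lambda>x. - 2 * a x, \<lambda>x. - 2, \<lambda>x. 0]] ! p ! r" for p r :: nat
  define N where "N p r = [[\<lambda>x. - 2 * xT x - 2 * a x, \<lambda>x. - 2 * xB x + 4 * b x, \<lambda>x. 0, \<lambda>x. 0],
    [\<lambda>x. 0, \<lambda>x. 0, \<lambda>x. 1, \<lambda>x. 0], [yT, yB, \<lambda>x. 0, \<lambda>x. 0],
    [\<lambda>x. 0, \<lambda>x. - 2 * b x, \<lambda>x. 0, \<lambda>x. 0]] ! p ! r" for p r :: nat
  have less4: "p < 4 \<longleftrightarrow> p = 0 \<or> p = 1 \<or> p = 2 \<or> p = 3" for p :: nat by auto
  have set4: "{..<4} = {0, 1, 2, 3 :: nat}" by auto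
  have "u p x = 0" if "p < 4" for p
  proof (rule linear_system_unique[where I = "{..<4}" and u = u and M = M and N = N,
        OF _ _ _ _ _ _ q(1) _ x])
    show "smooth_on W (u p)" if "p \<in> {..<4}" for p
      using that by (auto simp: less4 u_def)
    show "continuous_on W (M p r)" if "p \<in> {..<4}" "r \<in> {..<4}" for p r
      using that sm by (auto simp: less4 M_def intro: smooth_on_continuous)
    show "continuous_on W (N p r)" if "p \<in> {..<4}" "r \<in> {..<4}" for p r
      using that sm by (auto simp: less4 N_def intro: smooth_on_continuous)
    show "D1 (u p) x = (\<Sum>r<4. M p r x * u r x)" if "p \<in> {..<4}" "x \<in> W" for p x
      using that
      by (auto simp: less4 set4 M_def u_def D1_T D1_C T_def[symmetric] X S algebra_simps)
    show "D2 (u p) x = (\<Sum>r<4. N p r x * u r x)" if "p \<in> {..<4}" "x \<in> W" for p x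
      using that
      by (auto simp: less4 set4 N_def u_def D2_T D2_C D2_Y T_def[symmetric] X yT_def yB_def algebra_simps)
    show "u p q = 0" if "p \<in> {..<4}" for p
      using that q by (auto simp: less4 u_def T_def)
  qed (use that in auto)
  from this[of 0] this[of 1] this[of 3] show ?thesis by (simp add: u_def T_def)
qed

text \<open>The third constraint differentiated once more along \<open>E2\<close>, with
  \<open>D2_S\<close> inserted: a second condition in which, for \<open>a = 0\<close>,
  \<open>S\<close> no longer occurs.\<close>

lemma fourth_constraint:
  assumes a0: "\<And>x. x \<in> W \<Longrightarrow> a x = 0" and x: "x \<in> W"
  shows "5 * k x * (4 * B x * K x * b x + 4 * B x * b x ^ 3 - B x * k x
      - 4 * K x * X x - 4 * b x ^ 2 * X x - 2 * Y x * D2 b x) =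
    - 3 * D2 b x * k x * Y x
    - (4 * b x * k x + D1 k x) * (- B x * K x - 4 * b x ^ 2 * B x - D2 b x * T x + 3 * b x * X x)
    + D2 (D2 b) x * k x * B x"
proof -
  have Da: "along E a x = 0" if "x \<in> W" for E x
    using D_cong[OF a0 that] by simp
  have DDa: "along E (along E' a) x = 0" if "x \<in> W" for E E' x
    using D_cong[OF Da that] by simp
  have "5 * k x * S x = - (4 * b x * k x + D1 k x) * Y x + D2 b x * k x * B x" if "x \<in> W" for x
    using third_constraint[OF that] by (simp add: a0[OF that] Da[OF that] algebra_simps)
  then have "D2 (\<lambda>x. 5 * k x * S x) x = D2 (\<lambda>x. - (4 * b x * k x + D1 k x) * Y x + D2 b x * k x * B x) x"
    by (rule D_cong[OF _ x])
  moreover have "D2 (D1 k) x = 0"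
    using commutator[of k x] D_cong[of "D2 k" "\<lambda>x. 0" x E1] x a0 by (simp add: D2_k)
  ultimately show ?thesis
    using x by (simp add: D2_S D2_Y D2_k a0 Da DDa) (simp add: algebra_simps)
qed

end

section \<open>The obstructions: necessity, and construction of integrals\<close>

context adapted_frame
begin

text \<open>For \<open>a = 0\<close> this is \<open>- 5 k\<close> times the coefficient of
  \<open>B\<close> in the second constraint after the first has eliminated \<open>X\<close>.\<close>

definition "obstruction5 x =
  5 * k x * (D1 (D1 k) x - b x * D1 k x + b x ^ 2 * k x + K x * k x)
    + (D1 k x - b x * k x) * (b x * k x - 6 * D1 k x) - 25 * K x * k x ^ 2"

text \<open>The same for the fourth constraint when also \<open>D2 b = 0\<close>: what remains as
  coefficient of \<open>B\<close>, up to a nonzero factor. As a polynomial in \<open>b\<close> it is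
  a cubic.\<close>

definition "obstruction4 x =
  3 * b x * (D1 k x - b x * k x) * (D1 k x + 4 * b x * k x)
    - 15 * K x * k x * (D1 k x + 4 * b x * k x) + 25 * k x ^ 3"

text \<open>The constraints are linear in \<open>T, B, Y\<close>, so integrals with prescribed
  values at a point isolate single coefficients.\<close>

lemma obstructions_vanish:
  assumes ex: "\<And>q t \<beta> y. q \<in> W \<Longrightarrow>
    \<exists>A B C. quadratic_integral W E1 E2 a b K k A B C \<and> A q - C q = t \<and> B q = \<beta> \<and> D2 B q = y"
    and x: "x \<in> W"
  shows "a x = 0" "obstruction5 x = 0" "obstruction4 x = 0"
proof -
  have a0: "a x = 0" if x: "x \<in> W" for x
  proof -
    \<comment> \<open>With \<open>T = B = 0\<close> and \<open>Y = 1\<close> the first constraint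
      gives \<open>X = 0\<close>, and the second shrinks to \<open>7 a k = 0\<close>.\<close>
    from ex[OF x, of 0 0 1] obtain A B C where F: "quadratic_integral W E1 E2 a b K k A B C"
      and v: "A x - C x = 0" "B x = 0" "D2 B x = 1" by blast
    interpret quadratic_integral W E1 E2 a b K k A B C by fact
    show ?thesis
      using first_constraint[OF x] second_constraint[OF x] k_pos[OF x] v by (simp add: T_def)
  qed
  then show "a x = 0" using x .
  have Da: "along E a x = 0" if "x \<in> W" for E x
    using D_cong[OF a0 that] by simp
  have b2: "D2 b x = 0" if x: "x \<in> W" for x
  proof -
    \<comment> \<open>For the same values the fourth constraint reads
      \<open>- 10 k D2 b = - 3 k D2 b\<close>.\<close>
    from ex[OF x, of 0 0 1] obtain A B C where F: "quadratic_integral W E1 E2 a b K k A B C"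
      and v: "A x - C x = 0" "B x = 0" "D2 B x = 1" by blast
    interpret quadratic_integral W E1 E2 a b K k A B C by fact
    show ?thesis
      using first_constraint[OF x] fourth_constraint[OF a0 x] k_pos[OF x] v by (simp add: T_def)
  qed
  \<comment> \<open>With \<open>T = Y = 0\<close> and \<open>B = 1\<close> the constraints reduce to
    the coefficients of \<open>B\<close>.\<close>
  from ex[OF x, of 0 1 0] obtain A B C where F: "quadratic_integral W E1 E2 a b K k A B C"
    and v: "A x - C x = 0" "B x = 1" "D2 B x = 0" by blast
  interpret quadratic_integral W E1 E2 a b K k A B C by fact
  have Xk: "5 * k x * X x = b x * k x - D1 k x"
    using first_constraint[OF x] v a0[OF x] by (simp add: T_def)
  have 2: "(k x * b x - 6 * D1 k x) * X x + (4 * K x * k x + b x * D1 k x - b x ^ 2 * k x - D1 (D1 k) x) = 0"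
    using second_constraint[OF x] v a0[OF x] Da[OF x] by (simp add: T_def)
  show "obstruction5 x = 0"
    using 2 Xk unfolding obstruction5_def by algebra
  have DDb: "D2 (D2 b) x = 0"
    using D_cong[of "D2 b" "\<lambda>_. 0" x E2] b2 x by simp
  have 4: "5 * k x * (4 * K x * b x + 4 * b x ^ 3 - k x - 4 * K x * X x - 4 * b x ^ 2 * X x) =
      - (4 * b x * k x + D1 k x) * (- K x - 4 * b x ^ 2 + 3 * b x * X x)"
    using fourth_constraint[OF a0 x] v b2[OF x] DDb by (simp add: T_def algebra_simps)
  have "k x * obstruction4 x = 0"
    using 4 Xk unfolding obstruction4_def by algebra
  then show "obstruction4 x = 0" using k_pos[OF x] by simp
qed

text \<open>\<open>K\<close>, \<open>k\<close> and \<open>D1 k\<close> are constant along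
  \<open>E2\<close>, so differentiating the cubic equation for \<open>b\<close> repeatedly along
  \<open>E2\<close> ends at its leading coefficient, a nonzero multiple of
  \<open>k ^ 2\<close>.\<close>

lemma D2_b_zero:
  assumes a0: "\<And>x. x \<in> W \<Longrightarrow> a x = 0" and o4: "\<And>x. x \<in> W \<Longrightarrow> obstruction4 x = 0" and x: "x \<in> W"
  shows "D2 b x = 0"
proof (rule ccontr)
  assume b2: "D2 b x \<noteq> 0"
  have k2: "D2 k x = 0" if "x \<in> W" for x
    using D2_k[OF that] a0[OF that] by simp
  have k12: "D2 (D1 k) x = 0" if "x \<in> W" for x
    using commutator[of k x] D_cong[of "D2 k" "\<lambda>_. 0" x E1] that a0 k2 by simp
  \<comment> \<open>The first and second derivatives of the cubic with respect to
    \<open>b\<close>.\<close>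
  define q1 where "q1 x = 3 * D1 k x ^ 2 + 18 * b x * k x * D1 k x - 36 * b x ^ 2 * k x ^ 2 - 60 * K x * k x ^ 2" for x
  define q2 where "q2 x = 18 * k x * D1 k x - 72 * b x * k x ^ 2" for x
  have [simp]: "smooth_on W q1" "smooth_on W q2"
    by (simp_all add: q1_def[abs_def] q2_def[abs_def])
  have q1': "D2 q1 x = D2 b x * q2 x" if "x \<in> W" for x
    unfolding q1_def[abs_def] q2_def using that
    by (simp add: k2 k12 DK) (simp add: algebra_simps power2_eq_square)
  have q2': "D2 q2 x = D2 b x * (- 72 * k x ^ 2)" if "x \<in> W" for x
    unfolding q2_def[abs_def] using that by (simp add: k2 k12 DK)
  have 1: "D2 b x * q1 x = 0" if x: "x \<in> W" for x
  proof -
    have "D2 obstruction4 x = 0"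
      using D_cong[OF o4 x] by simp
    moreover have "D2 obstruction4 x = D2 b x * q1 x"
      unfolding obstruction4_def[abs_def] q1_def using x
      by (simp add: k2 k12 DK) (simp add: algebra_simps power2_eq_square)
    ultimately show ?thesis by simp
  qed
  \<comment> \<open>Pointwise: where \<open>D2 b\<close> vanishes nothing is to be shown; elsewhere
    \<open>q1 x = 0\<close>, and the derivative of the previous product leaves only
    \<open>(D2 b) ^ 2 * q2\<close>. The same argument with \<open>q2\<close> gives the final
    contradiction.\<close>
  have 2: "D2 b x * q2 x = 0" if x: "x \<in> W" for x
  proof -
    have "D2 (\<lambda>x. D2 b x * q1 x) x = 0" using D_cong[OF 1 x] by simp
    then show ?thesis using 1[OF x] x q1'[OF x] by auto
  qed
  have "D2 (\<lambda>x. D2 b x * q2 x) x = 0" using D_cong[OF 2 x] by simp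
  then show False using 2[OF x] x q2'[OF x] b2 k_pos[OF x] by auto
qed

text \<open>All coefficients are constant along \<open>E2\<close>, so the system is solved by
  separation of variables for \<open>B\<close>, after which \<open>T\<close> and \<open>C\<close>
  come from closed 1-forms. The four integration constants match the four prescribed
  numbers.\<close>

lemma quadratic_integral_exists:
  assumes a0: "\<And>x. x \<in> W \<Longrightarrow> a x = 0" and o5: "\<And>x. x \<in> W \<Longrightarrow> obstruction5 x = 0"
    and o4: "\<And>x. x \<in> W \<Longrightarrow> obstruction4 x = 0" and q: "q \<in> W"
  shows "\<exists>A B C. quadratic_integral W E1 E2 a b K k A B C \<and>
    A q - C q = t \<and> B q = \<beta> \<and> D2 B q = y \<and> C q = \<gamma>"
proof -
  have k: "k x \<noteq> 0" if "x \<in> W" for x using k_pos[OF that] by simp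
  have Da: "along E a x = 0" if "x \<in> W" for E x
    using D_cong[OF a0 that] by simp
  have b2: "D2 b x = 0" if "x \<in> W" for x
    using D2_b_zero[OF a0 o4 that] .
  have b1: "D1 b x = - (b x ^ 2) - K x" if "x \<in> W" for x
    using gauss[OF that] Da[OF that] a0[OF that] by simp
  have k2: "D2 k x = 0" if "x \<in> W" for x
    using D2_k[OF that] a0[OF that] by simp
  have k12: "D2 (D1 k) x = 0" if "x \<in> W" for x
    using commutator[of k x] D_cong[of "D2 k" "\<lambda>_. 0" x E1] that a0 k2 by simp
  \<comment> \<open>For \<open>a = 0\<close> the first constraint says
    \<open>X = \<xi> B\<close>.\<close>
  define \<xi> where "\<xi> x = (b x - D1 k x / k x) / 5" for x
  have \<xi>_smooth [simp]: "smooth_on W \<xi>"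
    unfolding \<xi>_def[abs_def] using k by simp
  have \<xi>2: "D2 \<xi> x = 0" if "x \<in> W" for x
    unfolding \<xi>_def[abs_def] using that k by (simp add: b2 k2 k12)
  have k1: "D1 k x = (b x - 5 * \<xi> x) * k x" if "x \<in> W" for x
    using k[OF that] by (simp add: \<xi>_def field_simps)
  \<comment> \<open>In terms of \<open>\<xi>\<close> the condition \<open>obstruction5 = 0\<close>
    is a Riccati equation, the same one that the Gauss equation imposes on \<open>b\<close>.\<close>
  have \<xi>1: "D1 \<xi> x = - (\<xi> x ^ 2) - K x" if x: "x \<in> W" for x
  proof -
    have "D1 (D1 k) x = D1 (\<lambda>x. (b x - 5 * \<xi> x) * k x) x" by (rule D_cong[OF k1 x])
    also have "\<dots> = (- (b x ^ 2) - K x - 5 * D1 \<xi> x) * k x + (b x - 5 * \<xi> x) * ((b x - 5 * \<xi> x) * k x)"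
      using x by (simp add: b1 k1)
    finally have "k x ^ 2 * (D1 \<xi> x + \<xi> x ^ 2 + K x) = 0"
      using o5[OF x] k1[OF x] unfolding obstruction5_def by algebra
    then show ?thesis using k[OF x] by simp
  qed
  \<comment> \<open>\<open>obstruction4\<close> after substituting \<open>D1 k\<close>; the common
    factor \<open>k ^ 2\<close> is then cancelled.\<close>
  have o4': "k x = 3 * K x * (b x - \<xi> x) + 3 * b x * \<xi> x * (b x - \<xi> x)" if x: "x \<in> W" for x
  proof -
    have "k x ^ 2 * (k x - (3 * K x * (b x - \<xi> x) + 3 * b x * \<xi> x * (b x - \<xi> x))) = 0"
      using o4[OF x] k1[OF x] unfolding obstruction4_def by algebra
    then show ?thesis using k[OF x] by simp
  qed
  \<comment> \<open>\<open>f = exp \<Lambda>\<close> and \<open>m = exp M\<close> have logarithmic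
    derivatives \<open>b\<close> and \<open>\<xi>\<close> along \<open>E1\<close>:
    \<open>f E2\<close> is the Killing field, and \<open>m\<close> is the factor of \<open>B\<close>
    transverse to it.\<close>
  obtain \<Lambda> where \<Lambda>: "smooth_on W \<Lambda>" "\<And>x. x \<in> W \<Longrightarrow> D1 \<Lambda> x = b x" "\<And>x. x \<in> W \<Longrightarrow> D2 \<Lambda> x = 0"
    by (rule frame_potential[of b "\<lambda>_. 0"]) (use b2 a0 in auto)
  obtain M where M: "smooth_on W M" "\<And>x. x \<in> W \<Longrightarrow> D1 M x = \<xi> x" "\<And>x. x \<in> W \<Longrightarrow> D2 M x = 0"
    by (rule frame_potential[of \<xi> "\<lambda>_. 0"]) (use \<xi>2 a0 in auto)
  note [simp] = \<Lambda>(1) M(1)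
  define f where "f x = exp (\<Lambda> x)" for x
  define m where "m x = exp (M x)" for x
  have f_smooth [simp]: "smooth_on W f" "smooth_on W m"
    by (simp_all add: f_def[abs_def] m_def[abs_def])
  have f0 [simp]: "f x \<noteq> 0" "m x \<noteq> 0" for x by (simp_all add: f_def m_def)
  have Df: "D1 f x = b x * f x" "D2 f x = 0" "D1 m x = \<xi> x * m x" "D2 m x = 0" if "x \<in> W" for x
    using that \<Lambda> M along_comp[OF _ W_open that DERIV_exp]
    by (simp_all add: f_def[abs_def] m_def[abs_def])
  \<comment> \<open>The parameter of the Killing field: \<open>f E2\<close> applied to
    \<open>\<theta>\<close> is 1.\<close>
  obtain \<theta> where \<theta>: "smooth_on W \<theta>" "\<And>x. x \<in> W \<Longrightarrow> D1 \<theta> x = 0" "\<And>x. x \<in> W \<Longrightarrow> D2 \<theta> x = 1 / f x"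
    by (rule frame_potential[of "\<lambda>_. 0" "\<lambda>x. 1 / f x"])
      (use a0 in \<open>auto simp: Df power2_eq_square\<close>)
  \<comment> \<open>The separation constant. \<open>D2_Y\<close> requires
    \<open>D2 Y = - (\<nu> / f ^ 2) B\<close>, and since \<open>E2\<close> differentiates functions
    of \<open>\<theta>\<close> with a factor \<open>1 / f\<close>, this becomes an equation in
    \<open>\<theta>\<close> alone as soon as \<open>\<nu>\<close> is constant.\<close>
  define \<nu> where "\<nu> x = f x ^ 2 * (K x + 4 * b x ^ 2 - 3 * b x * \<xi> x)" for x
  have \<nu>: "\<nu> x = \<nu> q" if x: "x \<in> W" for x
  proof (rule constant_of_D_zero[OF _ _ _ q x])
    show "smooth_on W \<nu>" by (simp add: \<nu>_def[abs_def])
    show "D2 \<nu> x = 0" if "x \<in> W" for x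
      unfolding \<nu>_def[abs_def] using that by (simp add: Df b2 DK \<xi>2)
    show "D1 \<nu> x = 0" if x: "x \<in> W" for x
    proof -
      have "D1 \<nu> x = f x ^ 2 * (k x - 3 * K x * (b x - \<xi> x) - 3 * b x * \<xi> x * (b x - \<xi> x))"
        unfolding \<nu>_def[abs_def] using x
        by (simp add: Df b1 DK \<xi>1) (simp add: algebra_simps power2_eq_square)
      then show ?thesis using o4'[OF x] by simp
    qed
  qed
  \<comment> \<open>The initial values are those that make \<open>B q = \<beta>\<close> and
    \<open>D2 B q = y\<close> for \<open>B = m c(\<theta>)\<close>.\<close>
  obtain c :: "nat \<Rightarrow> real \<Rightarrow> real" where c: "\<And>n t. (c n has_real_derivative c (Suc n) t) (at t)"
    "\<And>n t. c (Suc (Suc n)) t = - \<nu> q * c n t" "c 0 (\<theta> q) = \<beta> / m q" "c 1 (\<theta> q) = y * f q / m q"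
    using harmonic_oscillator_exists[where \<mu> = "\<nu> q"] by blast
  have c_smooth [simp]: "smooth_on W (\<lambda>x. c n (\<theta> x))" for n
    by (rule smooth_on_comp) (use \<theta> c in auto)
  have Dc: "D1 (\<lambda>x. c n (\<theta> x)) x = 0" "D2 (\<lambda>x. c n (\<theta> x)) x = c (Suc n) (\<theta> x) / f x"
    if "x \<in> W" for n x
    using along_comp[OF \<theta>(1) W_open that c(1)] \<theta>(2,3)[OF that] by simp_all
  define B where "B x = m x * c 0 (\<theta> x)" for x
  define Y where "Y x = m x * c 1 (\<theta> x) / f x" for x
  have sB [simp]: "smooth_on W B" "smooth_on W Y"
    by (simp_all add: B_def[abs_def] Y_def[abs_def])
  have B1: "D1 B x = \<xi> x * B x" if "x \<in> W" for x
    unfolding B_def[abs_def] using that by (simp add: Df Dc)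
  have B2: "D2 B x = Y x" if "x \<in> W" for x
    unfolding B_def[abs_def] Y_def using that by (simp add: Df Dc)
  have Y2: "D2 Y x = - (K x + 4 * b x ^ 2 - 3 * b x * \<xi> x) * B x" if x: "x \<in> W" for x
  proof -
    have "D2 Y x = - (m x * \<nu> x * c 0 (\<theta> x)) / f x ^ 2"
      unfolding Y_def[abs_def] using x
      by (simp add: Df Dc c(2) \<nu>[OF x] power2_eq_square)
    then show ?thesis by (simp add: \<nu>_def B_def) (simp add: algebra_simps)
  qed
  \<comment> \<open>\<open>P\<close> is \<open>T / f ^ 2\<close> up to a constant: dividing by
    \<open>f ^ 2\<close> absorbs the term \<open>2 b T\<close> of \<open>D1_T\<close>. Closedness
    rests on the Riccati equations of \<open>b\<close> and \<open>\<xi>\<close> and on the formula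
    for \<open>D2 Y\<close>.\<close>
  obtain P where P: "smooth_on W P" "\<And>x. x \<in> W \<Longrightarrow> D1 P x = 2 * Y x / f x ^ 2"
    "\<And>x. x \<in> W \<Longrightarrow> D2 P x = (4 * b x - 2 * \<xi> x) * B x / f x ^ 2"
  proof (rule frame_potential[of "\<lambda>x. 2 * Y x / f x ^ 2" "\<lambda>x. (4 * b x - 2 * \<xi> x) * B x / f x ^ 2"])
    fix x assume x: "x \<in> W"
    have "D1 (\<lambda>x. (4 * b x - 2 * \<xi> x) * B x / f x ^ 2) x =
        (4 * D1 b x - 2 * D1 \<xi> x + (4 * b x - 2 * \<xi> x) * \<xi> x - 2 * b x * (4 * b x - 2 * \<xi> x)) * B x / f x ^ 2"
      using x by (simp add: Df B1 field_simps power2_eq_square)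
    moreover have "D2 (\<lambda>x. 2 * Y x / f x ^ 2) x = - 2 * (K x + 4 * b x ^ 2 - 3 * b x * \<xi> x) * B x / f x ^ 2"
      using x by (simp add: Df Y2 field_simps power2_eq_square)
    ultimately show "D1 (\<lambda>x. (4 * b x - 2 * \<xi> x) * B x / f x ^ 2) x - D2 (\<lambda>x. 2 * Y x / f x ^ 2) x +
        a x * (2 * Y x / f x ^ 2) + b x * ((4 * b x - 2 * \<xi> x) * B x / f x ^ 2) = 0"
      using x by (simp add: a0 b1 \<xi>1) (simp add: field_simps power2_eq_square)
  qed simp_all
  \<comment> \<open>The constant is chosen to give \<open>T q = t\<close>; \<open>C\<close> is
    normalised in the same way below.\<close>
  define T where "T x = f x ^ 2 * (P x + (t / f q ^ 2 - P q))" for x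
  have sT [simp]: "smooth_on W T" using P(1) by (simp add: T_def[abs_def])
  have T1: "D1 T x = 2 * Y x + 2 * b x * T x" if "x \<in> W" for x
    unfolding T_def[abs_def] using that P by (simp add: Df) (simp add: field_simps power2_eq_square)
  have T2: "D2 T x = (4 * b x - 2 * \<xi> x) * B x" if "x \<in> W" for x
    unfolding T_def[abs_def] using that P by (simp add: Df)
  obtain R where R: "smooth_on W R" "\<And>x. x \<in> W \<Longrightarrow> D1 R x = - 2 * Y x - 2 * b x * T x"
    "\<And>x. x \<in> W \<Longrightarrow> D2 R x = - 2 * b x * B x"
    by (rule frame_potential[of "\<lambda>x. - 2 * Y x - 2 * b x * T x" "\<lambda>x. - 2 * b x * B x"])
      (use a0 in \<open>simp_all add: b1 b2 B1 T2 Y2 algebra_simps power2_eq_square\<close>)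
  define C where "C x = R x + (\<gamma> - R q)" for x
  define A where "A x = T x + C x" for x
  have [simp]: "smooth_on W C" "smooth_on W A" using R(1) by (simp_all add: C_def[abs_def] A_def[abs_def])
  have C1: "D1 C x = - 2 * Y x - 2 * b x * T x" and C2: "D2 C x = - 2 * b x * B x" if "x \<in> W" for x
    using R that by (simp_all add: C_def[abs_def])
  have AC: "A x - C x = T x" for x by (simp add: A_def)
  have "quadratic_integral W E1 E2 a b K k A B C"
  proof unfold_locales
    fix x assume x: "x \<in> W"
    show "D1 A x = 2 * a x * B x" "D2 A x = - 2 * D1 B x - 2 * a x * (A x - C x) + 2 * b x * B x"
      unfolding AC using x a0 by (simp_all add: A_def[abs_def] T1 C1 T2 C2 B1 algebra_simps)
    show "D2 C x = - 2 * b x * B x" "D1 C x = - 2 * D2 B x - 2 * b x * (A x - C x) - 2 * a x * B x"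
      unfolding AC using x a0 by (simp_all add: C1 C2 B2)
  qed simp_all
  moreover have "A q - C q = t" unfolding AC by (simp add: T_def)
  moreover have "B q = \<beta>" "D2 B q = y" "C q = \<gamma>"
    using c(3,4) by (simp_all add: B2[OF q] B_def Y_def C_def)
  ultimately show ?thesis by blast
qed

end

section \<open>The Levi-Civita connection in an orthonormal frame\<close>

lemma pd_eq_along: "pd i f x = along (\<lambda>_. axis i 1) f x"
  by (simp add: pd_def along_def)

lemma matrix_inv_2x2:
  fixes m :: "real^2^2"
  assumes "det m \<noteq> 0"
  shows "matrix_inv m $ 1 $ 1 = m $ 2 $ 2 / det m" "matrix_inv m $ 1 $ 2 = - (m $ 1 $ 2) / det m"
    "matrix_inv m $ 2 $ 1 = - (m $ 2 $ 1) / det m" "matrix_inv m $ 2 $ 2 = m $ 1 $ 1 / det m"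
proof -
  have inv: "matrix_inv m ** m = mat 1"
    using assms someI_ex[of "\<lambda>A'. m ** A' = mat 1 \<and> A' ** m = mat 1"]
    by (simp add: invertible_det_nz[symmetric] invertible_def matrix_inv_def)
  have "(matrix_inv m ** m) $ i $ j = mat 1 $ i $ j" for i j by (simp add: inv)
  note * = this[of 1 1] this[of 1 2] this[of 2 1] this[of 2 2]
  note * = *[unfolded matrix_matrix_mult_def mat_def sum_2 vec_lambda_beta, simplified]
  have d: "det m = m $ 1 $ 1 * m $ 2 $ 2 - m $ 1 $ 2 * m $ 2 $ 1" by (rule det_2)
  have "matrix_inv m $ 1 $ 1 * det m = m $ 2 $ 2" "matrix_inv m $ 1 $ 2 * det m = - (m $ 1 $ 2)"
    "matrix_inv m $ 2 $ 1 * det m = - (m $ 2 $ 1)" "matrix_inv m $ 2 $ 2 * det m = m $ 1 $ 1"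
    using * unfolding d by algebra+
  then show "matrix_inv m $ 1 $ 1 = m $ 2 $ 2 / det m" "matrix_inv m $ 1 $ 2 = - (m $ 1 $ 2) / det m"
    "matrix_inv m $ 2 $ 1 = - (m $ 2 $ 1) / det m" "matrix_inv m $ 2 $ 2 = m $ 1 $ 1 / det m"
    using assms by (simp_all add: field_simps)
qed

locale chart_metric =
  fixes V :: "(real^2) set" and g :: metric
  assumes V_open [simp]: "open V"
    and smooth_metric [simp]: "smooth_on V (\<lambda>x. g x $ i $ j)"
    and symmetric: "x \<in> V \<Longrightarrow> transpose (g x) = g x"
    and positive: "x \<in> V \<Longrightarrow> v \<noteq> 0 \<Longrightarrow> v \<bullet> (g x *v v) > 0"
begin

lemma g_sym: "x \<in> V \<Longrightarrow> g x $ 2 $ 1 = g x $ 1 $ 2"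
  using arg_cong[OF symmetric[of x], of "\<lambda>m. m $ 1 $ 2"] unfolding transpose_def by simp

lemma pd_g_sym: "x \<in> V \<Longrightarrow> pd i (\<lambda>y. g y $ 2 $ 1) x = pd i (\<lambda>y. g y $ 1 $ 2) x"
  by (rule pd_cong_open[OF V_open]) (simp_all add: g_sym)

lemma det_pos:
  assumes x: "x \<in> V"
  shows "det (g x) > 0"
proof -
  have 1: "g x $ 1 $ 1 > 0"
    using positive[OF x, of "axis 1 1"] by (simp add: matrix_vector_mult_basis column_def inner_axis')
  \<comment> \<open>This vector is orthogonal to the first coordinate vector, and its squared length
    is \<open>g $ 1 $ 1\<close> times the determinant.\<close>
  have nz: "vector [- (g x $ 1 $ 2), g x $ 1 $ 1] \<noteq> (0 :: real^2)"
    using 1 by (metis less_irrefl vector_2(2) zero_index)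
  have "g x $ 1 $ 1 * det (g x) > 0"
    using positive[OF x nz] by (simp add: matrix_vector_mult_def inner_vec_def sum_2 det_2 g_sym[OF x] algebra_simps)
  then show ?thesis using 1 by (simp add: zero_less_mult_iff)
qed

lemma smooth_det [simp]: "smooth_on V (\<lambda>x. det (g x))"
  by (simp add: det_2)

lemma smooth_matrix_inv [simp]: "smooth_on V (\<lambda>x. matrix_inv (g x) $ i $ j)"
proof -
  have nz: "\<forall>x\<in>V. det (g x) \<noteq> 0" using det_pos by fastforce
  have "smooth_on V (\<lambda>x. matrix_inv (g x) $ 1 $ 1)"
    by (rule smooth_on_cong[of _ "\<lambda>x. g x $ 2 $ 2 / det (g x)"]) (use nz in \<open>simp_all add: matrix_inv_2x2\<close>)
  moreover have "smooth_on V (\<lambda>x. matrix_inv (g x) $ 1 $ 2)"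
    by (rule smooth_on_cong[of _ "\<lambda>x. - (g x $ 1 $ 2) / det (g x)"]) (use nz in \<open>simp_all add: matrix_inv_2x2\<close>)
  moreover have "smooth_on V (\<lambda>x. matrix_inv (g x) $ 2 $ 1)"
    by (rule smooth_on_cong[of _ "\<lambda>x. - (g x $ 2 $ 1) / det (g x)"]) (use nz in \<open>simp_all add: matrix_inv_2x2\<close>)
  moreover have "smooth_on V (\<lambda>x. matrix_inv (g x) $ 2 $ 2)"
    by (rule smooth_on_cong[of _ "\<lambda>x. g x $ 1 $ 1 / det (g x)"]) (use nz in \<open>simp_all add: matrix_inv_2x2\<close>)
  ultimately show ?thesis using exhaust_2[of i] exhaust_2[of j] by auto
qed

abbreviation "\<Gamma> k i j x \<equiv> christoffel g x k i j"

lemma smooth_pd [simp]: "smooth_on V f \<Longrightarrow> smooth_on V (pd i f)"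
  by (rule smooth_on_pd)

lemma smooth_christoffel [simp]: "smooth_on V (\<Gamma> k i j)"
  by (simp add: christoffel_def[abs_def])

lemma smooth_gauss_curvature [simp]: "smooth_on V (gauss_curvature g)"
proof -
  have "\<forall>x\<in>V. det (g x) \<noteq> 0" using det_pos by fastforce
  then show ?thesis by (simp add: gauss_curvature_def[abs_def] riemann_def[abs_def])
qed

lemma christoffel_sym: "x \<in> V \<Longrightarrow> \<Gamma> k 2 1 x = \<Gamma> k 1 2 x"
  by (simp add: christoffel_def sum_2 pd_g_sym algebra_simps)

text \<open>Contraction with the metric undoes the inverse matrix in \<open>christoffel\<close>,
  leaving the Christoffel symbols of the first kind.\<close>

lemma christoffel_lower:
  assumes x: "x \<in> V"
  shows "\<Gamma> 1 i j x * g x $ 1 $ l + \<Gamma> 2 i j x * g x $ 2 $ l =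
    (pd i (\<lambda>y. g y $ j $ l) x + pd j (\<lambda>y. g y $ i $ l) x - pd l (\<lambda>y. g y $ i $ j) x) / 2"
proof -
  have d: "det (g x) \<noteq> 0" using det_pos[OF x] by simp
  have "\<Gamma> 1 i j x * g x $ 1 $ 1 + \<Gamma> 2 i j x * g x $ 2 $ 1 =
      (pd i (\<lambda>y. g y $ j $ 1) x + pd j (\<lambda>y. g y $ i $ 1) x - pd 1 (\<lambda>y. g y $ i $ j) x) / 2"
    "\<Gamma> 1 i j x * g x $ 1 $ 2 + \<Gamma> 2 i j x * g x $ 2 $ 2 =
      (pd i (\<lambda>y. g y $ j $ 2) x + pd j (\<lambda>y. g y $ i $ 2) x - pd 2 (\<lambda>y. g y $ i $ j) x) / 2"
    unfolding christoffel_def sum_2 matrix_inv_2x2[OF d] using d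
    by (simp_all add: field_simps) (simp_all add: det_2 g_sym[OF x] algebra_simps)
  then show ?thesis using exhaust_2[of l] by auto
qed

text \<open>Metric compatibility: in the sum of the two lowered symbols all derivatives but one
  cancel.\<close>

lemma pd_metric:
  assumes x: "x \<in> V"
  shows "pd i (\<lambda>y. g y $ j $ l) x = \<Gamma> 1 i j x * g x $ 1 $ l + \<Gamma> 2 i j x * g x $ 2 $ l +
    (\<Gamma> 1 i l x * g x $ j $ 1 + \<Gamma> 2 i l x * g x $ j $ 2)"
proof -
  have sym: "g y $ j $ l = g y $ l $ j" if "y \<in> V" for y j l
    using g_sym[OF that] exhaust_2[of j] exhaust_2[of l] by auto
  have 1: "pd i (\<lambda>y. g y $ l $ j) x = pd i (\<lambda>y. g y $ j $ l) x"
    by (rule pd_cong_open[OF V_open x]) (rule sym)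
  have 2: "\<Gamma> 1 i l x * g x $ j $ 1 + \<Gamma> 2 i l x * g x $ j $ 2 =
      (pd i (\<lambda>y. g y $ l $ j) x + pd l (\<lambda>y. g y $ i $ j) x - pd j (\<lambda>y. g y $ i $ l) x) / 2"
    unfolding christoffel_lower[OF x, of i l j, symmetric] by (simp only: sym[OF x, of j])
  show ?thesis
    unfolding 2 christoffel_lower[OF x] 1 by (simp add: field_simps)
qed

end

section \<open>Structure equations of an orthonormal frame\<close>

locale orthonormal_frame = chart_metric +
  fixes W :: "(real^2) set" and e1 e2 :: "real^2 \<Rightarrow> real^2"
  assumes W_sub: "W \<subseteq> V" and W_open [simp]: "open W" and W_convex: "convex W"
    and smooth_e [simp]: "smooth_on W (\<lambda>x. e1 x $ i)" "smooth_on W (\<lambda>x. e2 x $ i)"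
    and orthonormal: "x \<in> W \<Longrightarrow> e1 x \<bullet> (g x *v e1 x) = 1" "x \<in> W \<Longrightarrow> e1 x \<bullet> (g x *v e2 x) = 0"
      "x \<in> W \<Longrightarrow> e2 x \<bullet> (g x *v e2 x) = 1"
begin

lemma W_V: "x \<in> W \<Longrightarrow> x \<in> V"
  using W_sub by blast

lemma smooth_W [simp]: "smooth_on V f \<Longrightarrow> smooth_on W f"
  using smooth_on_subset[OF _ W_sub] .

definition "ip x u v = (u :: real^2) \<bullet> (g x *v v)"

lemma ip_eq: "x \<in> V \<Longrightarrow> ip x u v = g x $ 1 $ 1 * u $ 1 * v $ 1 +
    g x $ 1 $ 2 * (u $ 1 * v $ 2 + u $ 2 * v $ 1) + g x $ 2 $ 2 * u $ 2 * v $ 2"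
  by (simp add: ip_def inner_vec_def matrix_vector_mult_def sum_2 g_sym algebra_simps)

definition "\<delta> x = e1 x $ 1 * e2 x $ 2 - e1 x $ 2 * e2 x $ 1"

lemma ip_e: "x \<in> W \<Longrightarrow> ip x (e1 x) (e1 x) = 1" "x \<in> W \<Longrightarrow> ip x (e1 x) (e2 x) = 0"
  "x \<in> W \<Longrightarrow> ip x (e2 x) (e1 x) = 0" "x \<in> W \<Longrightarrow> ip x (e2 x) (e2 x) = 1"
  using orthonormal[of x] ip_eq[OF W_V, of x "e1 x" "e2 x"] ip_eq[OF W_V, of x "e2 x" "e1 x"]
  by (auto simp: ip_def algebra_simps)

text \<open>The left-hand side is the determinant of the Gram matrix of the frame.\<close>

lemma det_frame: "x \<in> W \<Longrightarrow> \<delta> x ^ 2 * det (g x) = 1"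
proof -
  assume x: "x \<in> W"
  have "\<delta> x ^ 2 * det (g x) =
      ip x (e1 x) (e1 x) * ip x (e2 x) (e2 x) - ip x (e1 x) (e2 x) * ip x (e2 x) (e1 x)"
    unfolding ip_eq[OF W_V[OF x]] \<delta>_def det_2 g_sym[OF W_V[OF x]] by algebra
  then show ?thesis using x by (simp add: ip_e)
qed

text \<open>With the Gram determinant kept as a factor this is a polynomial identity for arbitrary
  vectors; orthonormality then simplifies all coefficients.\<close>

lemma frame_expansion:
  assumes x: "x \<in> W"
  shows "u $ i = ip x u (e1 x) * e1 x $ i + ip x u (e2 x) * e2 x $ i"
proof -
  have "\<delta> x ^ 2 * det (g x) * u $ i =
      (ip x u (e1 x) * ip x (e2 x) (e2 x) - ip x u (e2 x) * ip x (e1 x) (e2 x)) * e1 x $ i +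
      (ip x u (e2 x) * ip x (e1 x) (e1 x) - ip x u (e1 x) * ip x (e1 x) (e2 x)) * e2 x $ i"
    using exhaust_2[of i]
  proof
    assume i: "i = 1"
    show ?thesis
      unfolding i ip_eq[OF W_V[OF x]] \<delta>_def det_2 g_sym[OF W_V[OF x]] by algebra
  next
    assume i: "i = 2"
    show ?thesis
      unfolding i ip_eq[OF W_V[OF x]] \<delta>_def det_2 g_sym[OF W_V[OF x]] by algebra
  qed
  then show ?thesis using x by (simp add: ip_e det_frame)
qed

text \<open>The covariant derivative of the field \<open>e\<close> along the coordinate direction
  \<open>i\<close>.\<close>

definition "nabla i e x = (\<chi> k. pd i (\<lambda>y. e y $ k) x + \<Gamma> k i 1 x * e x $ 1 + \<Gamma> k i 2 x * e x $ 2)"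

lemma nabla_metric:
  assumes x: "x \<in> W" and sm: "\<And>k. smooth_on W (\<lambda>x. e x $ k)" "\<And>k. smooth_on W (\<lambda>x. f x $ k)"
  shows "pd i (\<lambda>x. ip x (e x) (f x)) x = ip x (nabla i e x) (f x) + ip x (e x) (nabla i f x)"
proof -
  have "pd i (\<lambda>x. ip x (e x) (f x)) x = pd i (\<lambda>x. g x $ 1 $ 1 * e x $ 1 * f x $ 1 +
    g x $ 1 $ 2 * (e x $ 1 * f x $ 2 + e x $ 2 * f x $ 1) + g x $ 2 $ 2 * e x $ 2 * f x $ 2) x"
    by (rule pd_cong_open[OF W_open x]) (simp add: ip_eq W_V)
  also have "\<dots> = ip x (nabla i e x) (f x) + ip x (e x) (nabla i f x)"
    using x sm
    by (simp add: pd_eq_along along_add[where W = W] along_mult[where W = W])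
      (simp add: pd_eq_along[symmetric] pd_metric[OF W_V] ip_eq[OF W_V] nabla_def g_sym[OF W_V] algebra_simps)
  finally show ?thesis .
qed

text \<open>The connection form of the frame in coordinates; \<open>a\<close> and \<open>b\<close>
  below are its values on \<open>e1\<close> and \<open>e2\<close>.\<close>

definition "\<omega> i x = ip x (nabla i e1 x) (e2 x)"

text \<open>The inner products of the frame vectors are constant, so metric compatibility makes the
  connection matrix skew, with \<open>\<omega>\<close> as its only entry.\<close>

lemma nabla_frame:
  assumes x: "x \<in> W"
  shows "nabla i e1 x $ k = \<omega> i x * e2 x $ k" "nabla i e2 x $ k = - \<omega> i x * e1 x $ k"
proof -
  have sym: "ip x u v = ip x v u" for u v by (simp add: ip_eq[OF W_V[OF x]] algebra_simps)
  have c: "pd i (\<lambda>x. ip x (e1 x) (e1 x)) x = 0" "pd i (\<lambda>x. ip x (e1 x) (e2 x)) x = 0"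
    "pd i (\<lambda>x. ip x (e2 x) (e2 x)) x = 0"
    using pd_cong_open[OF W_open x, of "\<lambda>x. ip x (e1 x) (e1 x)" "\<lambda>_. 1" i]
      pd_cong_open[OF W_open x, of "\<lambda>x. ip x (e1 x) (e2 x)" "\<lambda>_. 0" i]
      pd_cong_open[OF W_open x, of "\<lambda>x. ip x (e2 x) (e2 x)" "\<lambda>_. 1" i] ip_e
    by (simp_all add: pd_eq_along along_const)
  have "ip x (nabla i e1 x) (e1 x) = 0" "ip x (nabla i e2 x) (e2 x) = 0"
    "ip x (nabla i e2 x) (e1 x) = - \<omega> i x"
    using nabla_metric[OF x smooth_e(1) smooth_e(1), of i] nabla_metric[OF x smooth_e(1) smooth_e(2), of i]
      nabla_metric[OF x smooth_e(2) smooth_e(2), of i] c sym by (auto simp: \<omega>_def)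
  then show "nabla i e1 x $ k = \<omega> i x * e2 x $ k" "nabla i e2 x $ k = - \<omega> i x * e1 x $ k"
    using frame_expansion[OF x, of "nabla i e1 x" k] frame_expansion[OF x, of "nabla i e2 x" k]
    by (simp_all add: \<omega>_def)
qed

lemma pd_frame:
  assumes x: "x \<in> W"
  shows "pd i (\<lambda>y. e1 y $ k) x = \<omega> i x * e2 x $ k - \<Gamma> k i 1 x * e1 x $ 1 - \<Gamma> k i 2 x * e1 x $ 2"
    "pd i (\<lambda>y. e2 y $ k) x = - \<omega> i x * e1 x $ k - \<Gamma> k i 1 x * e2 x $ 1 - \<Gamma> k i 2 x * e2 x $ 2"
  using nabla_frame[OF x, of i k] by (simp_all add: nabla_def)

lemma smooth_\<omega> [simp]: "smooth_on W (\<omega> i)"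
  by (rule smooth_on_cong[of W "\<lambda>x. g x $ 1 $ 1 * nabla i e1 x $ 1 * e2 x $ 1 +
    g x $ 1 $ 2 * (nabla i e1 x $ 1 * e2 x $ 2 + nabla i e1 x $ 2 * e2 x $ 1) + g x $ 2 $ 2 * nabla i e1 x $ 2 * e2 x $ 2"])
    (simp_all add: nabla_def smooth_on_pd \<omega>_def ip_eq W_V)

definition "a x = \<omega> 1 x * e1 x $ 1 + \<omega> 2 x * e1 x $ 2"
definition "b x = \<omega> 1 x * e2 x $ 1 + \<omega> 2 x * e2 x $ 2"

lemma along_frame:
  assumes x: "x \<in> W"
  shows "along e1 (\<lambda>y. e1 y $ k) x = a x * e2 x $ k - nabla_const g x (e1 x) (e1 x) $ k"
    "along e1 (\<lambda>y. e2 y $ k) x = - a x * e1 x $ k - nabla_const g x (e1 x) (e2 x) $ k"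
    "along e2 (\<lambda>y. e1 y $ k) x = b x * e2 x $ k - nabla_const g x (e2 x) (e1 x) $ k"
    "along e2 (\<lambda>y. e2 y $ k) x = - b x * e1 x $ k - nabla_const g x (e2 x) (e2 x) $ k"
  using x by (simp_all add: along_eq_pd[where W = W] pd_frame a_def b_def nabla_const_def sum_2 algebra_simps)

lemma nabla_const_sym: "x \<in> W \<Longrightarrow> nabla_const g x u v = nabla_const g x v u"
  by (simp add: nabla_const_def vec_eq_iff sum_2 christoffel_sym[OF W_V] algebra_simps)

text \<open>The Christoffel terms in the two derivatives of the frame agree by symmetry and drop out
  of the bracket.\<close>

sublocale moving_frame W e1 e2 a b
proof
  show "smooth_on W a" "smooth_on W b" by (simp_all add: a_def[abs_def] b_def[abs_def])
  show "e1 x $ 1 * e2 x $ 2 - e1 x $ 2 * e2 x $ 1 \<noteq> 0" if "x \<in> W" for x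
    using det_frame[OF that] by (auto simp: \<delta>_def)
  show "along e1 (\<lambda>x. e2 x $ i) x - along e2 (\<lambda>x. e1 x $ i) x = - a x * e1 x $ i - b x * e2 x $ i"
    if "x \<in> W" for x i
    using along_frame[OF that] nabla_const_sym[OF that, of "e1 x" "e2 x"] by simp
qed (simp_all add: W_convex)

text \<open>Equality of the mixed partial derivatives of the frame components, with first
  derivatives replaced by \<open>pd_frame\<close>: curvature acts on the frame as the rotation by
  the exterior derivative of \<open>\<omega>\<close>.\<close>

lemma riemann_frame:
  assumes x: "x \<in> W"
  shows "riemann g x k 1 1 2 * e1 x $ 1 + riemann g x k 2 1 2 * e1 x $ 2 =
      (pd 1 (\<omega> 2) x - pd 2 (\<omega> 1) x) * e2 x $ k"
    "riemann g x k 1 1 2 * e2 x $ 1 + riemann g x k 2 1 2 * e2 x $ 2 =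
      - (pd 1 (\<omega> 2) x - pd 2 (\<omega> 1) x) * e1 x $ k"
proof -
  have 1: "pd j (pd i (\<lambda>y. e1 y $ k)) x =
      pd j (\<lambda>y. \<omega> i y * e2 y $ k - \<Gamma> k i 1 y * e1 y $ 1 - \<Gamma> k i 2 y * e1 y $ 2) x" for i j
    by (rule pd_cong_open[OF W_open x pd_frame(1)])
  have 2: "pd j (pd i (\<lambda>y. e2 y $ k)) x =
      pd j (\<lambda>y. - \<omega> i y * e1 y $ k - \<Gamma> k i 1 y * e2 y $ 1 - \<Gamma> k i 2 y * e2 y $ 2) x" for i j
    by (rule pd_cong_open[OF W_open x pd_frame(2)])
  note mixed = pd_commute[OF W_open _ x, of "\<lambda>y. e1 y $ k" 1 2] pd_commute[OF W_open _ x, of "\<lambda>y. e2 y $ k" 1 2]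
  note rules = pd_eq_along along_add[where W = W] along_mult[where W = W] along_diff[where W = W]
    along_minus[where W = W]
  have d1: "pd j (\<lambda>y. \<omega> i y * e2 y $ k - \<Gamma> k i 1 y * e1 y $ 1 - \<Gamma> k i 2 y * e1 y $ 2) x =
      pd j (\<omega> i) x * e2 x $ k + \<omega> i x * pd j (\<lambda>y. e2 y $ k) x
      - pd j (\<Gamma> k i 1) x * e1 x $ 1 - \<Gamma> k i 1 x * pd j (\<lambda>y. e1 y $ 1) x
      - pd j (\<Gamma> k i 2) x * e1 x $ 2 - \<Gamma> k i 2 x * pd j (\<lambda>y. e1 y $ 2) x" for i j
    using x by (simp add: rules)
  have d2: "pd j (\<lambda>y. - \<omega> i y * e1 y $ k - \<Gamma> k i 1 y * e2 y $ 1 - \<Gamma> k i 2 y * e2 y $ 2) x =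
      - pd j (\<omega> i) x * e1 x $ k - \<omega> i x * pd j (\<lambda>y. e1 y $ k) x
      - pd j (\<Gamma> k i 1) x * e2 x $ 1 - \<Gamma> k i 1 x * pd j (\<lambda>y. e2 y $ 1) x
      - pd j (\<Gamma> k i 2) x * e2 x $ 2 - \<Gamma> k i 2 x * pd j (\<lambda>y. e2 y $ 2) x" for i j
    using x by (simp add: rules)
  show "riemann g x k 1 1 2 * e1 x $ 1 + riemann g x k 2 1 2 * e1 x $ 2 =
      (pd 1 (\<omega> 2) x - pd 2 (\<omega> 1) x) * e2 x $ k"
    using mixed(1) unfolding 1 d1 pd_frame[OF x]
    by (simp add: riemann_def sum_2 algebra_simps)
  show "riemann g x k 1 1 2 * e2 x $ 1 + riemann g x k 2 1 2 * e2 x $ 2 =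
      - (pd 1 (\<omega> 2) x - pd 2 (\<omega> 1) x) * e1 x $ k"
    using mixed(2) unfolding 2 d2 pd_frame[OF x]
    by (simp add: riemann_def sum_2 algebra_simps)
qed

text \<open>Both sides are minus the exterior derivative of \<open>\<omega>\<close> on
  \<open>(e1, e2)\<close>, one computed in coordinates, the other in the frame.\<close>

lemma gauss_equation:
  assumes x: "x \<in> W"
  shows "gauss_curvature g x = D2 a x - D1 b x - a x ^ 2 - b x ^ 2"
proof -
  define \<Omega> where "\<Omega> = pd 1 (\<omega> 2) x - pd 2 (\<omega> 1) x"
  have \<delta>: "\<delta> x \<noteq> 0" "det (g x) \<noteq> 0" using det_frame[OF x] by auto
  \<comment> \<open>\<open>s\<close> is the numerator in the definition of the Gaussian
    curvature.\<close>
  define s where "s = riemann g x 1 2 1 2 * g x $ 1 $ 1 + riemann g x 2 2 1 2 * g x $ 1 $ 2"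
  have one: "ip x (axis 1 1) (e1 x) * e1 x $ 1 + ip x (axis 1 1) (e2 x) * e2 x $ 1 = 1"
    using frame_expansion[OF x, of "axis 1 1" 1] by simp
  have ax: "(axis 1 1 :: real^2) $ 1 = 1" "(axis 1 1 :: real^2) $ 2 = 0" by (simp_all add: axis_def)
  have one: "(g x $ 1 $ 1 * e1 x $ 1 + g x $ 1 $ 2 * e1 x $ 2) * e1 x $ 1 +
      (g x $ 1 $ 1 * e2 x $ 1 + g x $ 1 $ 2 * e2 x $ 2) * e2 x $ 1 = 1"
    using one unfolding ip_eq[OF W_V[OF x]] ax by simp
  \<comment> \<open>The two equations of \<open>riemann_frame\<close> solved by Cramer's rule for
    the curvature applied to the second coordinate vector.\<close>
  have "\<delta> x * riemann g x l 2 1 2 = - \<Omega> * (e1 x $ 1 * e1 x $ l + e2 x $ 1 * e2 x $ l)" for l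
    using riemann_frame[OF x, of l] unfolding \<delta>_def \<Omega>_def[symmetric] by algebra
  from this[of 1] this[of 2] one have "\<delta> x * s = - \<Omega>"
    unfolding s_def by algebra
  moreover have "gauss_curvature g x * det (g x) = s"
    using \<delta> by (simp add: gauss_curvature_def sum_2 s_def g_sym[OF W_V[OF x]])
  ultimately have K: "gauss_curvature g x = - \<Omega> * \<delta> x"
    using det_frame[OF x] \<delta> by (algebra)
  have Db: "D1 b x = D1 (\<omega> 1) x * e2 x $ 1 + \<omega> 1 x * D1 (\<lambda>x. e2 x $ 1) x
      + D1 (\<omega> 2) x * e2 x $ 2 + \<omega> 2 x * D1 (\<lambda>x. e2 x $ 2) x"
    unfolding b_def[abs_def] using x by simp
  have Da: "D2 a x = D2 (\<omega> 1) x * e1 x $ 1 + \<omega> 1 x * D2 (\<lambda>x. e1 x $ 1) x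
      + D2 (\<omega> 2) x * e1 x $ 2 + \<omega> 2 x * D2 (\<lambda>x. e1 x $ 2) x"
    unfolding a_def[abs_def] using x by simp
  have D\<omega>: "D1 (\<omega> i) x = e1 x $ 1 * pd 1 (\<omega> i) x + e1 x $ 2 * pd 2 (\<omega> i) x"
    "D2 (\<omega> i) x = e2 x $ 1 * pd 1 (\<omega> i) x + e2 x $ 2 * pd 2 (\<omega> i) x" for i
    using x by (simp_all add: along_eq_pd[where W = W])
  \<comment> \<open>The derivatives of the frame components combine to the bracket, which
    contributes the two squares.\<close>
  have "D1 b x - D2 a x = \<Omega> * \<delta> x - a x * a x - b x * b x"
    unfolding Db Da D\<omega> along_frame[OF x] nabla_const_sym[OF x, of "e2 x" "e1 x"]
    by (simp add: \<Omega>_def \<delta>_def) (simp add: a_def b_def algebra_simps)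
  then show ?thesis by (simp add: K power2_eq_square)
qed

end

section \<open>Second and third covariant derivatives of a function\<close>

context chart_metric
begin

definition "hess f i j x = pd i (pd j f) x - \<Gamma> 1 i j x * pd 1 f x - \<Gamma> 2 i j x * pd 2 f x"

text \<open>The first index is the direction of the last differentiation, as in
  \<open>cov_diff\<close>.\<close>

definition "third f i j l x = pd i (hess f j l) x - \<Gamma> 1 i j x * hess f 1 l x - \<Gamma> 2 i j x * hess f 2 l x
  - \<Gamma> 1 i l x * hess f j 1 x - \<Gamma> 2 i l x * hess f j 2 x"

lemma smooth_hess [simp]: "smooth_on V f \<Longrightarrow> smooth_on V (hess f i j)"
  unfolding hess_def[abs_def] by simp

lemma frechet_smooth:
  "smooth_on V f \<Longrightarrow> x \<in> V \<Longrightarrow> frechet_derivative f (at x) v = v $ 1 * pd 1 f x + v $ 2 * pd 2 f x"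
  by (simp add: frechet_derivative_eq_pd smooth_on_differentiable_at[where S = V])

lemma d_nabla_2:
  assumes f: "smooth_on V f" and x: "x \<in> V"
  shows "d_nabla g 2 f x [v, w] = v $ 1 * w $ 1 * hess f 1 1 x + v $ 1 * w $ 2 * hess f 1 2 x
    + v $ 2 * w $ 1 * hess f 2 1 x + v $ 2 * w $ 2 * hess f 2 2 x"
proof -
  have "frechet_derivative (\<lambda>y. frechet_derivative f (at y) w) (at x) v =
      along (\<lambda>_. v) (\<lambda>y. w $ 1 * pd 1 f y + w $ 2 * pd 2 f y) x"
    unfolding along_def
    by (subst frechet_derivative_cong_open[OF V_open x]) (use f in \<open>auto simp: frechet_smooth\<close>)
  also have "\<dots> = w $ 1 * (v $ 1 * pd 1 (pd 1 f) x + v $ 2 * pd 2 (pd 1 f) x) +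
      w $ 2 * (v $ 1 * pd 1 (pd 2 f) x + v $ 2 * pd 2 (pd 2 f) x)"
    using f x by (simp add: along_add[where W = V] along_mult[where W = V] along_const)
      (simp add: along_eq_pd[where W = V])
  finally show ?thesis
    using f x
    by (simp add: d_nabla_def numeral_2_eq_2 frechet_smooth nabla_const_def sum_2 hess_def algebra_simps)
qed

lemma d_nabla_3:
  assumes f: "smooth_on V f" and x: "x \<in> V"
  shows "d_nabla g 3 f x [u, v, w] = (\<Sum>i\<in>UNIV. \<Sum>j\<in>UNIV. \<Sum>l\<in>UNIV. u $ i * v $ j * w $ l * third f i j l x)"
proof -
  have "frechet_derivative (\<lambda>y. d_nabla g 2 f y [v, w]) (at x) u =
      along (\<lambda>_. u) (\<lambda>y. v $ 1 * w $ 1 * hess f 1 1 y + v $ 1 * w $ 2 * hess f 1 2 y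
    + v $ 2 * w $ 1 * hess f 2 1 y + v $ 2 * w $ 2 * hess f 2 2 y) x"
    unfolding along_def
    by (subst frechet_derivative_cong_open[OF V_open x]) (use f in \<open>auto simp: d_nabla_2\<close>)
  also have "\<dots> = u $ 1 * (v $ 1 * w $ 1 * pd 1 (hess f 1 1) x + v $ 1 * w $ 2 * pd 1 (hess f 1 2) x
    + v $ 2 * w $ 1 * pd 1 (hess f 2 1) x + v $ 2 * w $ 2 * pd 1 (hess f 2 2) x)
    + u $ 2 * (v $ 1 * w $ 1 * pd 2 (hess f 1 1) x + v $ 1 * w $ 2 * pd 2 (hess f 1 2) x
    + v $ 2 * w $ 1 * pd 2 (hess f 2 1) x + v $ 2 * w $ 2 * pd 2 (hess f 2 2) x)"
    using f x by (simp add: along_add[where W = V] along_mult[where W = V] along_const)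
      (simp add: along_eq_pd[where W = V] algebra_simps)
  finally have 1: "frechet_derivative (\<lambda>y. d_nabla g 2 f y [v, w]) (at x) u = \<dots>" .
  have "d_nabla g 3 f x [u, v, w] = frechet_derivative (\<lambda>y. d_nabla g 2 f y [v, w]) (at x) u
      - d_nabla g 2 f x [nabla_const g x u v, w] - d_nabla g 2 f x [v, nabla_const g x u w]"
    by (simp add: d_nabla_def numeral_3_eq_3 numeral_2_eq_2)
  then show ?thesis
    unfolding 1 d_nabla_2[OF f x] by (simp add: nabla_const_def sum_2 third_def algebra_simps)
qed

end

context orthonormal_frame
begin

definition "Hess f v w x = v x $ 1 * w x $ 1 * hess f 1 1 x + v x $ 1 * w x $ 2 * hess f 1 2 x
    + v x $ 2 * w x $ 1 * hess f 2 1 x + v x $ 2 * w x $ 2 * hess f 2 2 x"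

text \<open>The product rule for an iterated derivative: a Hessian term and the covariant derivative
  of the second field applied to \<open>f\<close>. For frame fields \<open>along_frame\<close>
  supplies the latter.\<close>

lemma along_pd:
  assumes f: "smooth_on V f" and x: "x \<in> W" and e': "\<And>i. smooth_on W (\<lambda>x. e' x $ i)"
  shows "along e (along e' f) x = (along e (\<lambda>x. e' x $ 1) x + nabla_const g x (e x) (e' x) $ 1) * pd 1 f x +
    (along e (\<lambda>x. e' x $ 2) x + nabla_const g x (e x) (e' x) $ 2) * pd 2 f x + Hess f e e' x"
proof -
  have "along e (along e' f) x = along e (\<lambda>x. e' x $ 1 * pd 1 f x + e' x $ 2 * pd 2 f x) x"
    by (rule D_cong[OF _ x]) (use f in \<open>simp add: along_eq_pd[where W = W]\<close>)
  also have "\<dots> = along e (\<lambda>x. e' x $ 1) x * pd 1 f x + e' x $ 1 * along e (pd 1 f) x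
      + along e (\<lambda>x. e' x $ 2) x * pd 2 f x + e' x $ 2 * along e (pd 2 f) x"
    using f x e' by simp
  finally show ?thesis
    using f x by (simp add: along_eq_pd[where W = W] Hess_def hess_def nabla_const_def sum_2 algebra_simps)
qed

lemma Hess_frame:
  assumes f: "smooth_on V f" and x: "x \<in> W"
  shows "Hess f e1 e1 x = D1 (D1 f) x - a x * D2 f x" "Hess f e1 e2 x = D1 (D2 f) x + a x * D1 f x"
    "Hess f e2 e1 x = D2 (D1 f) x - b x * D2 f x" "Hess f e2 e2 x = D2 (D2 f) x + b x * D1 f x"
  using f x by (simp_all add: along_pd along_frame)
    (simp_all add: along_eq_pd[where W = W] algebra_simps)

definition "Third f u v w x = (\<Sum>i\<in>UNIV. \<Sum>j\<in>UNIV. \<Sum>l\<in>UNIV. u x $ i * v x $ j * w x $ l * third f i j l x)"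

lemma Third_frame:
  assumes f: "smooth_on V f" and x: "x \<in> W"
  shows "Third f e1 e1 e1 x = D1 (Hess f e1 e1) x - a x * (Hess f e1 e2 x + Hess f e2 e1 x)"
    "Third f e1 e2 e2 x = D1 (Hess f e2 e2) x + a x * (Hess f e1 e2 x + Hess f e2 e1 x)"
proof -
  have h: "D1 (hess f i j) x = e1 x $ 1 * pd 1 (hess f i j) x + e1 x $ 2 * pd 2 (hess f i j) x" for i j
    using f x by (simp add: along_eq_pd[where W = W])
  show "Third f e1 e1 e1 x = D1 (Hess f e1 e1) x - a x * (Hess f e1 e2 x + Hess f e2 e1 x)"
    unfolding Hess_def[abs_def] using f x
    by (simp add: along_frame h)
      (simp add: Third_def third_def sum_2 nabla_const_def algebra_simps)
  show "Third f e1 e2 e2 x = D1 (Hess f e2 e2) x + a x * (Hess f e1 e2 x + Hess f e2 e1 x)"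
    unfolding Hess_def[abs_def] using f x
    by (simp add: along_frame h)
      (simp add: Third_def third_def sum_2 nabla_const_def algebra_simps)
qed

end

section \<open>Integrals of the geodesic flow in frame momenta\<close>

lemma smooth_on_component [simp]: "open S \<Longrightarrow> smooth_on S (\<lambda>p. p $ i)"
proof (rule smooth_on_of_pd[where f' = "\<lambda>j _. axis j 1 $ i"])
  have d: "((\<lambda>p. p $ i) has_derivative (\<lambda>v. v $ i)) (at x)" for x :: "real^2"
    by (rule bounded_linear_imp_has_derivative[OF bounded_linear_vec_nth])
  then show "(\<lambda>p. p $ i) differentiable (at x)" for x :: "real^2" by (auto simp: differentiable_def)
  show "pd j (\<lambda>p. p $ i) x = axis j 1 $ i" for j x using pd_eqI[OF d] .
qed simp_all

definition quadratic_form :: "(real^2 \<Rightarrow> real^2) \<Rightarrow> (real^2 \<Rightarrow> real^2) \<Rightarrow> (real^2 \<Rightarrow> real) \<Rightarrow>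
    (real^2 \<Rightarrow> real) \<Rightarrow> (real^2 \<Rightarrow> real) \<Rightarrow> real^2 \<Rightarrow> real^2 \<Rightarrow> real" where
  "quadratic_form e1 e2 A B C x p = A x * (p \<bullet> e1 x) ^ 2 + 2 * B x * (p \<bullet> e1 x) * (p \<bullet> e2 x) + C x * (p \<bullet> e2 x) ^ 2"

context orthonormal_frame
begin

text \<open>The inverse metric is the sum of the tensor squares of the vectors of an orthonormal
  frame.\<close>

lemma hamiltonian_frame:
  assumes x: "x \<in> W"
  shows "hamiltonian g x p = (p \<bullet> e1 x) ^ 2 + (p \<bullet> e2 x) ^ 2"
proof -
  have d: "det (g x) \<noteq> 0" using det_pos[OF W_V[OF x]] by simp
  have ax: "(axis 1 1 :: real^2) $ 1 = 1" "(axis 1 1 :: real^2) $ 2 = 0"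
    "(axis 2 1 :: real^2) $ 1 = 0" "(axis 2 1 :: real^2) $ 2 = 1" by (simp_all add: axis_def)
  note * = frame_expansion[OF x, of "axis 1 1" 1] frame_expansion[OF x, of "axis 1 1" 2]
    frame_expansion[OF x, of "axis 2 1" 1] frame_expansion[OF x, of "axis 2 1" 2]
  note * = *[unfolded ip_eq[OF W_V[OF x]] ax]
  have dd: "det (g x) = g x $ 1 $ 1 * g x $ 2 $ 2 - g x $ 1 $ 2 * g x $ 1 $ 2"
    by (simp add: det_2 g_sym[OF W_V[OF x]])
  have N: "det (g x) * (e1 x $ 1 * e1 x $ 1 + e2 x $ 1 * e2 x $ 1) = g x $ 2 $ 2"
    "det (g x) * (e1 x $ 1 * e1 x $ 2 + e2 x $ 1 * e2 x $ 2) = - (g x $ 1 $ 2)"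
    "det (g x) * (e1 x $ 2 * e1 x $ 2 + e2 x $ 2 * e2 x $ 2) = g x $ 1 $ 1"
    using * unfolding dd by algebra+
  then have inv: "matrix_inv (g x) $ 1 $ 1 = e1 x $ 1 * e1 x $ 1 + e2 x $ 1 * e2 x $ 1"
    "matrix_inv (g x) $ 1 $ 2 = e1 x $ 1 * e1 x $ 2 + e2 x $ 1 * e2 x $ 2"
    "matrix_inv (g x) $ 2 $ 1 = e1 x $ 1 * e1 x $ 2 + e2 x $ 1 * e2 x $ 2"
    "matrix_inv (g x) $ 2 $ 2 = e1 x $ 2 * e1 x $ 2 + e2 x $ 2 * e2 x $ 2"
    using d by (simp_all add: matrix_inv_2x2 g_sym[OF W_V[OF x]] field_simps)
  show ?thesis
    by (simp add: hamiltonian_def sum_2 inv inner_vec_def algebra_simps power2_eq_square)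
qed

lemma momenta_surj:
  assumes x: "x \<in> W"
  obtains p where "p \<bullet> e1 x = s" "p \<bullet> e2 x = t"
proof
  have sym: "ip x u v = v \<bullet> (g x *v u)" for u v
    using ip_eq[OF W_V[OF x], of u v] ip_eq[OF W_V[OF x], of v u] by (simp add: ip_def algebra_simps)
  show "(g x *v (s *\<^sub>R e1 x + t *\<^sub>R e2 x)) \<bullet> e1 x = s" "(g x *v (s *\<^sub>R e1 x + t *\<^sub>R e2 x)) \<bullet> e2 x = t"
    using ip_e[OF x] unfolding sym
    by (simp_all add: matrix_vector_right_distrib matrix_vector_mult_scaleR inner_add_right inner_commute)
qed

lemma quadratic_form_eq_0_iff:
  assumes x: "x \<in> W"
  shows "(\<forall>p. quadratic_form e1 e2 A B C x p = 0) \<longleftrightarrow> A x = 0 \<and> B x = 0 \<and> C x = 0"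
proof
  assume *: "\<forall>p. quadratic_form e1 e2 A B C x p = 0"
  have "A x * s ^ 2 + 2 * B x * s * t + C x * t ^ 2 = 0" for s t
    using * momenta_surj[OF x, of s t] unfolding quadratic_form_def by metis
  from this[of 1 0] this[of 0 1] this[of 1 1] show "A x = 0 \<and> B x = 0 \<and> C x = 0" by simp
qed (simp add: quadratic_form_def)

text \<open>In terms of the frame momenta \<open>P1\<close>, \<open>P2\<close> their derivatives
  survive only in the combination \<open>D1 P2 - D2 P1\<close>, which \<open>bracket\<close> turns
  into \<open>- a P1 - b P2\<close>.\<close>

lemma poisson_frame:
  assumes sm: "smooth_on W A" "smooth_on W B" "smooth_on W C"
    and F: "\<And>x p. x \<in> W \<Longrightarrow> F x p = quadratic_form e1 e2 A B C x p" and x: "x \<in> W"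
  shows "poisson (hamiltonian g) F x p = - 2 *
    ((D1 A x - 2 * a x * B x) * (p \<bullet> e1 x) ^ 3
     + (D2 A x + 2 * D1 B x + 2 * a x * (A x - C x) - 2 * b x * B x) * (p \<bullet> e1 x) ^ 2 * (p \<bullet> e2 x)
     + (2 * D2 B x + D1 C x + 2 * b x * (A x - C x) + 2 * a x * B x) * (p \<bullet> e1 x) * (p \<bullet> e2 x) ^ 2
     + (D2 C x + 2 * b x * B x) * (p \<bullet> e2 x) ^ 3)"
proof -
  define P1 where "P1 y = p $ 1 * e1 y $ 1 + p $ 2 * e1 y $ 2" for y
  define P2 where "P2 y = p $ 1 * e2 y $ 1 + p $ 2 * e2 y $ 2" for y
  have Pe: "p \<bullet> e1 y = P1 y" "p \<bullet> e2 y = P2 y" for y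
    by (simp_all add: P1_def P2_def inner_vec_def sum_2)
  have [simp]: "smooth_on W P1" "smooth_on W P2" by (simp_all add: P1_def[abs_def] P2_def[abs_def])
  define H where "H y = P1 y ^ 2 + P2 y ^ 2" for y
  define f where "f y = A y * P1 y ^ 2 + 2 * B y * P1 y * P2 y + C y * P2 y ^ 2" for y
  have [simp]: "smooth_on W H" "smooth_on W f" using sm by (simp_all add: H_def[abs_def] f_def[abs_def])
  have pdH: "pd i (\<lambda>y. hamiltonian g y p) x = pd i H x" for i
    by (rule pd_cong_open[OF W_open x]) (simp add: hamiltonian_frame H_def Pe)
  have pdF: "pd i (\<lambda>y. F y p) x = pd i f x" for i
    by (rule pd_cong_open[OF W_open x]) (simp add: F f_def quadratic_form_def Pe)
  note rules = pd_eq_along along_add[where W = UNIV] along_mult[where W = UNIV] along_power[where W = UNIV] along_const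
  have pe: "pd i (\<lambda>p. p \<bullet> e) p = e $ i" for i p and e :: "real^2"
    by (rule pd_eqI[of _ "\<lambda>p. p \<bullet> e", THEN trans]) (auto simp: inner_axis' intro!: derivative_eq_intros)
  have [simp]: "smooth_on UNIV (\<lambda>p. p \<bullet> e)" for e :: "real^2"
    by (simp add: inner_vec_def)
  have Hx: "hamiltonian g x = (\<lambda>p. (p \<bullet> e1 x) ^ 2 + (p \<bullet> e2 x) ^ 2)"
    using hamiltonian_frame[OF x] by blast
  have Fx: "F x = (\<lambda>p. A x * (p \<bullet> e1 x) ^ 2 + 2 * B x * (p \<bullet> e1 x) * (p \<bullet> e2 x) + C x * (p \<bullet> e2 x) ^ 2)"
    using F[OF x] by (simp add: fun_eq_iff quadratic_form_def)
  have pdHx: "pd i (hamiltonian g x) p = 2 * P1 x * e1 x $ i + 2 * P2 x * e2 x $ i" for i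
    unfolding Hx by (simp add: rules) (simp add: pd_eq_along[symmetric] pe Pe)
  have pdFx: "pd i (F x) p = (2 * A x * P1 x + 2 * B x * P2 x) * e1 x $ i + (2 * B x * P1 x + 2 * C x * P2 x) * e2 x $ i" for i
    unfolding Fx by (simp add: rules) (simp add: pd_eq_along[symmetric] pe Pe algebra_simps)
  have "poisson (hamiltonian g) F x p =
      (2 * A x * P1 x + 2 * B x * P2 x) * D1 H x + (2 * B x * P1 x + 2 * C x * P2 x) * D2 H x
      - 2 * P1 x * D1 f x - 2 * P2 x * D2 f x"
    unfolding poisson_def sum_2 pdH pdF pdHx pdFx using x
    by (simp add: along_eq_pd[where W = W] algebra_simps)
  moreover have "along e H x = 2 * P1 x * along e P1 x + 2 * P2 x * along e P2 x" for e
    unfolding H_def[abs_def] using x by simp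
  moreover have "along e f x = along e A x * P1 x ^ 2 + 2 * along e B x * P1 x * P2 x + along e C x * P2 x ^ 2
      + 2 * A x * P1 x * along e P1 x + 2 * B x * (along e P1 x * P2 x + P1 x * along e P2 x) + 2 * C x * P2 x * along e P2 x" for e
    unfolding f_def[abs_def] using x sm by (simp add: algebra_simps)
  moreover have "D1 P2 x = D2 P1 x - a x * P1 x - b x * P2 x"
  proof -
    have "D1 P2 x - D2 P1 x = p $ 1 * (D1 (\<lambda>x. e2 x $ 1) x - D2 (\<lambda>x. e1 x $ 1) x) +
        p $ 2 * (D1 (\<lambda>x. e2 x $ 2) x - D2 (\<lambda>x. e1 x $ 2) x)"
      unfolding P1_def[abs_def] P2_def[abs_def] using x by (simp add: algebra_simps)
    then show ?thesis unfolding bracket[OF x] by (simp add: P1_def P2_def algebra_simps)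
  qed
  ultimately show ?thesis
    unfolding Pe by (simp add: algebra_simps power2_eq_square power3_eq_cube)
qed

lemma poisson_eq_0_iff:
  assumes sm: "smooth_on W A" "smooth_on W B" "smooth_on W C"
    and F: "\<And>x p. x \<in> W \<Longrightarrow> F x p = quadratic_form e1 e2 A B C x p" and x: "x \<in> W"
  shows "(\<forall>p. poisson (hamiltonian g) F x p = 0) \<longleftrightarrow>
    D1 A x = 2 * a x * B x \<and> D2 C x = - 2 * b x * B x \<and>
    D2 A x = - 2 * D1 B x - 2 * a x * (A x - C x) + 2 * b x * B x \<and>
    D1 C x = - 2 * D2 B x - 2 * b x * (A x - C x) - 2 * a x * B x"
    (is "?l \<longleftrightarrow> ?r")
proof
  define c0 where "c0 = D1 A x - 2 * a x * B x"
  define c1 where "c1 = D2 A x + 2 * D1 B x + 2 * a x * (A x - C x) - 2 * b x * B x"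
  define c2 where "c2 = 2 * D2 B x + D1 C x + 2 * b x * (A x - C x) + 2 * a x * B x"
  define c3 where "c3 = D2 C x + 2 * b x * B x"
  have P: "poisson (hamiltonian g) F x p = - 2 * (c0 * (p \<bullet> e1 x) ^ 3 + c1 * (p \<bullet> e1 x) ^ 2 * (p \<bullet> e2 x)
      + c2 * (p \<bullet> e1 x) * (p \<bullet> e2 x) ^ 2 + c3 * (p \<bullet> e2 x) ^ 3)" for p
    unfolding c0_def c1_def c2_def c3_def by (rule poisson_frame[OF sm _ x]) (simp add: F)
  {
    assume ?l
    have "c0 * s ^ 3 + c1 * s ^ 2 * t + c2 * s * t ^ 2 + c3 * t ^ 3 = 0" for s t
    proof -
      obtain p where p: "p \<bullet> e1 x = s" "p \<bullet> e2 x = t" using momenta_surj[OF x] by blast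
      have "poisson (hamiltonian g) F x p = 0" using \<open>?l\<close> by blast
      then show ?thesis using P[of p] by (simp add: p)
    qed
    \<comment> \<open>Four values of a binary cubic form that determine its coefficients.\<close>
    from this[of 1 0] this[of 0 1] this[of 1 1] this[of 1 "-1"]
    have "c0 = 0" "c1 = 0" "c2 = 0" "c3 = 0" by auto
    then show ?r by (simp add: c0_def c1_def c2_def c3_def)
  }
  assume ?r
  then have "c0 = 0" "c1 = 0" "c2 = 0" "c3 = 0" by (simp_all add: c0_def c1_def c2_def c3_def)
  then show ?l by (simp add: P)
qed

text \<open>The coefficients of a quadratic form in the frame momenta are its values on the coframe
  \<open>g e\<^sub>1\<close>, \<open>g e\<^sub>2\<close>.\<close>

lemma quadratic_form_of_coefficients:
  assumes u: "\<And>i. i \<le> 2 \<Longrightarrow> smooth_on W (u i)"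
  obtains A B C where "smooth_on W A" "smooth_on W B" "smooth_on W C"
    "\<And>x p. x \<in> W \<Longrightarrow> (\<Sum>i\<le>2. u i x * p $ 1 ^ i * p $ 2 ^ (2 - i)) = quadratic_form e1 e2 A B C x p"
proof -
  define l where "l e j x = g x $ 1 $ j * e x $ 1 + g x $ 2 $ j * (e x $ 2 :: real)" for e :: "real^2 \<Rightarrow> real^2" and j :: 2 and x
  have [simp]: "smooth_on W (l e1 j)" "smooth_on W (l e2 j)" for j by (simp_all add: l_def[abs_def])
  define A where "A x = u 2 x * l e1 1 x ^ 2 + u 1 x * l e1 1 x * l e1 2 x + u 0 x * l e1 2 x ^ 2" for x
  define C where "C x = u 2 x * l e2 1 x ^ 2 + u 1 x * l e2 1 x * l e2 2 x + u 0 x * l e2 2 x ^ 2" for x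
  define B where "B x = u 2 x * l e1 1 x * l e2 1 x + u 1 x * (l e1 1 x * l e2 2 x + l e1 2 x * l e2 1 x) * (1 / 2)
      + u 0 x * l e1 2 x * l e2 2 x" for x
  show ?thesis
  proof
    show "smooth_on W A" "smooth_on W B" "smooth_on W C"
      using u by (simp_all add: A_def[abs_def] B_def[abs_def] C_def[abs_def])
    fix x p assume x: "x \<in> W"
    have ax: "(axis 1 1 :: real^2) $ 1 = 1" "(axis 1 1 :: real^2) $ 2 = 0"
      "(axis 2 1 :: real^2) $ 1 = 0" "(axis 2 1 :: real^2) $ 2 = 1" by (simp_all add: axis_def)
    have e: "ip x (axis j 1) (e1 x) = l e1 j x" "ip x (axis j 1) (e2 x) = l e2 j x" for j
      using exhaust_2[of j] by (auto simp: ip_eq[OF W_V[OF x]] ax l_def g_sym[OF W_V[OF x]])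
    note * = frame_expansion[OF x, of "axis 1 1" 1] frame_expansion[OF x, of "axis 1 1" 2]
      frame_expansion[OF x, of "axis 2 1" 1] frame_expansion[OF x, of "axis 2 1" 2]
    note * = *[unfolded e ax]
    define P1 where "P1 = p \<bullet> e1 x"
    define P2 where "P2 = p \<bullet> e2 x"
    have "p $ 1 = l e1 1 x * P1 + l e2 1 x * P2"
    proof -
      have "l e1 1 x * P1 + l e2 1 x * P2 = p $ 1 * (l e1 1 x * e1 x $ 1 + l e2 1 x * e2 x $ 1) +
          p $ 2 * (l e1 1 x * e1 x $ 2 + l e2 1 x * e2 x $ 2)"
        by (simp add: P1_def P2_def inner_vec_def sum_2 algebra_simps)
      then show ?thesis by (simp flip: *)
    qed
    moreover have "p $ 2 = l e1 2 x * P1 + l e2 2 x * P2"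
    proof -
      have "l e1 2 x * P1 + l e2 2 x * P2 = p $ 1 * (l e1 2 x * e1 x $ 1 + l e2 2 x * e2 x $ 1) +
          p $ 2 * (l e1 2 x * e1 x $ 2 + l e2 2 x * e2 x $ 2)"
        by (simp add: P1_def P2_def inner_vec_def sum_2 algebra_simps)
      then show ?thesis by (simp flip: *)
    qed
    moreover have "(\<Sum>i\<le>2. u i x * p $ 1 ^ i * p $ 2 ^ (2 - i)) =
        u 0 x * p $ 2 ^ 2 + u 1 x * p $ 1 * p $ 2 + u 2 x * p $ 1 ^ 2"
      by (simp add: numeral_2_eq_2)
    ultimately show "(\<Sum>i\<le>2. u i x * p $ 1 ^ i * p $ 2 ^ (2 - i)) = quadratic_form e1 e2 A B C x p"
      unfolding quadratic_form_def P1_def[symmetric] P2_def[symmetric] A_def B_def C_def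
      by (simp add: algebra_simps power2_eq_square)
  qed
qed

lemma coefficients_of_quadratic_form:
  assumes "smooth_on W A" "smooth_on W B" "smooth_on W C"
  obtains u where "\<And>i. i \<le> 2 \<Longrightarrow> smooth_on W (u i)"
    "\<And>x p. quadratic_form e1 e2 A B C x p = (\<Sum>i\<le>2. u i x * p $ 1 ^ i * p $ 2 ^ (2 - i))"
proof
  define u where "u i x = [A x * e1 x $ 2 ^ 2 + 2 * B x * e1 x $ 2 * e2 x $ 2 + C x * e2 x $ 2 ^ 2,
    2 * (A x * e1 x $ 1 * e1 x $ 2 + B x * (e1 x $ 1 * e2 x $ 2 + e1 x $ 2 * e2 x $ 1) + C x * e2 x $ 1 * e2 x $ 2),
    A x * e1 x $ 1 ^ 2 + 2 * B x * e1 x $ 1 * e2 x $ 1 + C x * e2 x $ 1 ^ 2] ! i" for i :: nat and x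
  show "smooth_on W (u i)" if "i \<le> 2" for i
  proof -
    have "i = 0 \<or> i = 1 \<or> i = 2" using that by auto
    then show ?thesis using assms by (auto simp: u_def[abs_def])
  qed
  show "quadratic_form e1 e2 A B C x p = (\<Sum>i\<le>2. u i x * p $ 1 ^ i * p $ 2 ^ (2 - i))" for x p
    by (simp add: numeral_2_eq_2 u_def quadratic_form_def inner_vec_def sum_2)
      (simp add: algebra_simps power2_eq_square)
qed

end

section \<open>The frame of the gradient of the curvature\<close>

context adapted_frame
begin

lemma quadratic_integral_iff:
  "quadratic_integral W E1 E2 a b K k A B C \<longleftrightarrow>
    smooth_on W A \<and> smooth_on W B \<and> smooth_on W C \<and>
    (\<forall>x\<in>W. D1 A x = 2 * a x * B x \<and> D2 C x = - 2 * b x * B x \<and>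
      D2 A x = - 2 * D1 B x - 2 * a x * (A x - C x) + 2 * b x * B x \<and>
      D1 C x = - 2 * D2 B x - 2 * b x * (A x - C x) - 2 * a x * B x)"
  by (auto simp: quadratic_integral_def quadratic_integral_axioms_def adapted_frame_axioms)

lemma quadratic_integral_sum:
  assumes "\<And>j. j \<in> I \<Longrightarrow> quadratic_integral W E1 E2 a b K k (A j) (B j) (C j)"
  shows "quadratic_integral W E1 E2 a b K k
    (\<lambda>x. \<Sum>j\<in>I. c j * A j x) (\<lambda>x. \<Sum>j\<in>I. c j * B j x) (\<lambda>x. \<Sum>j\<in>I. c j * C j x)"
proof -
  have sm: "smooth_on W (A j)" "smooth_on W (B j)" "smooth_on W (C j)" if "j \<in> I" for j
    using assms[OF that] unfolding quadratic_integral_iff by blast+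
  have D: "along e (\<lambda>x. \<Sum>j\<in>I. c j * f j x) x = (\<Sum>j\<in>I. c j * along e (f j) x)"
    if "\<And>j. j \<in> I \<Longrightarrow> smooth_on W (f j)" "x \<in> W" for e f x
    using that by (subst along_sum[where W = W]) (auto intro!: sum.cong)
  show ?thesis
    unfolding quadratic_integral_iff
  proof (intro conjI ballI)
    fix x assume x: "x \<in> W"
    have eqs: "D1 (A j) x = 2 * a x * B j x" "D2 (C j) x = - 2 * b x * B j x"
      "D2 (A j) x = - 2 * D1 (B j) x - 2 * a x * (A j x - C j x) + 2 * b x * B j x"
      "D1 (C j) x = - 2 * D2 (B j) x - 2 * b x * (A j x - C j x) - 2 * a x * B j x" if "j \<in> I" for j
      using assms[OF that] x unfolding quadratic_integral_iff by blast+
    have Ds: "along e (\<lambda>x. \<Sum>j\<in>I. c j * A j x) x = (\<Sum>j\<in>I. c j * along e (A j) x)"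
      "along e (\<lambda>x. \<Sum>j\<in>I. c j * B j x) x = (\<Sum>j\<in>I. c j * along e (B j) x)"
      "along e (\<lambda>x. \<Sum>j\<in>I. c j * C j x) x = (\<Sum>j\<in>I. c j * along e (C j) x)" for e
      by (rule D[OF _ x], rule sm, assumption)+
    show "D1 (\<lambda>x. \<Sum>j\<in>I. c j * A j x) x = 2 * a x * (\<Sum>j\<in>I. c j * B j x)"
      "D2 (\<lambda>x. \<Sum>j\<in>I. c j * C j x) x = - 2 * b x * (\<Sum>j\<in>I. c j * B j x)"
      unfolding Ds sum_distrib_left by (auto simp: eqs intro!: sum.cong)
    show "D2 (\<lambda>x. \<Sum>j\<in>I. c j * A j x) x = - 2 * D1 (\<lambda>x. \<Sum>j\<in>I. c j * B j x) x -
        2 * a x * ((\<Sum>j\<in>I. c j * A j x) - (\<Sum>j\<in>I. c j * C j x)) + 2 * b x * (\<Sum>j\<in>I. c j * B j x)"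
      "D1 (\<lambda>x. \<Sum>j\<in>I. c j * C j x) x = - 2 * D2 (\<lambda>x. \<Sum>j\<in>I. c j * B j x) x -
        2 * b x * ((\<Sum>j\<in>I. c j * A j x) - (\<Sum>j\<in>I. c j * C j x)) - 2 * a x * (\<Sum>j\<in>I. c j * B j x)"
      unfolding Ds sum_distrib_left sum_subtractf[symmetric] sum.distrib[symmetric]
      by (auto simp: eqs algebra_simps intro!: sum.cong)
  qed (use sm in simp_all)
qed

end

section \<open>The unit frame along the gradient of the curvature and its rotation\<close>

locale curved_patch = chart_metric +
  fixes \<epsilon> :: real
  assumes \<epsilon>: "\<epsilon> \<in> {1, -1}"
begin

abbreviation "K \<equiv> gauss_curvature g"
definition "k x = sqrt (I3 g x)"
definition "e1 x = (1 / k x) *\<^sub>R gradK g x"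
definition "e2 x = (1 / k x) *\<^sub>R sgradK g \<epsilon> x"

lemma gradK_components: "gradK g x $ i = matrix_inv (g x) $ i $ 1 * pd 1 K x + matrix_inv (g x) $ i $ 2 * pd 2 K x"
  by (simp add: gradK_def gradient_def matrix_vector_mult_def sum_2)

lemma smooth_gradK [simp]: "smooth_on V (\<lambda>x. gradK g x $ i)"
  by (simp add: gradK_components)

lemma g_gradK:
  assumes x: "x \<in> V"
  shows "(g x *v gradK g x) $ 1 = pd 1 K x" "(g x *v gradK g x) $ 2 = pd 2 K x"
proof -
  have "det (g x) \<noteq> 0" using det_pos[OF x] by simp
  then show "(g x *v gradK g x) $ 1 = pd 1 K x" "(g x *v gradK g x) $ 2 = pd 2 K x"
    by (simp_all add: matrix_vector_mult_def sum_2 gradK_components matrix_inv_2x2 field_simps)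
      (simp_all add: det_2 g_sym[OF x] algebra_simps)
qed

lemma I3_eq: "x \<in> V \<Longrightarrow> I3 g x = gradK g x $ 1 * pd 1 K x + gradK g x $ 2 * pd 2 K x"
  by (simp add: I3_def inner_vec_def sum_2 g_gradK)

lemma smooth_I3 [simp]: "smooth_on V (I3 g)"
  by (rule smooth_on_cong[of V "\<lambda>x. gradK g x $ 1 * pd 1 K x + gradK g x $ 2 * pd 2 K x"])
    (simp_all add: I3_eq)

lemma sgradK_components:
  assumes x: "x \<in> V"
  shows "sgradK g \<epsilon> x $ 1 = - (\<epsilon> / sqrt (det (g x)) * pd 2 K x)"
    "sgradK g \<epsilon> x $ 2 = \<epsilon> / sqrt (det (g x)) * pd 1 K x"
  by (simp_all add: sgradK_def rotate_right_angle_def g_gradK[OF x])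

lemma smooth_sgradK [simp]: "smooth_on V (\<lambda>x. sgradK g \<epsilon> x $ i)"
proof -
  have pos: "\<forall>x\<in>V. det (g x) > 0" using det_pos by blast
  have nz: "\<forall>x\<in>V. sqrt (det (g x)) \<noteq> 0" using det_pos by fastforce
  have "smooth_on V (\<lambda>x. - (\<epsilon> / sqrt (det (g x)) * pd 2 K x))"
    "smooth_on V (\<lambda>x. \<epsilon> / sqrt (det (g x)) * pd 1 K x)"
    using pos nz by simp_all
  from this[THEN smooth_on_cong[OF V_open]]
  have "smooth_on V (\<lambda>x. sgradK g \<epsilon> x $ 1)" "smooth_on V (\<lambda>x. sgradK g \<epsilon> x $ 2)"
    by (simp_all add: sgradK_components)
  then show ?thesis using exhaust_2[of i] by auto
qed

lemma sgradK_orthogonal: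
  assumes x: "x \<in> V"
  shows "gradK g x \<bullet> (g x *v sgradK g \<epsilon> x) = 0" "sgradK g \<epsilon> x \<bullet> (g x *v sgradK g \<epsilon> x) = I3 g x"
    "sgradK g \<epsilon> x $ 1 * pd 1 K x + sgradK g \<epsilon> x $ 2 * pd 2 K x = 0"
proof -
  define r where "r = \<epsilon> / sqrt (det (g x))"
  have d: "det (g x) > 0" using det_pos[OF x] .
  \<comment> \<open>Only the square of the orientation sign enters.\<close>
  have r: "r ^ 2 * det (g x) = 1" using \<epsilon> d by (auto simp: r_def power_divide)
  note s = sgradK_components[OF x, folded r_def]
  show "sgradK g \<epsilon> x $ 1 * pd 1 K x + sgradK g \<epsilon> x $ 2 * pd 2 K x = 0" by (simp add: s)
  have "gradK g x \<bullet> (g x *v sgradK g \<epsilon> x) =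
      sgradK g \<epsilon> x $ 1 * (g x *v gradK g x) $ 1 + sgradK g \<epsilon> x $ 2 * (g x *v gradK g x) $ 2"
    by (simp add: inner_vec_def matrix_vector_mult_def sum_2 g_sym[OF x] algebra_simps)
  then show "gradK g x \<bullet> (g x *v sgradK g \<epsilon> x) = 0" by (simp add: g_gradK[OF x] s)
  have "sgradK g \<epsilon> x \<bullet> (g x *v sgradK g \<epsilon> x) =
      r ^ 2 * (g x $ 2 $ 2 * pd 1 K x ^ 2 - 2 * g x $ 1 $ 2 * pd 1 K x * pd 2 K x + g x $ 1 $ 1 * pd 2 K x ^ 2)"
    by (simp add: inner_vec_def matrix_vector_mult_def sum_2 g_sym[OF x] s algebra_simps power2_eq_square)
  also have "\<dots> = r ^ 2 * det (g x) * I3 g x"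
    using d by (simp add: I3_eq[OF x] gradK_components matrix_inv_2x2 g_sym[OF x] field_simps power2_eq_square)
  finally show "sgradK g \<epsilon> x \<bullet> (g x *v sgradK g \<epsilon> x) = I3 g x" using r by simp
qed

lemma k_square: "I3 g x > 0 \<Longrightarrow> k x > 0 \<and> k x * k x = I3 g x"
  by (simp add: k_def)

lemma orthonormal_frame_gradK:
  assumes W: "open W" "convex W" "W \<subseteq> V" and pos: "\<And>x. x \<in> W \<Longrightarrow> I3 g x > 0"
  shows "orthonormal_frame V g W e1 e2"
proof
  have k: "smooth_on W k" "\<forall>x\<in>W. k x \<noteq> 0"
    using W smooth_on_subset[OF smooth_I3 W(3)] pos by (simp_all add: k_def[abs_def]) fastforce
  show "smooth_on W (\<lambda>x. e1 x $ i)" "smooth_on W (\<lambda>x. e2 x $ i)" for i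
    using k W smooth_on_subset[OF smooth_gradK[of i] W(3)] smooth_on_subset[OF smooth_sgradK[of i] W(3)]
    by (simp_all add: e1_def e2_def)
  show "e1 x \<bullet> (g x *v e1 x) = 1" "e1 x \<bullet> (g x *v e2 x) = 0" "e2 x \<bullet> (g x *v e2 x) = 1" if "x \<in> W" for x
    using sgradK_orthogonal[of x] k_square[OF pos[OF that]] W(3) that
    by (auto simp: e1_def e2_def matrix_vector_mult_scaleR I3_def[symmetric])
qed (use W in auto)

text \<open>These coefficients are independent of the domain \<open>W\<close>, so they stay the same
  when a frame is restricted to a smaller set.\<close>

abbreviation "\<alpha> \<equiv> orthonormal_frame.a g e1 e2"
abbreviation "\<beta> \<equiv> orthonormal_frame.b g e1 e2"

lemma adapted_frame_gradK:
  assumes W: "open W" "convex W" "W \<subseteq> V" and pos: "\<And>x. x \<in> W \<Longrightarrow> I3 g x > 0"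
  shows "adapted_frame W e1 e2 \<alpha> \<beta> K k"
proof -
  interpret orthonormal_frame V g W e1 e2 using orthonormal_frame_gradK[OF W pos] .
  show ?thesis
  proof
    show "smooth_on W K" by simp
    show "smooth_on W k" using pos by (simp add: k_def[abs_def])
    fix x assume x: "x \<in> W"
    note k = k_square[OF pos[OF x]]
    show "k x > 0" using k by blast
    have "along e1 K x = (gradK g x $ 1 * pd 1 K x + gradK g x $ 2 * pd 2 K x) / k x"
      using x by (simp add: along_eq_pd[where W = W] e1_def add_divide_distrib)
    also have "\<dots> = k x" using k I3_eq[OF W_V[OF x]] by (simp add: field_simps)
    finally show "along e1 K x = k x" .
    have "along e2 K x = (sgradK g \<epsilon> x $ 1 * pd 1 K x + sgradK g \<epsilon> x $ 2 * pd 2 K x) / k x"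
      using x by (simp add: along_eq_pd[where W = W] e2_def add_divide_distrib)
    then show "along e2 K x = 0" by (simp add: sgradK_orthogonal[OF W_V[OF x]])
    show "along e1 \<beta> x = along e2 \<alpha> x - \<alpha> x ^ 2 - \<beta> x ^ 2 - K x"
      using gauss_equation[OF x] by simp
  qed
qed

text \<open>On the gradient frame \<open>I4b\<close> is \<open>k ^ 3 * \<alpha>\<close> and
  \<open>J4\<close> is \<open>k ^ 7 * obstruction4\<close>; once \<open>\<alpha>\<close> vanishes
  identically, \<open>J5\<close> is \<open>k ^ 4 * obstruction5\<close>. Since \<open>k\<close> is
  positive, the two sets of conditions agree.\<close>

lemma invariants_frame:
  assumes W: "open W" "convex W" "W \<subseteq> V" and pos: "\<And>x. x \<in> W \<Longrightarrow> I3 g x > 0"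
  shows "(\<forall>x\<in>W. I4b g \<epsilon> x = 0 \<and> J5 g \<epsilon> x = 0 \<and> J4 g \<epsilon> x = 0) \<longleftrightarrow>
    (\<forall>x\<in>W. \<alpha> x = 0 \<and> adapted_frame.obstruction5 e1 \<beta> K k x = 0 \<and> adapted_frame.obstruction4 e1 \<beta> K k x = 0)"
proof -
  interpret orthonormal_frame V g W e1 e2 using orthonormal_frame_gradK[OF W pos] .
  interpret adapted_frame W e1 e2 \<alpha> \<beta> K k using adapted_frame_gradK[OF W pos] .
  have k2: "k x * k x = I3 g x" "k x \<noteq> 0" if "x \<in> W" for x using k_square[OF pos[OF that]] by auto
  have ge: "gradK g x = k x *\<^sub>R e1 x" "sgradK g \<epsilon> x = k x *\<^sub>R e2 x" if "x \<in> W" for x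
    using k2[OF that] by (simp_all add: e1_def e2_def)
  \<comment> \<open>The first derivatives of \<open>K\<close> along the frame are \<open>k\<close>
    and 0, so its Hessian involves only the derivatives of \<open>k\<close> and the
    connection.\<close>
  have H: "Hess K e1 e1 x = D1 k x" "Hess K e1 e2 x = \<alpha> x * k x" "Hess K e2 e1 x = \<alpha> x * k x"
    "Hess K e2 e2 x = \<beta> x * k x" if x: "x \<in> W" for x
    using D_cong[of "along e1 K" k x e1] D_cong[of "along e1 K" k x e2]
      D_cong[of "along e2 K" "\<lambda>_. 0" x e1] D_cong[of "along e2 K" "\<lambda>_. 0" x e2] x
    by (simp_all add: Hess_frame DK D2_k)
  have I4: "I4a g \<epsilon> x = k x ^ 2 * D1 k x" "I4b g \<epsilon> x = k x ^ 3 * \<alpha> x" "I4c g \<epsilon> x = k x ^ 3 * \<beta> x" if x: "x \<in> W" for x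
  proof -
    have "d_nabla g 2 K x [r *\<^sub>R u x, s *\<^sub>R v x] = r * s * Hess K u v x" for r s u v
      by (simp add: d_nabla_2[OF smooth_gauss_curvature W_V[OF x]] Hess_def algebra_simps)
    then show "I4a g \<epsilon> x = k x ^ 2 * D1 k x" "I4b g \<epsilon> x = k x ^ 3 * \<alpha> x" "I4c g \<epsilon> x = k x ^ 3 * \<beta> x"
      using x by (simp_all add: Inv_def numeral_2_eq_2 ge H) (simp_all add: power2_eq_square power3_eq_cube)
  qed
  have T: "Third K e1 e1 e1 x = D1 (D1 k) x - 2 * \<alpha> x ^ 2 * k x"
    "Third K e1 e2 e2 x = D1 \<beta> x * k x + \<beta> x * D1 k x + 2 * \<alpha> x ^ 2 * k x" if x: "x \<in> W" for x
    using D_cong[of "Hess K e1 e1" "D1 k" x e1] D_cong[of "Hess K e2 e2" "\<lambda>x. \<beta> x * k x" x e1] x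
    by (simp_all add: Third_frame H power2_eq_square)
  have I5: "I5a g \<epsilon> x = k x ^ 3 * Third K e1 e1 e1 x" "I5c g \<epsilon> x = k x ^ 3 * Third K e1 e2 e2 x" if x: "x \<in> W" for x
  proof -
    have "d_nabla g 3 K x [r *\<^sub>R u x, s *\<^sub>R v x, t *\<^sub>R w x] = r * s * t * Third K u v w x" for r s t u v w
      by (simp add: d_nabla_3[OF smooth_gauss_curvature W_V[OF x]] Third_def sum_2 algebra_simps)
    then show "I5a g \<epsilon> x = k x ^ 3 * Third K e1 e1 e1 x" "I5c g \<epsilon> x = k x ^ 3 * Third K e1 e2 e2 x"
      using x by (simp_all add: Inv_def numeral_2_eq_2 numeral_3_eq_3 ge)
  qed
  \<comment> \<open>\<open>I5c\<close> contains the derivative of \<open>\<beta>\<close> along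
    \<open>e1\<close>, and the Gauss equation brings in the derivative of \<open>\<alpha>\<close>
    along \<open>e2\<close>; hence both vanishing conditions.\<close>
  have J5: "J5 g \<epsilon> x = k x ^ 4 * obstruction5 x" if "x \<in> W" "\<alpha> x = 0" "D2 \<alpha> x = 0" for x
  proof -
    have b1: "D1 \<beta> x = - (\<beta> x * \<beta> x) - K x"
      using that gauss[OF that(1)] by (simp add: power2_eq_square)
    show ?thesis
      unfolding J5_def I5[OF that(1)] I4[OF that(1)] T[OF that(1)] k2[OF that(1), symmetric] I2_def obstruction5_def
      by (simp add: b1 that algebra_simps power2_eq_square power3_eq_cube power4_eq_xxxx)
  qed
  have J4: "J4 g \<epsilon> x = k x ^ 7 * obstruction4 x" if "x \<in> W" for x
    unfolding J4_def I4[OF that(1)] k2[OF that(1), symmetric] I2_def obstruction4_def by algebra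
  have D\<alpha>: "D2 \<alpha> x = 0" if "\<And>x. x \<in> W \<Longrightarrow> \<alpha> x = 0" "x \<in> W" for x
    using D_cong[of \<alpha> "\<lambda>_. 0" x e2] that by simp
  show ?thesis
  proof
    assume l: "\<forall>x\<in>W. I4b g \<epsilon> x = 0 \<and> J5 g \<epsilon> x = 0 \<and> J4 g \<epsilon> x = 0"
    then have 0: "\<alpha> x = 0" if "x \<in> W" for x using I4(2)[OF that] k2[OF that] that by auto
    show "\<forall>x\<in>W. \<alpha> x = 0 \<and> obstruction5 x = 0 \<and> obstruction4 x = 0"
      using l 0 J5[OF _ 0 D\<alpha>[OF 0]] J4 k2 by auto
  next
    assume r: "\<forall>x\<in>W. \<alpha> x = 0 \<and> obstruction5 x = 0 \<and> obstruction4 x = 0"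
    then show "\<forall>x\<in>W. I4b g \<epsilon> x = 0 \<and> J5 g \<epsilon> x = 0 \<and> J4 g \<epsilon> x = 0"
      using J5[OF _ _ D\<alpha>] J4 I4(2) by auto
  qed
qed

end

section \<open>Germs of quadratic integrals\<close>

lemma germ_at_eq_iff:
  "germ_at a F = germ_at a G \<longleftrightarrow> (\<exists>r>0. \<forall>x\<in>ball a r. F x = G x)"
proof -
  have "germ_at a F = germ_at a G \<longleftrightarrow> (\<forall>\<^sub>F h in nhds 0. F (a + h) = G (a + h))"
    unfolding germ_at_def by (rule fibre_germ.abs_eq_iff)
  also have "\<dots> \<longleftrightarrow> (\<exists>r>0. \<forall>h. norm h < r \<longrightarrow> F (a + h) = G (a + h))"
    by (simp add: eventually_nhds_metric dist_norm)
  also have "\<dots> \<longleftrightarrow> (\<exists>r>0. \<forall>x\<in>ball a r. F x = G x)"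
  proof (intro ex_cong1 conj_cong refl iffI ballI allI impI)
    fix r x assume *: "\<forall>h. norm h < r \<longrightarrow> F (a + h) = G (a + h)" and "x \<in> ball a r"
    then show "F x = G x" using *[rule_format, of "x - a"] by (simp add: dist_norm norm_minus_commute)
  next
    fix r h assume *: "\<forall>x\<in>ball a r. F x = G x" and "norm (h :: real^2) < r"
    then show "F (a + h) = G (a + h)" by (auto simp: dist_norm)
  qed
  finally show ?thesis .
qed

lemma germ_at_zero: "germ_at a (\<lambda>_ _. 0) = 0"
  by (simp add: germ_at_def zero_fibre_germ_def)

lemma germ_at_sum:
  "germ_at a (\<lambda>x p. \<Sum>j\<in>I. c j * F j x p) = (\<Sum>j\<in>I. c j *\<^sub>R germ_at a (F j))"
proof (induction I rule: infinite_finite_induct)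
  case (insert j I)
  have "germ_at a (\<lambda>x p. c j * F j x p + (\<Sum>j\<in>I. c j * F j x p)) =
      germ_at a (\<lambda>x p. c j * F j x p) + germ_at a (\<lambda>x p. \<Sum>j\<in>I. c j * F j x p)"
    by (simp add: germ_at_def plus_fibre_germ.abs_eq)
  also have "germ_at a (\<lambda>x p. c j * F j x p) = c j *\<^sub>R germ_at a (F j)"
    by (simp add: germ_at_def scaleR_fibre_germ.abs_eq)
  finally show ?case using insert by simp
qed (simp_all add: germ_at_zero)

text \<open>Two equal members of the family would satisfy a relation with coefficients 1 and -1, so
  the family is injective and sums over its range become sums over its indices.\<close>

lemma independent_family:
  fixes G :: "'n::finite \<Rightarrow> 'v::real_vector"
  assumes "\<And>c. (\<Sum>j\<in>UNIV. c j *\<^sub>R G j) = 0 \<Longrightarrow> \<forall>j. c j = 0"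
  shows "inj G" "independent (range G)"
proof -
  show inj: "inj G"
  proof (rule injI, rule ccontr)
    fix i j assume ij: "G i = G j" "i \<noteq> j"
    define c where "c l = (if l = i then 1 else if l = j then -1 else (0::real))" for l
    have "(\<Sum>l\<in>UNIV. c l *\<^sub>R G l) = (\<Sum>l\<in>{i, j}. c l *\<^sub>R G l)"
      by (rule sum.mono_neutral_right) (auto simp: c_def)
    also have "\<dots> = 0" using ij by (simp add: c_def)
    finally have "c i = 0" using assms by blast
    then show False by (simp add: c_def)
  qed
  show "independent (range G)"
  proof (rule independent_if_scalars_zero)
    fix f x assume *: "(\<Sum>x\<in>range G. f x *\<^sub>R x) = 0" and x: "x \<in> range G"
    have "(\<Sum>j\<in>UNIV. f (G j) *\<^sub>R G j) = 0"
      using * sum.reindex[OF inj, of "\<lambda>x. f x *\<^sub>R x"] by (simp add: o_def)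
    then show "f x = 0" using assms[of "\<lambda>j. f (G j)"] x by auto
  qed simp
qed

lemma vector_4_nth: "(vector [w, x, y, z] :: real^4) $ 1 = w" "(vector [w, x, y, z] :: real^4) $ 2 = x"
  "(vector [w, x, y, z] :: real^4) $ 3 = y" "(vector [w, x, y, z] :: real^4) $ 4 = z"
  unfolding vector_def by simp_all

context adapted_frame
begin

text \<open>The initial data of an integral at \<open>q\<close> as a vector of
  \<open>real^4\<close>, in the order \<open>T, B, Y, C\<close>.\<close>

definition values_at :: "real^2 \<Rightarrow> (real^2 \<Rightarrow> real) \<Rightarrow> (real^2 \<Rightarrow> real) \<Rightarrow> (real^2 \<Rightarrow> real) \<Rightarrow> real^4" where
  "values_at q A B C = vector [A q - C q, B q, D2 B q, C q]"

lemma values_at_sum: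
  assumes "q \<in> W" "\<And>j. j \<in> I \<Longrightarrow> smooth_on W (B j)"
  shows "values_at q (\<lambda>x. \<Sum>j\<in>I. c j * A j x) (\<lambda>x. \<Sum>j\<in>I. c j * B j x) (\<lambda>x. \<Sum>j\<in>I. c j * C j x) =
    (\<Sum>j\<in>I. c j *\<^sub>R values_at q (A j) (B j) (C j))"
proof -
  have "D2 (\<lambda>x. \<Sum>j\<in>I. c j * B j x) q = (\<Sum>j\<in>I. c j * D2 (B j) q)"
    using assms by (subst along_sum[where W = W]) (auto intro!: sum.cong)
  then show ?thesis
    by (simp add: values_at_def vec_eq_iff forall_4 vector_4_nth sum_subtractf algebra_simps)
qed

lemma values_at_eq_0_iff: "values_at q A B C = 0 \<longleftrightarrow> A q = 0 \<and> B q = 0 \<and> D2 B q = 0 \<and> C q = 0"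
  by (auto simp: values_at_def vec_eq_iff forall_4 vector_4_nth)

lemma quadratic_integral_zero:
  assumes "quadratic_integral W E1 E2 a b K k A B C" "q \<in> W" "values_at q A B C = 0" "x \<in> W"
  shows "A x = 0 \<and> B x = 0 \<and> C x = 0"
  using quadratic_integral.determined_by_values[OF assms(1,2)] assms(3,4)
  by (simp add: values_at_eq_0_iff)

end

section \<open>Germs of integrals and the dimension of their space\<close>

context curved_patch
begin

abbreviation "integral_on W \<equiv> quadratic_integral W e1 e2 \<alpha> \<beta> K k"
abbreviation "qform \<equiv> quadratic_form e1 e2"

definition "adapted_domain W \<longleftrightarrow> open W \<and> convex W \<and> W \<subseteq> V \<and> (\<forall>x\<in>W. I3 g x > 0)"

lemma adapted_domain_frame: "adapted_domain W \<Longrightarrow> orthonormal_frame V g W e1 e2" "adapted_domain W \<Longrightarrow> adapted_frame W e1 e2 \<alpha> \<beta> K k"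
  using orthonormal_frame_gradK adapted_frame_gradK by (auto simp: adapted_domain_def)

lemma adapted_domain_subset: "adapted_domain W \<Longrightarrow> W' \<subseteq> W \<Longrightarrow> open W' \<Longrightarrow> convex W' \<Longrightarrow> adapted_domain W'"
  by (auto simp: adapted_domain_def)

lemma integral_on_subset:
  assumes "adapted_domain W" "adapted_domain W'" "W' \<subseteq> W" "integral_on W A B C"
  shows "integral_on W' A B C"
  using assms(3,4) smooth_on_subset
  unfolding adapted_frame.quadratic_integral_iff[OF adapted_domain_frame(2)[OF assms(1)]]
    adapted_frame.quadratic_integral_iff[OF adapted_domain_frame(2)[OF assms(2)]]
  by blast

lemma germ_of_integral:
  assumes W: "adapted_domain W" "a \<in> W" and F: "integral_on W A B C"
  shows "germ_at a (qform A B C) \<in> integral_germs 2 V g a"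
proof -
  interpret orthonormal_frame V g W e1 e2 using adapted_domain_frame(1)[OF W(1)] .
  note F' = F[unfolded adapted_frame.quadratic_integral_iff[OF adapted_domain_frame(2)[OF W(1)]]]
  from coefficients_of_quadratic_form[of A B C] F' obtain u where u: "\<And>i. i \<le> 2 \<Longrightarrow> smooth_on W (u i)"
    "\<And>x p. qform A B C x p = (\<Sum>i\<le>2. u i x * p $ 1 ^ i * p $ 2 ^ (2 - i))" by blast
  have "poisson (hamiltonian g) (qform A B C) x p = 0" if "x \<in> W" for x p
    using poisson_eq_0_iff[of A B C "qform A B C" x] that F' by blast
  then show ?thesis
    using W W_sub W_open u unfolding integral_germs_def by (intro CollectI exI[of _ "qform A B C"] conjI refl exI[of _ W] exI[of _ u]) auto
qed

text \<open>A ball inside both the domain of the representative and \<open>W0\<close> is again an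
  adapted domain; there the coefficients are rewritten in frame momenta.\<close>

lemma integral_of_germ:
  assumes W0: "adapted_domain W0" "a \<in> W0" and G: "G \<in> integral_germs 2 V g a"
  obtains r A B C where "r > 0" "ball a r \<subseteq> W0" "integral_on (ball a r) A B C" "G = germ_at a (qform A B C)"
proof -
  from G obtain F W u where F: "G = germ_at a F" "open W" "a \<in> W" "\<And>i. i \<le> 2 \<Longrightarrow> smooth_on W (u i)"
    "\<And>x p. x \<in> W \<Longrightarrow> F x p = (\<Sum>i\<le>2. u i x * p $ 1 ^ i * p $ 2 ^ (2 - i))"
    "\<And>x p. x \<in> W \<Longrightarrow> poisson (hamiltonian g) F x p = 0"
    unfolding integral_germs_def by blast
  have "open (W \<inter> W0)" "a \<in> W \<inter> W0" using F W0 by (auto simp: adapted_domain_def)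
  then obtain r where r: "r > 0" "ball a r \<subseteq> W \<inter> W0" using open_contains_ball by blast
  have good: "adapted_domain (ball a r)" using adapted_domain_subset[OF W0(1)] r by simp
  interpret orthonormal_frame V g "ball a r" e1 e2 using adapted_domain_frame(1)[OF good] .
  have "smooth_on (ball a r) (u i)" if "i \<le> 2" for i
    using smooth_on_subset[OF F(4)[OF that]] r by blast
  from quadratic_form_of_coefficients[of u, OF this]
  obtain A B C where ABC: "smooth_on (ball a r) A" "smooth_on (ball a r) B" "smooth_on (ball a r) C"
    "\<And>x p. x \<in> ball a r \<Longrightarrow> (\<Sum>i\<le>2. u i x * p $ 1 ^ i * p $ 2 ^ (2 - i)) = qform A B C x p" by blast
  have Fq: "F x p = qform A B C x p" if "x \<in> ball a r" for x p
    using F(5) ABC(4)[OF that] r that by auto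
  show ?thesis
  proof
    show "G = germ_at a (qform A B C)"
      unfolding F(1) germ_at_eq_iff using r Fq by blast
    show "integral_on (ball a r) A B C"
      unfolding adapted_frame.quadratic_integral_iff[OF adapted_domain_frame(2)[OF good]]
      using ABC(1-3) poisson_eq_0_iff[OF ABC(1-3), of F] Fq F(6) r by blast
  qed (use r in auto)
qed

lemma germ_at_qform_sum:
  "(\<Sum>j\<in>I. c j *\<^sub>R germ_at a (qform (A j) (B j) (C j))) =
    germ_at a (qform (\<lambda>x. \<Sum>j\<in>I. c j * A j x) (\<lambda>x. \<Sum>j\<in>I. c j * B j x) (\<lambda>x. \<Sum>j\<in>I. c j * C j x))"
proof -
  have "(\<Sum>j\<in>I. c j * qform (A j) (B j) (C j) x p) =
      qform (\<lambda>x. \<Sum>j\<in>I. c j * A j x) (\<lambda>x. \<Sum>j\<in>I. c j * B j x) (\<lambda>x. \<Sum>j\<in>I. c j * C j x) x p" for x p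
    by (simp add: quadratic_form_def sum_distrib_left sum_distrib_right sum.distrib algebra_simps)
  then show ?thesis unfolding germ_at_sum[symmetric] by presburger
qed

text \<open>Unique continuation: a vanishing germ has vanishing initial data at \<open>a\<close>,
  and these determine the integral on all of \<open>W\<close>.\<close>

lemma germ_eq_0_iff:
  assumes W: "adapted_domain W" "a \<in> W" and F: "integral_on W A B C"
  shows "germ_at a (qform A B C) = 0 \<longleftrightarrow> (\<forall>x\<in>W. A x = 0 \<and> B x = 0 \<and> C x = 0)"
proof
  interpret orthonormal_frame V g W e1 e2 using adapted_domain_frame(1)[OF W(1)] .
  interpret adapted_frame W e1 e2 \<alpha> \<beta> K k using adapted_domain_frame(2)[OF W(1)] .
  assume "germ_at a (qform A B C) = 0"
  then obtain r where r: "r > 0" "\<And>x. x \<in> ball a r \<Longrightarrow> qform A B C x = (\<lambda>_. 0)"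
    unfolding germ_at_zero[symmetric, of a] germ_at_eq_iff by blast
  have "open (W \<inter> ball a r)" "a \<in> W \<inter> ball a r" using W r by auto
  have zero: "A x = 0 \<and> B x = 0 \<and> C x = 0" if "x \<in> W \<inter> ball a r" for x
    using quadratic_form_eq_0_iff[of x A B C] r that by simp
  have "D2 B a = D2 (\<lambda>_. 0) a"
    by (rule along_cong[of "W \<inter> ball a r"]) (use zero \<open>a \<in> W \<inter> ball a r\<close> in auto)
  then have "values_at a A B C = 0"
    using zero[OF \<open>a \<in> W \<inter> ball a r\<close>] by (simp add: values_at_eq_0_iff)
  then show "\<forall>x\<in>W. A x = 0 \<and> B x = 0 \<and> C x = 0"
    using quadratic_integral_zero[OF F W(2)] by blast
next
  assume *: "\<forall>x\<in>W. A x = 0 \<and> B x = 0 \<and> C x = 0"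
  have "open W" using W by (simp add: adapted_domain_def)
  then obtain r where "r > 0" "ball a r \<subseteq> W" using W open_contains_ball by blast
  then show "germ_at a (qform A B C) = 0"
    unfolding germ_at_zero[symmetric, of a] germ_at_eq_iff using *
    by (intro exI[of _ r]) (auto simp: quadratic_form_def fun_eq_iff subset_iff)
qed

text \<open>Four independent integrals live on a common ball; by counting dimensions their
  combinations realise all initial data at every point of it, which is what
  \<open>obstructions_vanish\<close> asks for.\<close>

lemma conditions_of_dim:
  assumes W0: "adapted_domain W0" "a \<in> W0" and dim: "dim (integral_germs 2 V g a) = 4"
  obtains W where "adapted_domain W" "a \<in> W"
    "\<forall>x\<in>W. I4b g \<epsilon> x = 0 \<and> J5 g \<epsilon> x = 0 \<and> J4 g \<epsilon> x = 0"
proof -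
  obtain S where S: "S \<subseteq> integral_germs 2 V g a" "independent S" "card S = 4"
    using basis_exists[of "integral_germs 2 V g a"] dim by metis
  \<comment> \<open>An infinite set has cardinality 0, so cardinality 4 forces finiteness.\<close>
  then have "finite S" by (metis card.infinite zero_neq_numeral)
  then obtain h :: "4 \<Rightarrow> fibre_germ" where h: "bij_betw h UNIV S"
    using finite_same_card_bij[of "UNIV :: 4 set" S] S(3) by auto
  have indep: "c j = 0" if c: "(\<Sum>j\<in>UNIV. c j *\<^sub>R h j) = 0" for c j
  proof -
    have "(\<Sum>v\<in>S. c (inv_into UNIV h v) *\<^sub>R v) = (\<Sum>j\<in>UNIV. c (inv_into UNIV h (h j)) *\<^sub>R h j)"
      by (rule sum.reindex_bij_betw[OF h, symmetric])
    also have "\<dots> = 0" using c h by (simp add: bij_betw_def)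
    finally have "c (inv_into UNIV h (h j)) = 0"
      using independentD[OF S(2) \<open>finite S\<close> subset_refl, of "\<lambda>v. c (inv_into UNIV h v)" "h j"] h
      by (auto simp: bij_betw_def)
    then show ?thesis using h by (simp add: bij_betw_def)
  qed
  have "\<forall>j. \<exists>r A B C. r > 0 \<and> ball a r \<subseteq> W0 \<and> integral_on (ball a r) A B C \<and> h j = germ_at a (qform A B C)"
  proof
    fix j
    have "h j \<in> integral_germs 2 V g a" using S h by (auto simp: bij_betw_def)
    then show "\<exists>r A B C. r > 0 \<and> ball a r \<subseteq> W0 \<and> integral_on (ball a r) A B C \<and> h j = germ_at a (qform A B C)"
      using integral_of_germ[OF W0] by metis
  qed
  then obtain r A B C where rep: "\<And>j. r j > 0" "\<And>j. ball a (r j) \<subseteq> W0"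
    "\<And>j. integral_on (ball a (r j)) (A j) (B j) (C j)" "\<And>j. h j = germ_at a (qform (A j) (B j) (C j))"
    by metis
  \<comment> \<open>The smallest of the four radii makes all four representatives integrals on one
    ball.\<close>
  define W where "W = ball a (Min (range r))"
  have Wr: "W \<subseteq> ball a (r j)" for j unfolding W_def by (intro subset_ball Min_le) auto
  have aW: "a \<in> W" using rep(1) by (simp add: W_def Min_gr_iff)
  have good: "adapted_domain W" using adapted_domain_subset[OF W0(1), of W] Wr rep(2) by (simp add: W_def) blast
  have goodr: "adapted_domain (ball a (r j))" for j using adapted_domain_subset[OF W0(1) rep(2)] by simp
  have int: "integral_on W (A j) (B j) (C j)" for j
    using integral_on_subset[OF goodr good Wr rep(3)] .
  interpret orthonormal_frame V g W e1 e2 using adapted_domain_frame(1)[OF good] .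
  interpret adapted_frame W e1 e2 \<alpha> \<beta> K k using adapted_domain_frame(2)[OF good] .
  have smB: "smooth_on W (B j)" for j using int[of j] by (simp add: quadratic_integral_iff)
  define sA where "sA c x = (\<Sum>j\<in>UNIV. c $ j * A j x)" for c :: "real^4" and x
  define sB where "sB c x = (\<Sum>j\<in>UNIV. c $ j * B j x)" for c :: "real^4" and x
  define sC where "sC c x = (\<Sum>j\<in>UNIV. c $ j * C j x)" for c :: "real^4" and x
  have ints: "integral_on W (sA c) (sB c) (sC c)" for c
    unfolding sA_def[abs_def] sB_def[abs_def] sC_def[abs_def] by (rule quadratic_integral_sum) (rule int)
  have ex: "\<exists>A B C. integral_on W A B C \<and> values_at q A B C = w" if q: "q \<in> W" for q w
  proof -
    \<comment> \<open>The map from combinations to initial data at \<open>q\<close>. It is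
      injective, because vanishing data at \<open>q\<close> kill the combination on
      \<open>W\<close>, hence also its germ at \<open>a\<close>; between spaces of dimension 4 it is
      then onto.\<close>
    define f where "f c = values_at q (sA c) (sB c) (sC c)" for c
    have f: "f c = (\<Sum>j\<in>UNIV. c $ j *\<^sub>R values_at q (A j) (B j) (C j))" for c
      unfolding f_def sA_def[abs_def] sB_def[abs_def] sC_def[abs_def]
      by (rule values_at_sum[OF q]) (rule smB)
    have lin: "linear f"
      by (rule linearI) (simp_all add: f algebra_simps sum.distrib scaleR_sum_right)
    have "c = 0" if "f c = 0" for c
    proof -
      have "\<forall>x\<in>W. sA c x = 0 \<and> sB c x = 0 \<and> sC c x = 0"
        using quadratic_integral_zero[OF ints q] that by (simp add: f_def)
      then have "germ_at a (qform (sA c) (sB c) (sC c)) = 0"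
        using germ_eq_0_iff[OF good aW ints] by blast
      then have "(\<Sum>j\<in>UNIV. c $ j *\<^sub>R h j) = 0"
        unfolding rep(4) germ_at_qform_sum sA_def[abs_def] sB_def[abs_def] sC_def[abs_def] .
      from indep[OF this] show "c = 0" by (simp add: vec_eq_iff)
    qed
    then have "inj f" using lin by (simp add: linear_injective_0)
    then have "surj f" using linear_injective_imp_surjective[OF lin] by simp
    then obtain c where "w = f c" by (rule surjE)
    then have "values_at q (sA c) (sB c) (sC c) = w" by (simp add: f_def)
    with ints[of c] show ?thesis by (intro exI conjI)
  qed
  have "\<alpha> x = 0" "obstruction5 x = 0" "obstruction4 x = 0" if "x \<in> W" for x
  proof -
    have "\<exists>A B C. integral_on W A B C \<and> A q - C q = t \<and> B q = \<beta> \<and> along e2 B q = y" if "q \<in> W" for q t \<beta> y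
      using ex[OF that, of "vector [t, \<beta>, y, 0]"] by (auto simp: values_at_def vec_eq_iff forall_4 vector_4_nth)
    from obstructions_vanish[OF this that] show "\<alpha> x = 0" "obstruction5 x = 0" "obstruction4 x = 0" by auto
  qed
  then have "\<forall>x\<in>W. I4b g \<epsilon> x = 0 \<and> J5 g \<epsilon> x = 0 \<and> J4 g \<epsilon> x = 0"
    using invariants_frame[of W] good by (simp add: adapted_domain_def)
  then show ?thesis using that good aW by blast
qed

text \<open>The germs whose initial data at \<open>a\<close> are the standard basis vectors form a
  basis: the data are linear in the integral and determine it.\<close>

lemma dim_of_conditions:
  assumes W: "adapted_domain W" "a \<in> W"
    and cond: "\<forall>x\<in>W. I4b g \<epsilon> x = 0 \<and> J5 g \<epsilon> x = 0 \<and> J4 g \<epsilon> x = 0"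
  shows "dim (integral_germs 2 V g a) = 4"
proof -
  interpret orthonormal_frame V g W e1 e2 using adapted_domain_frame(1)[OF W(1)] .
  interpret adapted_frame W e1 e2 \<alpha> \<beta> K k using adapted_domain_frame(2)[OF W(1)] .
  have ob: "\<alpha> x = 0" "obstruction5 x = 0" "obstruction4 x = 0" if "x \<in> W" for x
    using invariants_frame[of W] W(1) cond that by (auto simp: adapted_domain_def)
  have "\<exists>A B C. integral_on W A B C \<and> values_at a A B C = w" for w
  proof -
    have "w = vector [w $ 1, w $ 2, w $ 3, w $ 4]" by (simp add: vec_eq_iff forall_4 vector_4_nth)
    then show ?thesis
      using quadratic_integral_exists[OF ob W(2), of "w $ 1" "w $ 2" "w $ 3" "w $ 4"]
      unfolding values_at_def by metis
  qed
  then obtain A B C where int: "\<And>w. integral_on W (A w) (B w) (C w)" "\<And>w. values_at a (A w) (B w) (C w) = w"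
    by metis
  define A' where "A' j = A (axis j 1)" for j :: 4
  define B' where "B' j = B (axis j 1)" for j :: 4
  define C' where "C' j = C (axis j 1)" for j :: 4
  have int': "integral_on W (A' j) (B' j) (C' j)" and val': "values_at a (A' j) (B' j) (C' j) = axis j 1" for j
    using int by (simp_all add: A'_def B'_def C'_def)
  have smB: "smooth_on W (B' j)" for j using int'[of j] by (simp add: quadratic_integral_iff)
  define G where "G j = germ_at a (qform (A' j) (B' j) (C' j))" for j
  have vals: "values_at a (\<lambda>x. \<Sum>j\<in>UNIV. c j * A' j x) (\<lambda>x. \<Sum>j\<in>UNIV. c j * B' j x) (\<lambda>x. \<Sum>j\<in>UNIV. c j * C' j x) =
      (\<chi> j. c j)" for c
    using smB by (subst values_at_sum[OF W(2)])
      (simp_all add: val' vec_eq_iff axis_def if_distrib[of "\<lambda>y. _ * y"] cong: if_cong)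
  have ints: "integral_on W (\<lambda>x. \<Sum>j\<in>UNIV. c j * A' j x) (\<lambda>x. \<Sum>j\<in>UNIV. c j * B' j x) (\<lambda>x. \<Sum>j\<in>UNIV. c j * C' j x)" for c
    by (rule quadratic_integral_sum) (rule int')
  have "\<forall>j. c j = 0" if "(\<Sum>j\<in>UNIV. c j *\<^sub>R G j) = 0" for c
  proof -
    have z: "\<forall>x\<in>W. (\<Sum>j\<in>UNIV. c j * A' j x) = 0 \<and> (\<Sum>j\<in>UNIV. c j * B' j x) = 0 \<and> (\<Sum>j\<in>UNIV. c j * C' j x) = 0"
      using that germ_eq_0_iff[OF W ints] unfolding G_def germ_at_qform_sum by blast
    have "D2 (\<lambda>x. \<Sum>j\<in>UNIV. c j * B' j x) a = D2 (\<lambda>_. 0) a"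
      by (rule D_cong[OF _ W(2)]) (use z in blast)
    then have "values_at a (\<lambda>x. \<Sum>j\<in>UNIV. c j * A' j x) (\<lambda>x. \<Sum>j\<in>UNIV. c j * B' j x) (\<lambda>x. \<Sum>j\<in>UNIV. c j * C' j x) = 0"
      using z W(2) by (simp add: values_at_eq_0_iff)
    then show ?thesis unfolding vals by (simp add: vec_eq_iff)
  qed
  from independent_family[OF this] have G: "inj G" "independent (range G)" by blast+
  show ?thesis
  proof (rule dim_unique[OF _ _ G(2)])
    show "card (range G) = 4" using G(1) by (simp add: card_image)
    show "range G \<subseteq> integral_germs 2 V g a"
      unfolding G_def using germ_of_integral[OF W int'] by blast
    show "integral_germs 2 V g a \<subseteq> span (range G)"
    proof
      fix F assume "F \<in> integral_germs 2 V g a"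
      from integral_of_germ[OF W this] obtain r P Q R where F: "r > 0" "ball a r \<subseteq> W"
        "integral_on (ball a r) P Q R" "F = germ_at a (qform P Q R)" by blast
      have good: "adapted_domain (ball a r)" using adapted_domain_subset[OF W(1) F(2)] by simp
      interpret W': adapted_frame "ball a r" e1 e2 \<alpha> \<beta> K k using adapted_domain_frame(2)[OF good] .
      define c where "c = values_at a P Q R"
      have c': "integral_on (ball a r) (\<lambda>x. \<Sum>j\<in>UNIV. c $ j * A' j x) (\<lambda>x. \<Sum>j\<in>UNIV. c $ j * B' j x) (\<lambda>x. \<Sum>j\<in>UNIV. c $ j * C' j x)"
        using integral_on_subset[OF W(1) good F(2) ints] .
      \<comment> \<open>The difference of the given integral and its candidate expansion, written as
        a sum over \<open>bool\<close> with coefficients 1 and -1 so that the lemmas on finite sums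
        apply. Its initial data at \<open>a\<close> vanish.\<close>
      define d where "d i = (if i then 1 else - 1 :: real)" for i
      define A2 where "A2 i = (if i then P else (\<lambda>x. \<Sum>j\<in>UNIV. c $ j * A' j x))" for i
      define B2 where "B2 i = (if i then Q else (\<lambda>x. \<Sum>j\<in>UNIV. c $ j * B' j x))" for i
      define C2 where "C2 i = (if i then R else (\<lambda>x. \<Sum>j\<in>UNIV. c $ j * C' j x))" for i
      have i2: "integral_on (ball a r) (A2 i) (B2 i) (C2 i)" for i
        using F(3) c' by (simp add: A2_def B2_def C2_def)
      have i2s: "integral_on (ball a r) (\<lambda>x. \<Sum>i\<in>UNIV. d i * A2 i x) (\<lambda>x. \<Sum>i\<in>UNIV. d i * B2 i x)
          (\<lambda>x. \<Sum>i\<in>UNIV. d i * C2 i x)"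
        by (rule W'.quadratic_integral_sum) (rule i2)
      have v2: "values_at a (A2 i) (B2 i) (C2 i) = c" for i
        using vals[of "($) c"] by (simp add: A2_def B2_def C2_def c_def)
      have aB: "a \<in> ball a r" using F by simp
      have "values_at a (\<lambda>x. \<Sum>i\<in>UNIV. d i * A2 i x) (\<lambda>x. \<Sum>i\<in>UNIV. d i * B2 i x) (\<lambda>x. \<Sum>i\<in>UNIV. d i * C2 i x) =
          (\<Sum>i\<in>UNIV. d i *\<^sub>R values_at a (A2 i) (B2 i) (C2 i))"
        by (rule W'.values_at_sum[OF aB]) (use i2 in \<open>simp add: W'.quadratic_integral_iff\<close>)
      also have "\<dots> = 0" by (simp add: v2 UNIV_bool d_def)
      finally have "germ_at a (qform (\<lambda>x. \<Sum>i\<in>UNIV. d i * A2 i x) (\<lambda>x. \<Sum>i\<in>UNIV. d i * B2 i x) (\<lambda>x. \<Sum>i\<in>UNIV. d i * C2 i x)) = 0"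
        using germ_eq_0_iff[OF good aB i2s] W'.quadratic_integral_zero[OF i2s aB] by blast
      then have "(\<Sum>i\<in>UNIV. d i *\<^sub>R germ_at a (qform (A2 i) (B2 i) (C2 i))) = 0"
        by (simp only: germ_at_qform_sum)
      then have "germ_at a (qform P Q R) = germ_at a (qform (\<lambda>x. \<Sum>j\<in>UNIV. c $ j * A' j x)
          (\<lambda>x. \<Sum>j\<in>UNIV. c $ j * B' j x) (\<lambda>x. \<Sum>j\<in>UNIV. c $ j * C' j x))"
        unfolding UNIV_bool by (simp add: d_def A2_def B2_def C2_def)
      also have "\<dots> = (\<Sum>j\<in>UNIV. c $ j *\<^sub>R G j)"
        unfolding G_def by (rule germ_at_qform_sum[symmetric])
      finally have "germ_at a (qform P Q R) = (\<Sum>j\<in>UNIV. c $ j *\<^sub>R G j)" .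
      then show "F \<in> span (range G)"
        unfolding F(4) by (simp add: span_sum span_scale span_base)
    qed
  qed
qed

end

section \<open>Passage from the chart to the surface\<close>

theorem theorem2:
  fixes M :: "'a topology" and A :: "'a chart set" and g :: "'a chart \<Rightarrow> metric"
    and U :: "'a set" and \<phi> :: "'a \<Rightarrow> real^2" and p0 :: 'a and \<epsilon> :: real
  assumes "smooth_surface M A"
    and "riemannian_metric A g"
    and "(U, \<phi>) \<in> A" and "p0 \<in> U"
    and "\<epsilon> \<in> {1, -1}"
    and "frechet_derivative (gauss_curvature (g (U, \<phi>))) (at (\<phi> p0)) \<noteq> (\<lambda>_. 0)"
  shows "dim (integral_germs 2 (\<phi> ` U) (g (U, \<phi>)) (\<phi> p0)) = 4 \<longleftrightarrow>
    (\<exists>N. openin M N \<and> p0 \<in> N \<and> N \<subseteq> U \<and>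
      (\<forall>q\<in>N. I4b (g (U, \<phi>)) \<epsilon> (\<phi> q) = 0 \<and>
             J5 (g (U, \<phi>)) \<epsilon> (\<phi> q) = 0 \<and>
             J4 (g (U, \<phi>)) \<epsilon> (\<phi> q) = 0))"
proof -
  define V where "V = \<phi> ` U"
  define h where "h = g (U, \<phi>)"
  define a where "a = \<phi> p0"
  have chart: "openin M U" "open V" "homeomorphic_map (subtopology M U) (top_of_set V) \<phi>"
    using assms(1,3) by (auto simp: smooth_surface_def V_def)
  have smooth: "smooth_on V (\<lambda>x. h x $ i $ j)"
    and sym: "x \<in> V \<Longrightarrow> transpose (h x) = h x"
    and pos: "x \<in> V \<Longrightarrow> v \<noteq> 0 \<Longrightarrow> v \<bullet> (h x *v v) > 0" for i j x v
    using bspec[OF conjunct1[OF assms(2)[unfolded riemannian_metric_def]] assms(3)]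
    by (auto simp: V_def h_def)
  interpret curved_patch V h \<epsilon>
    by unfold_locales (use chart(2) smooth sym pos assms(5) in auto)
  have aV: "a \<in> V" using assms(4) by (simp add: a_def V_def)
  have "frechet_derivative K (at a) \<noteq> (\<lambda>_. 0)" using assms(6) by (simp add: h_def a_def)
  then obtain v where "frechet_derivative K (at a) v \<noteq> 0" by (auto simp: fun_eq_iff)
  then have "pd 1 K a \<noteq> 0 \<or> pd 2 K a \<noteq> 0"
    using frechet_smooth[OF smooth_gauss_curvature aV] by auto
  then have "gradK h a \<noteq> 0"
    using g_gradK[OF aV] by auto
  then have I3a: "I3 h a > 0" using positive[OF aV] by (simp add: I3_def)
  \<comment> \<open>The gradient frame exists where \<open>I3\<close> is positive, an open condition
    that holds at \<open>a\<close>.\<close>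
  define V0 where "V0 = V \<inter> I3 h -` {0<..}"
  have V0: "open V0" "a \<in> V0"
    unfolding V0_def using continuous_open_preimage[OF smooth_on_continuous[OF smooth_I3] V_open] aV I3a
    by auto
  then obtain r0 where r0: "r0 > 0" "ball a r0 \<subseteq> V0" using open_contains_ball by blast
  have good0: "adapted_domain (ball a r0)" and a0: "a \<in> ball a r0"
    using r0 by (auto simp: adapted_domain_def V0_def)
  have "dim (integral_germs 2 V h a) = 4 \<longleftrightarrow>
    (\<exists>N. openin M N \<and> p0 \<in> N \<and> N \<subseteq> U \<and>
      (\<forall>q\<in>N. I4b h \<epsilon> (\<phi> q) = 0 \<and> J5 h \<epsilon> (\<phi> q) = 0 \<and> J4 h \<epsilon> (\<phi> q) = 0))"
  proof
    assume "dim (integral_germs 2 V h a) = 4"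
    from conditions_of_dim[OF good0 a0 this] obtain W where W: "adapted_domain W" "a \<in> W"
      "\<forall>x\<in>W. I4b h \<epsilon> x = 0 \<and> J5 h \<epsilon> x = 0 \<and> J4 h \<epsilon> x = 0" by blast
    \<comment> \<open>The neighbourhood is pulled back through the chart; the homeomorphism property
      makes it open in \<open>M\<close>.\<close>
    define N where "N = {q \<in> U. \<phi> q \<in> W}"
    have "openin (top_of_set V) W" using W(1) by (simp add: adapted_domain_def openin_open_eq)
    with homeomorphic_imp_continuous_map[OF chart(3)]
    have "openin (subtopology M U) {q \<in> topspace (subtopology M U). \<phi> q \<in> W}"
      by (rule openin_continuous_map_preimage)
    moreover have "topspace (subtopology M U) = U"
      using openin_subset[OF chart(1)] by auto
    ultimately have "openin (subtopology M U) N" by (simp only: N_def)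
    then have "openin M N" using chart(1) by (rule openin_trans_full)
    then show "\<exists>N. openin M N \<and> p0 \<in> N \<and> N \<subseteq> U \<and>
      (\<forall>q\<in>N. I4b h \<epsilon> (\<phi> q) = 0 \<and> J5 h \<epsilon> (\<phi> q) = 0 \<and> J4 h \<epsilon> (\<phi> q) = 0)"
      using W assms(4) by (intro exI[of _ N]) (auto simp: N_def a_def)
  next
    assume "\<exists>N. openin M N \<and> p0 \<in> N \<and> N \<subseteq> U \<and>
      (\<forall>q\<in>N. I4b h \<epsilon> (\<phi> q) = 0 \<and> J5 h \<epsilon> (\<phi> q) = 0 \<and> J4 h \<epsilon> (\<phi> q) = 0)"
    then obtain N where N: "openin M N" "p0 \<in> N" "N \<subseteq> U"
      "\<forall>q\<in>N. I4b h \<epsilon> (\<phi> q) = 0 \<and> J5 h \<epsilon> (\<phi> q) = 0 \<and> J4 h \<epsilon> (\<phi> q) = 0" by blast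
    have "openin (subtopology M U) N" using N(1,3) by (simp add: openin_open_subtopology chart(1))
    then have "openin (top_of_set V) (\<phi> ` N)"
      using homeomorphic_imp_open_map[OF chart(3)] by (simp add: open_map_def)
    then have "open (\<phi> ` N)" using chart(2) by (simp add: openin_open_eq)
    then have "open (\<phi> ` N \<inter> ball a r0)" "a \<in> \<phi> ` N \<inter> ball a r0"
      using N(2) a0 by (auto simp: a_def)
    \<comment> \<open>Passing to a ball restores the convexity of an adapted domain.\<close>
    then obtain r where r: "r > 0" "ball a r \<subseteq> \<phi> ` N \<inter> ball a r0"
      using open_contains_ball by blast
    have "adapted_domain (ball a r)" using adapted_domain_subset[OF good0] r by simp
    then show "dim (integral_germs 2 V h a) = 4"
    proof (rule dim_of_conditions)
      show "\<forall>x\<in>ball a r. I4b h \<epsilon> x = 0 \<and> J5 h \<epsilon> x = 0 \<and> J4 h \<epsilon> x = 0"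
        using r(2) N(4) by blast
    qed (use r in simp)
  qed
  then show ?thesis by (simp only: V_def h_def a_def)
qed

end
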